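(* Let $R$ be an associative ring, let $\mathbb G$ be a right Gabriel topology on $R$ having a countable base consisting of finitely generated right ideals, and let $\mathfrak R=\varprojlim_{I\in\mathbb G}R/I$ be the completion of $R$ with respect to $\mathbb G$, viewed as a topological ring in the projective limit topology. Then the forgetful functor $\mathfrak R\text{-contra}\to R\text{-mod}$ is fully faithful. Consequently, the natural surjective map of abelian groups $$\mathcal N\otimes_R\mathfrak C\longrightarrow\mathcal N\odot_{\mathfrak R}\mathfrak C$$ is an isomorphism for any left $\mathfrak R$-contramodule $\mathfrak C$ and any discrete right $\mathfrak R$-module $\mathcal N$. In particular, one has $I\mathfrak C=\mathfrak I\rightthreetimes\mathfrak C\subset\mathfrak C$ for any left $\mathfrak R$-contramodule $\mathfrak C$, any open right ideal $I\in\mathbb G$ in $R$, and the related open right ideal $\mathfrak I=\ker(\mathfrak R\to R/I)$ in $\mathfrak R$.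
   Context: Rings are associative and unital; $R\text{-mod}$ is the category of left $R$-modules. A right Gabriel topology on $R$ is a set $\mathbb G$ of right ideals such that: (T0) $R\in\mathbb G$; (T1) a right ideal containing an element of $\mathbb G$ is in $\mathbb G$; (T2) $I,J\in\mathbb G$ implies $I\cap J\in\mathbb G$; (T3) $I\in\mathbb G$, $s\in R$ implies $(I:s)=\{r\in R: sr\in I\}\in\mathbb G$; (T4) if $I$ is a right ideal and there is $J\in\mathbb G$ with $(I:s)\in\mathbb G$ for all $s\in J$, then $I\in\mathbb G$. A base is a subset $\mathbb B\subset\mathbb G$ such that every element of $\mathbb G$ contains an element of $\mathbb B$. $\mathfrak R$ has as a base of neighborhoods of zero the open right ideals $\mathfrak I=\ker(\mathfrak R\to R/I)$, $I\in\mathbb G$, and the unique topological ring structure making the natural map $R\to\mathfrak R$ a ring homomorphism. A right $\mathfrak R$-module $\mathcal N$ is discrete if the annihilator of each of its elements is an open right ideal. For a set $X$ and an abelian group $A$ put $A[X]=A^{(X)}$, and $\mathfrak R[[X]]=\varprojlim_{\mathfrak I}(\mathfrak R/\mathfrak I)[X]$ over open right ideals; equivalently, the set of formal sums $\sum_{x\in X}r_xx$ with $r_x\in\mathfrak R$ converging to zero (for each open $\mathfrak I$ all but finitely many $r_x$ lie in $\mathfrak I$). $\mathfrak I[[X]]\subset\mathfrak R[[X]]$ denotes the sums with all coefficients in $\mathfrak I$. The functor $X\mapsto\mathfrak R[[X]]$ (on maps: push-forward, summing coefficients) is a monad on sets, with unit $x\mapsto1\cdot x$ and multiplication opening parentheses.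 A left $\mathfrak R$-contramodule is a module (algebra) over this monad: a set $\mathfrak C$ with a map $\pi_{\mathfrak C}\colon\mathfrak R[[\mathfrak C]]\to\mathfrak C$ satisfying associativity and unitality; morphisms are maps compatible with the $\pi$'s. Restricting $\pi_{\mathfrak C}$ to finite formal sums makes $\mathfrak C$ a left $\mathfrak R$-module; restricting scalars along $R\to\mathfrak R$ gives the forgetful functor $\mathfrak R\text{-contra}\to R\text{-mod}$. The contratensor product $\mathcal N\odot_{\mathfrak R}\mathfrak C$ is the cokernel of the difference of the two maps $\mathcal N\otimes_{\mathbb Z}\mathfrak R[[\mathfrak C]]\rightrightarrows\mathcal N\otimes_{\mathbb Z}\mathfrak C$, one being $\mathcal N\otimes\pi_{\mathfrak C}$ and the other $b\otimes\sum_cr_cc\mapsto\sum_c br_c\otimes c$ (a finite sum since $\mathcal N$ is discrete). It is naturally a quotient of $\mathcal N\otimes_{\mathfrak R}\mathfrak C$, hence of $\mathcal N\otimes_R\mathfrak C$, and this is the natural surjective map of the claim. $I\mathfrak C$ is the subgroup of $\mathfrak C$ spanned by all $rc$, $r\in I$, $c\in\mathfrak C$; $\mathfrak I\rightthreetimes\mathfrak C$ is the image of $\mathfrak I[[\mathfrak C]]\subset\mathfrak R[[\mathfrak C]]$ under $\pi_{\mathfrak C}$. *)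

theory Defs
  imports
    "HOL-Analysis.Analysis"
    "HOL-Algebra.Free_Abelian_Groups"
    "HOL-Algebra.Generated_Groups"
    "HOL-Algebra.Ideal"
    "HOL-Algebra.Module"
    "HOL-Algebra.IntRing"
begin

section \<open>Right ideals and Gabriel topologies\<close>

definition right_ideal :: "'a set \<Rightarrow> ('a, 'm) ring_scheme \<Rightarrow> bool" where
  "right_ideal I R \<longleftrightarrow>
     additive_subgroup I R \<and> (\<forall>x\<in>I. \<forall>r\<in>carrier R. x \<otimes>\<^bsub>R\<^esub> r \<in> I)"

definition gen_right_ideal :: "('a, 'm) ring_scheme \<Rightarrow> 'a set \<Rightarrow> 'a set" where
  "gen_right_ideal R A = \<Inter>{I. right_ideal I R \<and> A \<subseteq> I}"

definition fg_right_ideal :: "'a set \<Rightarrow> ('a, 'm) ring_scheme \<Rightarrow> bool" where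
  "fg_right_ideal I R \<longleftrightarrow>
     right_ideal I R \<and> (\<exists>A. finite A \<and> A \<subseteq> carrier R \<and> I = gen_right_ideal R A)"

definition colon :: "('a, 'm) ring_scheme \<Rightarrow> 'a set \<Rightarrow> 'a \<Rightarrow> 'a set" where
  "colon R I s = {r \<in> carrier R. s \<otimes>\<^bsub>R\<^esub> r \<in> I}"

locale right_gabriel_topology =
  fixes R (structure) and \<G> :: "'a set set"
  assumes right_ideals: "I \<in> \<G> \<Longrightarrow> right_ideal I R"
    and T0: "carrier R \<in> \<G>"
    and T1: "\<lbrakk>I \<in> \<G>; right_ideal J R; I \<subseteq> J\<rbrakk> \<Longrightarrow> J \<in> \<G>"
    and T2: "\<lbrakk>I \<in> \<G>; J \<in> \<G>\<rbrakk> \<Longrightarrow> I \<inter> J \<in> \<G>"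
    and T3: "\<lbrakk>I \<in> \<G>; s \<in> carrier R\<rbrakk> \<Longrightarrow> colon R I s \<in> \<G>"
    and T4: "\<lbrakk>right_ideal I R; J \<in> \<G>; \<And>s. s \<in> J \<Longrightarrow> colon R I s \<in> \<G>\<rbrakk> \<Longrightarrow> I \<in> \<G>"

definition gabriel_base :: "'a set set \<Rightarrow> 'a set set \<Rightarrow> bool" where
  "gabriel_base \<G> \<B> \<longleftrightarrow> \<B> \<subseteq> \<G> \<and> (\<forall>I\<in>\<G>. \<exists>J\<in>\<B>. J \<subseteq> I)"


section \<open>The completion of a ring with respect to a Gabriel topology\<close>

text \<open>
  An element of the completion is a compatible family of cosets \<open>x I \<in> R/I\<close>; the
  transition map \<open>R/I \<rightarrow> R/J\<close> for \<open>I \<subseteq> J\<close> sends a coset \<open>A\<close> to \<open>J + A\<close>.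

  The groups \<open>R/I\<close> are only right modules.  If \<open>x I = a + I\<close>, then left multiplication by
  \<open>a\<close> is a well-defined map \<open>R/(I : a) \<rightarrow> R/I\<close>, and the component of \<open>x y\<close> at \<open>I\<close> is the
  image of \<open>y (I : a)\<close> under it.  The union in the definition ranges over all
  representatives; all the cosets occurring in it coincide.  This is the unique
  multiplication that is continuous for the projective limit topology and turns
  \<open>completion_map\<close> into a ring homomorphism.
\<close>

definition gabriel_completion :: "('a, 'm) ring_scheme \<Rightarrow> 'a set set \<Rightarrow> ('a set \<Rightarrow> 'a set) ring" where
  "gabriel_completion R \<G> =
    \<lparr>carrier = {x \<in> \<Pi>\<^sub>E I\<in>\<G>. a_rcosets\<^bsub>R\<^esub> I.
                  \<forall>I\<in>\<G>. \<forall>J\<in>\<G>. I \<subseteq> J \<longrightarrow> J <+>\<^bsub>R\<^esub> x I = x J},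
     mult = (\<lambda>x y. \<lambda>I\<in>\<G>. \<Union>a\<in>x I. \<Union>b\<in>y (colon R I a). I +>\<^bsub>R\<^esub> (a \<otimes>\<^bsub>R\<^esub> b)),
     one = (\<lambda>I\<in>\<G>. I +>\<^bsub>R\<^esub> \<one>\<^bsub>R\<^esub>),
     zero = (\<lambda>I\<in>\<G>. I),
     add = (\<lambda>x y. \<lambda>I\<in>\<G>. x I <+>\<^bsub>R\<^esub> y I)\<rparr>"

definition completion_topology ::
    "('a, 'm) ring_scheme \<Rightarrow> 'a set set \<Rightarrow> ('a set \<Rightarrow> 'a set) topology" where
  "completion_topology R \<G> =
     subtopology (product_topology (\<lambda>I. discrete_topology (a_rcosets\<^bsub>R\<^esub> I)) \<G>)
       (carrier (gabriel_completion R \<G>))"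

definition completion_map :: "('a, 'm) ring_scheme \<Rightarrow> 'a set set \<Rightarrow> 'a \<Rightarrow> 'a set \<Rightarrow> 'a set" where
  "completion_map R \<G> r = (\<lambda>I\<in>\<G>. I +>\<^bsub>R\<^esub> r)"

definition completion_ideal ::
    "('a, 'm) ring_scheme \<Rightarrow> 'a set set \<Rightarrow> 'a set \<Rightarrow> ('a set \<Rightarrow> 'a set) set" where
  "completion_ideal R \<G> I = kernel (add_monoid (gabriel_completion R \<G>)) (R A_Mod I) (\<lambda>x. x I)"


section \<open>Modules over noncommutative rings\<close>

locale left_module = R?: ring R + M?: abelian_group M for R (structure) and M (structure) +
  assumes smult_closed: "\<lbrakk>a \<in> carrier R; x \<in> carrier M\<rbrakk> \<Longrightarrow> a \<odot>\<^bsub>M\<^esub> x \<in> carrier M"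
    and smult_l_distr: "\<lbrakk>a \<in> carrier R; b \<in> carrier R; x \<in> carrier M\<rbrakk> \<Longrightarrow>
      (a \<oplus>\<^bsub>R\<^esub> b) \<odot>\<^bsub>M\<^esub> x = a \<odot>\<^bsub>M\<^esub> x \<oplus>\<^bsub>M\<^esub> b \<odot>\<^bsub>M\<^esub> x"
    and smult_r_distr: "\<lbrakk>a \<in> carrier R; x \<in> carrier M; y \<in> carrier M\<rbrakk> \<Longrightarrow>
      a \<odot>\<^bsub>M\<^esub> (x \<oplus>\<^bsub>M\<^esub> y) = a \<odot>\<^bsub>M\<^esub> x \<oplus>\<^bsub>M\<^esub> a \<odot>\<^bsub>M\<^esub> y"
    and smult_assoc: "\<lbrakk>a \<in> carrier R; b \<in> carrier R; x \<in> carrier M\<rbrakk> \<Longrightarrow>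
      (a \<otimes>\<^bsub>R\<^esub> b) \<odot>\<^bsub>M\<^esub> x = a \<odot>\<^bsub>M\<^esub> (b \<odot>\<^bsub>M\<^esub> x)"
    and smult_one: "x \<in> carrier M \<Longrightarrow> \<one>\<^bsub>R\<^esub> \<odot>\<^bsub>M\<^esub> x = x"

text \<open>For a right module, \<open>a \<odot> x\<close> denotes \<open>x a\<close>.\<close>

locale right_module = R?: ring R + M?: abelian_group M for R (structure) and M (structure) +
  assumes smult_closed: "\<lbrakk>a \<in> carrier R; x \<in> carrier M\<rbrakk> \<Longrightarrow> a \<odot>\<^bsub>M\<^esub> x \<in> carrier M"
    and smult_l_distr: "\<lbrakk>a \<in> carrier R; b \<in> carrier R; x \<in> carrier M\<rbrakk> \<Longrightarrow>
      (a \<oplus>\<^bsub>R\<^esub> b) \<odot>\<^bsub>M\<^esub> x = a \<odot>\<^bsub>M\<^esub> x \<oplus>\<^bsub>M\<^esub> b \<odot>\<^bsub>M\<^esub> x"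
    and smult_r_distr: "\<lbrakk>a \<in> carrier R; x \<in> carrier M; y \<in> carrier M\<rbrakk> \<Longrightarrow>
      a \<odot>\<^bsub>M\<^esub> (x \<oplus>\<^bsub>M\<^esub> y) = a \<odot>\<^bsub>M\<^esub> x \<oplus>\<^bsub>M\<^esub> a \<odot>\<^bsub>M\<^esub> y"
    and smult_assoc: "\<lbrakk>a \<in> carrier R; b \<in> carrier R; x \<in> carrier M\<rbrakk> \<Longrightarrow>
      (a \<otimes>\<^bsub>R\<^esub> b) \<odot>\<^bsub>M\<^esub> x = b \<odot>\<^bsub>M\<^esub> (a \<odot>\<^bsub>M\<^esub> x)"
    and smult_one: "x \<in> carrier M \<Longrightarrow> \<one>\<^bsub>R\<^esub> \<odot>\<^bsub>M\<^esub> x = x"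

definition lmod_hom ::
    "('r, 'k) ring_scheme \<Rightarrow> ('r, 'm, 'i) module_scheme \<Rightarrow> ('r, 'n, 'j) module_scheme \<Rightarrow> ('m \<Rightarrow> 'n) set" where
  "lmod_hom R M N =
     {f \<in> carrier M \<rightarrow>\<^sub>E carrier N.
        (\<forall>x\<in>carrier M. \<forall>y\<in>carrier M. f (x \<oplus>\<^bsub>M\<^esub> y) = f x \<oplus>\<^bsub>N\<^esub> f y) \<and>
        (\<forall>r\<in>carrier R. \<forall>x\<in>carrier M. f (r \<odot>\<^bsub>M\<^esub> x) = r \<odot>\<^bsub>N\<^esub> f x)}"

definition restrict_scalars :: "('r \<Rightarrow> 's) \<Rightarrow> ('s, 'm, 'i) module_scheme \<Rightarrow> ('r, 'm) module" where
  "restrict_scalars h M =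
    \<lparr>carrier = carrier M, mult = mult M, one = one M, zero = zero M, add = add M,
     smult = (\<lambda>r x. h r \<odot>\<^bsub>M\<^esub> x)\<rparr>"

definition int_module :: "('m, 'i) ring_scheme \<Rightarrow> (int, 'm) module" where
  "int_module M =
    \<lparr>carrier = carrier M, mult = mult M, one = one M, zero = zero M, add = add M,
     smult = (\<lambda>k x. [k] \<cdot>\<^bsub>M\<^esub> x)\<rparr>"


section \<open>Tensor products\<close>

text \<open>\<open>tensor A N M\<close> is \<open>N \<otimes>\<^sub>A M\<close> for a right \<open>A\<close>-module \<open>N\<close> and a left \<open>A\<close>-module \<open>M\<close>.\<close>

definition tensor_relations ::
    "('r, 'k) ring_scheme \<Rightarrow> ('r, 'n, 'i) module_scheme \<Rightarrow> ('r, 'm, 'j) module_scheme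
      \<Rightarrow> ('n \<times> 'm \<Rightarrow>\<^sub>0 int) set" where
  "tensor_relations A N M =
    {frag_of (x \<oplus>\<^bsub>N\<^esub> x', y) - frag_of (x, y) - frag_of (x', y) | x x' y.
       x \<in> carrier N \<and> x' \<in> carrier N \<and> y \<in> carrier M} \<union>
    {frag_of (x, y \<oplus>\<^bsub>M\<^esub> y') - frag_of (x, y) - frag_of (x, y') | x y y'.
       x \<in> carrier N \<and> y \<in> carrier M \<and> y' \<in> carrier M} \<union>
    {frag_of (a \<odot>\<^bsub>N\<^esub> x, y) - frag_of (x, a \<odot>\<^bsub>M\<^esub> y) | a x y.
       a \<in> carrier A \<and> x \<in> carrier N \<and> y \<in> carrier M}"

definition tensor_kernel ::
    "('r, 'k) ring_scheme \<Rightarrow> ('r, 'n, 'i) module_scheme \<Rightarrow> ('r, 'm, 'j) module_scheme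
      \<Rightarrow> ('n \<times> 'm \<Rightarrow>\<^sub>0 int) set" where
  "tensor_kernel A N M =
     generate (free_Abelian_group (carrier N \<times> carrier M)) (tensor_relations A N M)"

definition tensor ::
    "('r, 'k) ring_scheme \<Rightarrow> ('r, 'n, 'i) module_scheme \<Rightarrow> ('r, 'm, 'j) module_scheme
      \<Rightarrow> ('n \<times> 'm \<Rightarrow>\<^sub>0 int) set monoid" where
  "tensor A N M = free_Abelian_group (carrier N \<times> carrier M) Mod tensor_kernel A N M"

definition pure_tensor ::
    "('r, 'k) ring_scheme \<Rightarrow> ('r, 'n, 'i) module_scheme \<Rightarrow> ('r, 'm, 'j) module_scheme
      \<Rightarrow> 'n \<Rightarrow> 'm \<Rightarrow> ('n \<times> 'm \<Rightarrow>\<^sub>0 int) set" where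
  "pure_tensor A N M x y =
     tensor_kernel A N M #>\<^bsub>free_Abelian_group (carrier N \<times> carrier M)\<^esub> frag_of (x, y)"

text \<open>
  The homomorphism \<open>N \<otimes>\<^sub>A M \<rightarrow> G\<close> given on pure tensors by \<open>x \<otimes> y \<mapsto> \<phi> x y\<close>.  It is unique,
  because pure tensors generate, and it exists when \<open>\<phi>\<close> is biadditive and \<open>A\<close>-balanced
  and \<open>G\<close> is abelian.
\<close>

definition tensor_lift ::
    "('r, 'k) ring_scheme \<Rightarrow> ('r, 'n, 'i) module_scheme \<Rightarrow> ('r, 'm, 'j) module_scheme
      \<Rightarrow> ('g, 'l) monoid_scheme \<Rightarrow> ('n \<Rightarrow> 'm \<Rightarrow> 'g) \<Rightarrow> ('n \<times> 'm \<Rightarrow>\<^sub>0 int) set \<Rightarrow> 'g" where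
  "tensor_lift A N M G \<phi> =
     (THE h. h \<in> hom (tensor A N M) G \<and> h \<in> extensional (carrier (tensor A N M)) \<and>
        (\<forall>x\<in>carrier N. \<forall>y\<in>carrier M. h (pure_tensor A N M x y) = \<phi> x y))"


section \<open>Contramodules over a topological ring\<close>

text \<open>
  A topological ring is given by its ring structure \<open>S\<close> and its topology \<open>T\<close>; the notions
  below are meant for complete separated \<open>S\<close> in which the open right ideals form a base of
  neighborhoods of zero.
\<close>

definition open_right_ideal :: "'s set \<Rightarrow> ('s, 'k) ring_scheme \<Rightarrow> 's topology \<Rightarrow> bool" where
  "open_right_ideal J S T \<longleftrightarrow> right_ideal J S \<and> openin T J"

text \<open>The set \<open>S[[X]]\<close>, a formal sum being given by its family of coefficients.\<close>

definition formal_sums :: "('s, 'k) ring_scheme \<Rightarrow> 's topology \<Rightarrow> 'x set \<Rightarrow> ('x \<Rightarrow> 's) set" where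
  "formal_sums S T X =
     {s \<in> X \<rightarrow>\<^sub>E carrier S. \<forall>J. open_right_ideal J S T \<longrightarrow> finite {x \<in> X. s x \<notin> J}}"

definition formal_unit :: "('s, 'k) ring_scheme \<Rightarrow> 'x set \<Rightarrow> 'x \<Rightarrow> 'x \<Rightarrow> 's" where
  "formal_unit S X x = (\<lambda>y\<in>X. if y = x then \<one>\<^bsub>S\<^esub> else \<zero>\<^bsub>S\<^esub>)"

definition formal_zero :: "('s, 'k) ring_scheme \<Rightarrow> 'x set \<Rightarrow> 'x \<Rightarrow> 's" where
  "formal_zero S X = (\<lambda>x\<in>X. \<zero>\<^bsub>S\<^esub>)"

definition formal_add ::
    "('s, 'k) ring_scheme \<Rightarrow> 'x set \<Rightarrow> ('x \<Rightarrow> 's) \<Rightarrow> ('x \<Rightarrow> 's) \<Rightarrow> 'x \<Rightarrow> 's" where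
  "formal_add S X s t = (\<lambda>x\<in>X. s x \<oplus>\<^bsub>S\<^esub> t x)"

definition formal_scale :: "('s, 'k) ring_scheme \<Rightarrow> 'x set \<Rightarrow> 's \<Rightarrow> ('x \<Rightarrow> 's) \<Rightarrow> 'x \<Rightarrow> 's" where
  "formal_scale S X r s = (\<lambda>x\<in>X. r \<otimes>\<^bsub>S\<^esub> s x)"

text \<open>The left \<open>S\<close>-module \<open>S[[X]]\<close>.\<close>

definition formal_module :: "('s, 'k) ring_scheme \<Rightarrow> 's topology \<Rightarrow> 'x set \<Rightarrow> ('s, 'x \<Rightarrow> 's) module" where
  "formal_module S T X =
    \<lparr>carrier = formal_sums S T X, mult = undefined, one = undefined,
     zero = formal_zero S X, add = formal_add S X, smult = formal_scale S X\<rparr>"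

text \<open>
  The limit in \<open>T\<close> of the finite partial sums of a family indexed by \<open>X\<close>; it is unique
  when \<open>T\<close> is Hausdorff.
\<close>

definition conv_sum :: "('s, 'k) ring_scheme \<Rightarrow> 's topology \<Rightarrow> ('x \<Rightarrow> 's) \<Rightarrow> 'x set \<Rightarrow> 's" where
  "conv_sum S T f X =
     (THE l. limitin T (\<lambda>F. finsum S f F) l (finite_subsets_at_top X))"

definition push_forward ::
    "('s, 'k) ring_scheme \<Rightarrow> 's topology \<Rightarrow> 'x set \<Rightarrow> 'y set \<Rightarrow> ('x \<Rightarrow> 'y) \<Rightarrow> ('x \<Rightarrow> 's) \<Rightarrow> 'y \<Rightarrow> 's" where
  "push_forward S T X Y f s = (\<lambda>y\<in>Y. conv_sum S T s {x \<in> X. f x = y})"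

text \<open>The monad multiplication \<open>S[[S[[X]]]] \<rightarrow> S[[X]]\<close>.\<close>

definition open_parens ::
    "('s, 'k) ring_scheme \<Rightarrow> 's topology \<Rightarrow> 'x set \<Rightarrow> (('x \<Rightarrow> 's) \<Rightarrow> 's) \<Rightarrow> 'x \<Rightarrow> 's" where
  "open_parens S T X w =
     (\<lambda>x\<in>X. conv_sum S T (\<lambda>s. w s \<otimes>\<^bsub>S\<^esub> s x) (formal_sums S T X))"

record ('s, 'c) contramodule = "'c partial_object" +
  contra_act :: "('c \<Rightarrow> 's) \<Rightarrow> 'c"

locale contramodule =
  fixes S :: "('s, 'k) ring_scheme" and T :: "'s topology"
    and C :: "('s, 'c, 'i) contramodule_scheme"
  assumes contra_act_closed:
      "s \<in> formal_sums S T (carrier C) \<Longrightarrow> contra_act C s \<in> carrier C"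
    and contra_act_unit:
      "c \<in> carrier C \<Longrightarrow> contra_act C (formal_unit S (carrier C) c) = c"
    and contra_act_assoc:
      "w \<in> formal_sums S T (formal_sums S T (carrier C)) \<Longrightarrow>
        contra_act C (push_forward S T (formal_sums S T (carrier C)) (carrier C) (contra_act C) w) =
        contra_act C (open_parens S T (carrier C) w)"

definition contra_hom ::
    "('s, 'k) ring_scheme \<Rightarrow> 's topology \<Rightarrow> ('s, 'c, 'i) contramodule_scheme
      \<Rightarrow> ('s, 'd, 'j) contramodule_scheme \<Rightarrow> ('c \<Rightarrow> 'd) set" where
  "contra_hom S T C D =
     {f \<in> carrier C \<rightarrow>\<^sub>E carrier D.
        \<forall>s\<in>formal_sums S T (carrier C).
          f (contra_act C s) = contra_act D (push_forward S T (carrier C) (carrier D) f s)}"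

text \<open>The left \<open>S\<close>-module structure given by the finite formal sums \<open>0\<close>, \<open>1 c + 1 d\<close> and \<open>r c\<close>.\<close>

definition contra_module :: "('s, 'k) ring_scheme \<Rightarrow> ('s, 'c, 'i) contramodule_scheme \<Rightarrow> ('s, 'c) module" where
  "contra_module S C =
    \<lparr>carrier = carrier C, mult = undefined, one = undefined,
     zero = contra_act C (formal_zero S (carrier C)),
     add = (\<lambda>c d. contra_act C
       (formal_add S (carrier C) (formal_unit S (carrier C) c) (formal_unit S (carrier C) d))),
     smult = (\<lambda>r c. contra_act C (formal_scale S (carrier C) r (formal_unit S (carrier C) c)))\<rparr>"

text \<open>\<open>ideal_contra J\<close> is the image of \<open>J[[C]]\<close> under the contraaction.\<close>

definition ideal_contra ::
    "('s, 'k) ring_scheme \<Rightarrow> 's topology \<Rightarrow> 's set \<Rightarrow> ('s, 'c, 'i) contramodule_scheme \<Rightarrow> 'c set" where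
  "ideal_contra S T J C =
     contra_act C ` {s \<in> formal_sums S T (carrier C). \<forall>c\<in>carrier C. s c \<in> J}"

definition ideal_smult :: "'r set \<Rightarrow> ('r, 'm, 'i) module_scheme \<Rightarrow> 'm set" where
  "ideal_smult I M = generate (add_monoid M) {r \<odot>\<^bsub>M\<^esub> x | r x. r \<in> I \<and> x \<in> carrier M}"


section \<open>Discrete modules and the contratensor product\<close>

definition discrete_right_module ::
    "('s, 'k) ring_scheme \<Rightarrow> 's topology \<Rightarrow> ('s, 'n, 'i) module_scheme \<Rightarrow> bool" where
  "discrete_right_module S T N \<longleftrightarrow> right_module S N \<and>
     (\<forall>b\<in>carrier N. open_right_ideal {r \<in> carrier S. r \<odot>\<^bsub>N\<^esub> b = \<zero>\<^bsub>N\<^esub>} S T)"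

text \<open>The abelian groups \<open>N \<otimes>\<^sub>\<int> C\<close> and \<open>N \<otimes>\<^sub>\<int> S[[C]]\<close>.\<close>

abbreviation contra_int_tensor ::
    "('s, 'k) ring_scheme \<Rightarrow> ('s, 'n, 'i) module_scheme \<Rightarrow> ('s, 'c, 'j) contramodule_scheme
      \<Rightarrow> ('n \<times> 'c \<Rightarrow>\<^sub>0 int) set monoid" where
  "contra_int_tensor S N C \<equiv> tensor \<Z> (int_module N) (int_module (contra_module S C))"

abbreviation contra_int_pure ::
    "('s, 'k) ring_scheme \<Rightarrow> ('s, 'n, 'i) module_scheme \<Rightarrow> ('s, 'c, 'j) contramodule_scheme
      \<Rightarrow> 'n \<Rightarrow> 'c \<Rightarrow> ('n \<times> 'c \<Rightarrow>\<^sub>0 int) set" where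
  "contra_int_pure S N C \<equiv> pure_tensor \<Z> (int_module N) (int_module (contra_module S C))"

abbreviation formal_int_tensor ::
    "('s, 'k) ring_scheme \<Rightarrow> 's topology \<Rightarrow> ('s, 'n, 'i) module_scheme
      \<Rightarrow> ('s, 'c, 'j) contramodule_scheme \<Rightarrow> ('n \<times> ('c \<Rightarrow> 's) \<Rightarrow>\<^sub>0 int) set monoid" where
  "formal_int_tensor S T N C \<equiv>
     tensor \<Z> (int_module N) (int_module (formal_module S T (carrier C)))"

text \<open>
  The two maps \<open>N \<otimes>\<^sub>\<int> S[[C]] \<rightarrow> N \<otimes>\<^sub>\<int> C\<close>, whose difference has the contratensor product
  as its cokernel.
\<close>

definition contratensor_act ::
    "('s, 'k) ring_scheme \<Rightarrow> 's topology \<Rightarrow> ('s, 'n, 'i) module_scheme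
      \<Rightarrow> ('s, 'c, 'j) contramodule_scheme
      \<Rightarrow> ('n \<times> ('c \<Rightarrow> 's) \<Rightarrow>\<^sub>0 int) set \<Rightarrow> ('n \<times> 'c \<Rightarrow>\<^sub>0 int) set" where
  "contratensor_act S T N C =
     tensor_lift \<Z> (int_module N) (int_module (formal_module S T (carrier C)))
       (contra_int_tensor S N C) (\<lambda>b s. contra_int_pure S N C b (contra_act C s))"

definition contratensor_eval ::
    "('s, 'k) ring_scheme \<Rightarrow> 's topology \<Rightarrow> ('s, 'n, 'i) module_scheme
      \<Rightarrow> ('s, 'c, 'j) contramodule_scheme
      \<Rightarrow> ('n \<times> ('c \<Rightarrow> 's) \<Rightarrow>\<^sub>0 int) set \<Rightarrow> ('n \<times> 'c \<Rightarrow>\<^sub>0 int) set" where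
  "contratensor_eval S T N C =
     tensor_lift \<Z> (int_module N) (int_module (formal_module S T (carrier C)))
       (contra_int_tensor S N C)
       (\<lambda>b s. finprod (contra_int_tensor S N C) (\<lambda>c. contra_int_pure S N C (s c \<odot>\<^bsub>N\<^esub> b) c)
                {c \<in> carrier C. s c \<odot>\<^bsub>N\<^esub> b \<noteq> \<zero>\<^bsub>N\<^esub>})"

definition contratensor_image ::
    "('s, 'k) ring_scheme \<Rightarrow> 's topology \<Rightarrow> ('s, 'n, 'i) module_scheme
      \<Rightarrow> ('s, 'c, 'j) contramodule_scheme \<Rightarrow> ('n \<times> 'c \<Rightarrow>\<^sub>0 int) set set" where
  "contratensor_image S T N C =
     (\<lambda>t. contratensor_act S T N C t \<otimes>\<^bsub>contra_int_tensor S N C\<^esub>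
           inv\<^bsub>contra_int_tensor S N C\<^esub> contratensor_eval S T N C t)
       ` carrier (formal_int_tensor S T N C)"

definition contratensor ::
    "('s, 'k) ring_scheme \<Rightarrow> 's topology \<Rightarrow> ('s, 'n, 'i) module_scheme
      \<Rightarrow> ('s, 'c, 'j) contramodule_scheme \<Rightarrow> ('n \<times> 'c \<Rightarrow>\<^sub>0 int) set set monoid" where
  "contratensor S T N C = contra_int_tensor S N C Mod contratensor_image S T N C"

definition pure_contratensor ::
    "('s, 'k) ring_scheme \<Rightarrow> 's topology \<Rightarrow> ('s, 'n, 'i) module_scheme
      \<Rightarrow> ('s, 'c, 'j) contramodule_scheme \<Rightarrow> 'n \<Rightarrow> 'c \<Rightarrow> ('n \<times> 'c \<Rightarrow>\<^sub>0 int) set set" where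
  "pure_contratensor S T N C b c =
     contratensor_image S T N C #>\<^bsub>contra_int_tensor S N C\<^esub> contra_int_pure S N C b c"


section \<open>The forgetful functor and the comparison map\<close>

text \<open>
  The forgetful functor from contramodules over the completion to left \<open>R\<close>-modules.  It
  is given by \<open>forget\<close> on objects and does not change the underlying maps.
\<close>

definition forget ::
    "('a, 'm) ring_scheme \<Rightarrow> 'a set set \<Rightarrow> ('a set \<Rightarrow> 'a set, 'c, 'i) contramodule_scheme
      \<Rightarrow> ('a, 'c) module" where
  "forget R \<G> C = restrict_scalars (completion_map R \<G>) (contra_module (gabriel_completion R \<G>) C)"

abbreviation forget_right ::
    "('a, 'm) ring_scheme \<Rightarrow> 'a set set \<Rightarrow> ('a set \<Rightarrow> 'a set, 'n, 'i) module_scheme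
      \<Rightarrow> ('a, 'n) module" where
  "forget_right R \<G> N \<equiv> restrict_scalars (completion_map R \<G>) N"

definition contratensor_comparison ::
    "('a, 'm) ring_scheme \<Rightarrow> 'a set set \<Rightarrow> ('a set \<Rightarrow> 'a set, 'n, 'i) module_scheme
      \<Rightarrow> ('a set \<Rightarrow> 'a set, 'c, 'j) contramodule_scheme
      \<Rightarrow> ('n \<times> 'c \<Rightarrow>\<^sub>0 int) set \<Rightarrow> ('n \<times> 'c \<Rightarrow>\<^sub>0 int) set set" where
  "contratensor_comparison R \<G> N C =
     tensor_lift R (forget_right R \<G> N) (forget R \<G> C)
       (contratensor (gabriel_completion R \<G>) (completion_topology R \<G>) N C)
       (pure_contratensor (gabriel_completion R \<G>) (completion_topology R \<G>) N C)"

end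

theory Submission
  imports Defs
begin

text \<open>
  Let \<open>\<RR>\<close> be the completion and \<open>\<pi>\<close> the action of \<open>\<RR>[[C]]\<close> on a contramodule \<open>C\<close>.  All three
  assertions come from one property of \<open>\<RR>\<close>: a right ideal \<open>I = a\<^sub>1 R + \<dots> + a\<^sub>m R\<close> in the base
  stays finitely generated for infinite sums.  By T4 all the right ideals \<open>a\<^sub>1 K + \<dots> + a\<^sub>m K\<close> with
  \<open>K \<in> \<G>\<close> belong to \<open>\<G>\<close> again (\<open>right_span_G\<close>).  Hence the map \<open>(t\<^sub>j) \<mapsto> \<Sum> a\<^sub>j t\<^sub>j\<close> from \<open>\<RR>\<^sup>m\<close> onto
  the kernel of \<open>\<RR> \<rightarrow> R/I\<close> is open: elements close to zero have coefficients \<open>t\<^sub>j\<close> close to zero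
  (\<open>completion_span_series\<close>, \<open>completion_fg_lift\<close>).  So a formal sum all of whose coefficients lie
  in that kernel is \<open>\<Sum> a\<^sub>j t\<^sub>j\<close> with finitely many formal sums \<open>t\<^sub>j\<close> (\<open>fg_factor\<close>).  As the image of \<open>R\<close>
  is dense, every \<open>s \<in> \<RR>[[X]]\<close> is a finite formal sum with coefficients in \<open>R\<close> plus some
  \<open>\<Sum> a\<^sub>j t\<^sub>j\<close> with \<open>a\<^sub>j \<in> I\<close> (\<open>decompose\<close>).  This expression is finite, so that it can be
  substituted into any map that is linear over \<open>R\<close> (\<open>linear_decompose\<close>).

  Full faithfulness: let \<open>f : C \<rightarrow> D\<close> be linear over \<open>R\<close>.  The defect \<open>g s = f (\<pi> s) - \<pi> (f\<^sub>* s)\<close> is linear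
  over \<open>R\<close> on \<open>\<RR>[[C]]\<close> and vanishes on the basis \<open>C\<close>.  By the decomposition its image \<open>E\<close> satisfies
  \<open>E = I E\<close> for all \<open>I\<close> in the base.  A Nakayama lemma shows \<open>E = 0\<close> (\<open>contra_nakayama\<close>).  Expand
  \<open>e \<in> E\<close> again and again as a combination of elements of \<open>E\<close>, each time with coefficients so small,
  compared with the coefficients already present, that the resulting formal sums
  \<open>u\<^sub>0 = e, u\<^sub>1, u\<^sub>2, \<dots>\<close> tend to zero; here the countable base is used.  By contraassociativity \<open>\<Sum> u\<^sub>n\<close>
  and \<open>\<Sum> u\<^sub>n\<^sub>+\<^sub>1\<close> have the same value under \<open>\<pi>\<close>.  Their difference is \<open>e\<close>, so \<open>e = 0\<close>.

  Contratensor product: choose \<open>I\<close> annihilating \<open>b \<in> N\<close>.  Substituting the decomposition of \<open>s\<close> into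
  \<open>b \<otimes> \<pi> s\<close> leaves in \<open>N \<otimes>\<^sub>R C\<close> only the finite part, which is \<open>\<Sum> b s\<^sub>c \<otimes> c\<close> (\<open>pure_act_eq_eval\<close>).
  So the relations defining \<open>N \<odot> C\<close> hold in \<open>N \<otimes>\<^sub>R C\<close>, and the comparison map has an inverse.

  Ideals: in the decomposition of a formal sum with coefficients in the kernel of \<open>\<RR> \<rightarrow> R/I\<close> all the
  coefficients from \<open>R\<close> lie in \<open>I\<close>; applying \<open>\<pi>\<close> gives an element of \<open>I C\<close>.
\<close>


section \<open>Summation in linearly topologized rings\<close>

text \<open>
  A complete separated ring with a linear topology given by open right ideals.  Left multiplications
  are continuous by \<open>colon_open\<close>.  Completeness says that the ring maps onto the projective limit of its
  quotients by open right ideals, so that it mentions no index set.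
\<close>

locale linear_top_ring = ring S for S :: "('s, 'k) ring_scheme" (structure) +
  fixes T :: "'s topology"
  assumes topspace_eq: "topspace T = carrier S"
    and openin_iff: "openin T U \<longleftrightarrow> U \<subseteq> carrier S \<and>
      (\<forall>x\<in>U. \<exists>J. open_right_ideal J S T \<and> (\<forall>j\<in>J. x \<oplus> j \<in> U))"
    and colon_open: "\<lbrakk>open_right_ideal J S T; s \<in> carrier S\<rbrakk> \<Longrightarrow> open_right_ideal (colon S J s) S T"
    and separated: "\<lbrakk>x \<in> carrier S; \<And>J. open_right_ideal J S T \<Longrightarrow> x \<in> J\<rbrakk> \<Longrightarrow> x = \<zero>"
    and complete: "\<lbrakk>\<And>J. open_right_ideal J S T \<Longrightarrow> a J \<in> carrier S;
        \<And>J J'. \<lbrakk>open_right_ideal J S T; open_right_ideal J' S T; J \<subseteq> J'\<rbrakk> \<Longrightarrow> a J \<ominus> a J' \<in> J'\<rbrakk>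
      \<Longrightarrow> \<exists>l\<in>carrier S. \<forall>J. open_right_ideal J S T \<longrightarrow> l \<ominus> a J \<in> J"
begin

abbreviation oi :: "'s set \<Rightarrow> bool" where "oi J \<equiv> open_right_ideal J S T"

lemma oi_subset: "oi J \<Longrightarrow> J \<subseteq> carrier S"
  by (metis additive_subgroup.a_subset open_right_ideal_def right_ideal_def)

lemma oi_carr: "\<lbrakk>oi J; x \<in> J\<rbrakk> \<Longrightarrow> x \<in> carrier S"
  using oi_subset by blast

lemma oi_zero [simp]: "oi J \<Longrightarrow> \<zero> \<in> J"
  by (metis additive_subgroup.zero_closed open_right_ideal_def right_ideal_def)

lemma oi_add: "\<lbrakk>oi J; x \<in> J; y \<in> J\<rbrakk> \<Longrightarrow> x \<oplus> y \<in> J"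
  by (metis additive_subgroup.a_closed open_right_ideal_def right_ideal_def)

lemma oi_uminus: "\<lbrakk>oi J; x \<in> J\<rbrakk> \<Longrightarrow> \<ominus> x \<in> J"
  by (metis additive_subgroup.a_inv_closed open_right_ideal_def right_ideal_def is_abelian_group)

lemma oi_rmult: "\<lbrakk>oi J; x \<in> J; r \<in> carrier S\<rbrakk> \<Longrightarrow> x \<otimes> r \<in> J"
  by (simp add: open_right_ideal_def right_ideal_def)

lemma oi_finsum: "\<lbrakk>oi J; \<And>x. x \<in> F \<Longrightarrow> f x \<in> J\<rbrakk> \<Longrightarrow> finsum S f F \<in> J"
proof (induction F rule: infinite_finite_induct)
  case (insert x F)
  then have "f x \<in> carrier S" "f \<in> F \<rightarrow> carrier S" using oi_carr by auto
  with insert show ?case by (simp add: oi_add)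
qed (auto simp: finsum_infinite)

lemma diff_add_diff:
  "\<lbrakk>x \<in> carrier S; y \<in> carrier S; z \<in> carrier S\<rbrakk> \<Longrightarrow> (x \<ominus> y) \<oplus> (y \<ominus> z) = x \<ominus> z"
  by (simp add: a_minus_def a_assoc r_neg1)

lemma add_diff_cancel:
  "\<lbrakk>x \<in> carrier S; y \<in> carrier S\<rbrakk> \<Longrightarrow> x \<oplus> (y \<ominus> x) = y"
  by (simp add: a_minus_def a_comm[of y] r_neg2)

lemma oi_diff_trans:
  "\<lbrakk>oi J; x \<ominus> y \<in> J; y \<ominus> z \<in> J; x \<in> carrier S; y \<in> carrier S; z \<in> carrier S\<rbrakk> \<Longrightarrow> x \<ominus> z \<in> J"
  using oi_add[of J "x \<ominus> y" "y \<ominus> z"] by (simp add: diff_add_diff)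

lemma oi_diff_sym:
  "\<lbrakk>oi J; x \<ominus> y \<in> J; x \<in> carrier S; y \<in> carrier S\<rbrakk> \<Longrightarrow> y \<ominus> x \<in> J"
  using oi_uminus[of J "x \<ominus> y"] by (simp add: a_minus_def minus_add a_comm)

lemma oi_diff_trans':
  "\<lbrakk>oi J; x \<ominus> y \<in> J; x \<ominus> z \<in> J; x \<in> carrier S; y \<in> carrier S; z \<in> carrier S\<rbrakk> \<Longrightarrow> y \<ominus> z \<in> J"
  using oi_diff_trans[of J y x z] oi_diff_sym[of J x y] by simp

lemma oi_diff_mem:
  "\<lbrakk>oi J; x \<ominus> y \<in> J; y \<in> J; x \<in> carrier S\<rbrakk> \<Longrightarrow> x \<in> J"
  using oi_add[of J "x \<ominus> y" y] oi_carr[of J y] by (simp add: a_minus_def a_assoc l_neg)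

lemma oi_diff_mem':
  "\<lbrakk>oi J; x \<ominus> y \<in> J; x \<in> J; y \<in> carrier S\<rbrakk> \<Longrightarrow> y \<in> J"
  using oi_diff_mem[of J y x] oi_diff_sym[of J x y] oi_carr[of J x] by simp

lemma oi_eqI:
  "\<lbrakk>\<And>J. oi J \<Longrightarrow> x \<ominus> y \<in> J; x \<in> carrier S; y \<in> carrier S\<rbrakk> \<Longrightarrow> x = y"
proof -
  assume *: "\<And>J. oi J \<Longrightarrow> x \<ominus> y \<in> J" "x \<in> carrier S" "y \<in> carrier S"
  then have "x \<ominus> y = \<zero>" using separated[of "x \<ominus> y"] by simp
  then show "x = y" using * add_diff_cancel[of y x] by simp
qed

lemma oi_finsum_diff:
  assumes J: "oi J" and "f \<in> F \<rightarrow> carrier S" "g \<in> F \<rightarrow> carrier S" "\<And>x. x \<in> F \<Longrightarrow> f x \<ominus> g x \<in> J"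
  shows "finsum S f F \<ominus> finsum S g F \<in> J"
  using assms(2-)
proof (induction F rule: infinite_finite_induct)
  case (insert x F)
  then have c: "f x \<in> carrier S" "f \<in> F \<rightarrow> carrier S" "g x \<in> carrier S" "g \<in> F \<rightarrow> carrier S"
    by auto
  have "(f x \<oplus> finsum S f F) \<ominus> (g x \<oplus> finsum S g F) = (f x \<ominus> g x) \<oplus> (finsum S f F \<ominus> finsum S g F)"
    using c by (simp add: a_minus_def minus_add a_ac)
  then show ?case using insert c J by (simp add: oi_add)
qed (use J in \<open>auto simp: a_minus_def\<close>)

lemma oi_finsum_subset:
  assumes J: "oi J" and fin: "finite F" and "G \<subseteq> F" and f: "f \<in> F \<rightarrow> carrier S"
    and "\<And>x. x \<in> F - G \<Longrightarrow> f x \<in> J"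
  shows "finsum S f F \<ominus> finsum S f G \<in> J"
proof -
  have F: "F = G \<union> (F - G)" using assms by auto
  have "f \<in> G \<rightarrow> carrier S" "f \<in> F - G \<rightarrow> carrier S" using f \<open>G \<subseteq> F\<close> by auto
  moreover have "finsum S f F = finsum S f G \<oplus> finsum S f (F - G)"
    by (subst F, rule finsum_Un_disjoint) (use fin f \<open>G \<subseteq> F\<close> finite_subset in auto)
  ultimately have "finsum S f F \<ominus> finsum S f G = finsum S f (F - G)"
    by (simp add: a_minus_def a_ac r_neg1 r_neg2)
  then show ?thesis using oi_finsum[OF J, of "F - G" f] assms(5) by simp
qed

definition zconv :: "('x \<Rightarrow> 's) \<Rightarrow> 'x set \<Rightarrow> bool" where
  "zconv f X \<longleftrightarrow> f \<in> X \<rightarrow> carrier S \<and> (\<forall>J. oi J \<longrightarrow> finite {x \<in> X. f x \<notin> J})"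

text \<open>
  Modulo an open right ideal the sum of a family converging to zero is the finite sum of the terms
  outside the ideal.  With this as the definition, statements about sums become congruences, and limits
  over finite subsets occur only in the comparison with \<open>conv_sum\<close>.
\<close>

definition has_csum :: "('x \<Rightarrow> 's) \<Rightarrow> 'x set \<Rightarrow> 's \<Rightarrow> bool" where
  "has_csum f X l \<longleftrightarrow> zconv f X \<and> l \<in> carrier S \<and>
     (\<forall>J. oi J \<longrightarrow> finsum S f {x \<in> X. f x \<notin> J} \<ominus> l \<in> J)"

lemma zconv_fun: "zconv f X \<Longrightarrow> x \<in> X \<Longrightarrow> f x \<in> carrier S"
  by (auto simp: zconv_def)

lemma has_csum_carrier: "has_csum f X l \<Longrightarrow> l \<in> carrier S"
  by (simp add: has_csum_def)

lemma has_csum_zconv: "has_csum f X l \<Longrightarrow> zconv f X"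
  by (simp add: has_csum_def)

lemma has_csumI:
  assumes f: "f \<in> X \<rightarrow> carrier S" and l: "l \<in> carrier S"
    and *: "\<And>J. oi J \<Longrightarrow> \<exists>F. finite F \<and> F \<subseteq> X \<and> (\<forall>x\<in>X - F. f x \<in> J) \<and> finsum S f F \<ominus> l \<in> J"
  shows "has_csum f X l"
  unfolding has_csum_def zconv_def
proof (intro conjI allI impI f l)
  fix J assume J: "oi J"
  obtain F where F: "finite F" "F \<subseteq> X" "\<forall>x\<in>X - F. f x \<in> J" "finsum S f F \<ominus> l \<in> J"
    using *[OF J] by blast
  then have sub: "{x \<in> X. f x \<notin> J} \<subseteq> F" by auto
  then show "finite {x \<in> X. f x \<notin> J}" using F finite_subset by blast
  have "f \<in> F \<rightarrow> carrier S" "f \<in> {x \<in> X. f x \<notin> J} \<rightarrow> carrier S" using F f by auto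
  moreover have "finsum S f F \<ominus> finsum S f {x \<in> X. f x \<notin> J} \<in> J"
    by (rule oi_finsum_subset[OF J]) (use F f sub in auto)
  ultimately show "finsum S f {x \<in> X. f x \<notin> J} \<ominus> l \<in> J"
    using oi_diff_trans'[OF J _ F(4)] l finsum_closed by blast
qed

lemma has_csumD:
  assumes s: "has_csum f X l" and J: "oi J" and "finite F" "F \<subseteq> X" "\<And>x. x \<in> X - F \<Longrightarrow> f x \<in> J"
  shows "finsum S f F \<ominus> l \<in> J"
proof -
  have f: "f \<in> X \<rightarrow> carrier S" and l: "l \<in> carrier S"
    and 1: "finsum S f {x \<in> X. f x \<notin> J} \<ominus> l \<in> J"
    using s J by (auto simp: has_csum_def zconv_def)
  have "f \<in> F \<rightarrow> carrier S" "f \<in> {x \<in> X. f x \<notin> J} \<rightarrow> carrier S" using assms f by auto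
  moreover have "finsum S f F \<ominus> finsum S f {x \<in> X. f x \<notin> J} \<in> J"
    by (rule oi_finsum_subset[OF J]) (use assms f in auto)
  ultimately show ?thesis using oi_diff_trans[OF J _ 1] l finsum_closed by blast
qed

lemma has_csum_finite_part:
  assumes "zconv f X" "oi J"
  shows "finite {x \<in> X. f x \<notin> J}"
  using assms by (simp add: zconv_def)

lemma has_csum_unique:
  assumes "has_csum f X l" "has_csum f X m"
  shows "l = m"
proof (rule oi_eqI)
  show c: "l \<in> carrier S" "m \<in> carrier S" using assms by (auto simp: has_csum_def)
  fix J assume J: "oi J"
  have "f \<in> {x \<in> X. f x \<notin> J} \<rightarrow> carrier S" using assms by (auto simp: has_csum_def zconv_def)
  then have "finsum S f {x \<in> X. f x \<notin> J} \<in> carrier S" by (rule finsum_closed)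
  moreover have "finsum S f {x \<in> X. f x \<notin> J} \<ominus> l \<in> J" "finsum S f {x \<in> X. f x \<notin> J} \<ominus> m \<in> J"
    using assms J by (simp_all add: has_csum_def)
  ultimately show "l \<ominus> m \<in> J" using oi_diff_trans'[OF J] c by blast
qed

text \<open>
  The partial sums over the terms outside \<open>J\<close> are compatible when \<open>J\<close> varies.
\<close>

lemma has_csum_exists:
  assumes "zconv f X"
  shows "\<exists>l. has_csum f X l"
proof -
  let ?a = "\<lambda>J. finsum S f {x \<in> X. f x \<notin> J}"
  have f: "f \<in> X \<rightarrow> carrier S" and fin: "\<And>J. oi J \<Longrightarrow> finite {x \<in> X. f x \<notin> J}"
    using assms by (auto simp: zconv_def)
  have c: "?a J \<in> carrier S" for J using f by (intro finsum_closed) auto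
  have "\<exists>l\<in>carrier S. \<forall>J. oi J \<longrightarrow> l \<ominus> ?a J \<in> J"
  proof (rule complete)
    fix J J' assume "oi J" "oi J'" "J \<subseteq> J'"
    then show "?a J \<ominus> ?a J' \<in> J'"
      by (intro oi_finsum_subset) (use f fin in auto)
  qed (rule c)
  then obtain l where l: "l \<in> carrier S" "\<And>J. oi J \<Longrightarrow> l \<ominus> ?a J \<in> J" by blast
  have "has_csum f X l"
    unfolding has_csum_def using assms l oi_diff_sym c by auto
  then show ?thesis by blast
qed

lemma openin_coset:
  assumes J: "oi J" and x: "x \<in> carrier S"
  shows "openin T {y \<in> carrier S. y \<ominus> x \<in> J}"
  unfolding openin_iff
proof (intro conjI ballI exI[of _ J] J)
  fix y j assume "y \<in> {y \<in> carrier S. y \<ominus> x \<in> J}" "j \<in> J"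
  moreover from this have "j \<in> carrier S" using J oi_carr by blast
  moreover from calculation have "(y \<oplus> j) \<ominus> x = (y \<ominus> x) \<oplus> j"
    using x by (simp add: a_minus_def a_ac)
  ultimately show "y \<oplus> j \<in> {y \<in> carrier S. y \<ominus> x \<in> J}" using J by (simp add: oi_add)
qed auto

text \<open>
  Cosets of open right ideals are open, so a limit of the partial sums is determined modulo each \<open>J\<close>.
\<close>

lemma conv_sum_eq:
  assumes s: "has_csum f X l"
  shows "conv_sum S T f X = l"
  unfolding conv_sum_def
proof (rule the_equality)
  have f: "f \<in> X \<rightarrow> carrier S" and l: "l \<in> carrier S" and z: "zconv f X"
    using s by (auto simp: has_csum_def zconv_def)
  have ev: "eventually (\<lambda>F. finsum S f F \<ominus> l \<in> J \<and> finsum S f F \<in> carrier S) (finite_subsets_at_top X)"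
    if "oi J" for J
    unfolding eventually_finite_subsets_at_top
  proof (intro exI[of _ "{x \<in> X. f x \<notin> J}"] conjI allI impI)
    fix F assume "finite F \<and> {x \<in> X. f x \<notin> J} \<subseteq> F \<and> F \<subseteq> X"
    then show "finsum S f F \<ominus> l \<in> J" "finsum S f F \<in> carrier S"
      by (auto intro!: has_csumD[OF s that] finsum_closed) (use f in auto)
  qed (use has_csum_finite_part[OF z that] in auto)
  show "limitin T (finsum S f) l (finite_subsets_at_top X)"
    unfolding limitin_def
  proof (intro conjI allI impI)
    fix U assume "openin T U \<and> l \<in> U"
    then obtain J where J: "oi J" "\<And>j. j \<in> J \<Longrightarrow> l \<oplus> j \<in> U"
      using openin_iff[of U] by auto
    show "eventually (\<lambda>F. finsum S f F \<in> U) (finite_subsets_at_top X)"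
      using ev[OF J(1)]
    proof eventually_elim
      case (elim F)
      then have "l \<oplus> (finsum S f F \<ominus> l) = finsum S f F"
        using l by (simp add: add_diff_cancel)
      moreover have "l \<oplus> (finsum S f F \<ominus> l) \<in> U" using J(2) elim by simp
      ultimately show ?case by simp
    qed
  qed (simp add: topspace_eq l)
  fix m assume m: "limitin T (finsum S f) m (finite_subsets_at_top X)"
  then have mc: "m \<in> carrier S" using limitin_topspace[OF m] topspace_eq by simp
  show "m = l"
  proof (rule oi_eqI[OF _ mc l])
    fix J assume J: "oi J"
    have "m \<ominus> m \<in> J" using J mc by (simp add: a_minus_def r_neg)
    then have "eventually (\<lambda>F. finsum S f F \<in> {y \<in> carrier S. y \<ominus> m \<in> J}) (finite_subsets_at_top X)"
      using m[unfolded limitin_def] openin_coset[OF J mc] mc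
      by (elim conjE allE[of _ "{y \<in> carrier S. y \<ominus> m \<in> J}"]) simp
    then have "eventually (\<lambda>F. m \<ominus> l \<in> J) (finite_subsets_at_top X)"
      using ev[OF J]
    proof eventually_elim
      case (elim F)
      then show ?case using oi_diff_trans'[OF J _ _ _ mc l, of "finsum S f F"] by simp
    qed
    then show "m \<ominus> l \<in> J" by (simp add: eventually_const)
  qed
qed

lemma has_csum_conv_sum: "zconv f X \<Longrightarrow> has_csum f X (conv_sum S T f X)"
proof -
  assume "zconv f X"
  then obtain l where l: "has_csum f X l" using has_csum_exists by blast
  show ?thesis unfolding conv_sum_eq[OF l] by (rule l)
qed

lemma zconv_subset: "\<lbrakk>zconv f X; Y \<subseteq> X\<rbrakk> \<Longrightarrow> zconv f Y"
  unfolding zconv_def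
proof (intro conjI allI impI)
  fix J assume *: "f \<in> X \<rightarrow> carrier S \<and> (\<forall>J. oi J \<longrightarrow> finite {x \<in> X. f x \<notin> J})" "Y \<subseteq> X" "oi J"
  then have "finite {x \<in> X. f x \<notin> J}" "{x \<in> Y. f x \<notin> J} \<subseteq> {x \<in> X. f x \<notin> J}" by auto
  then show "finite {x \<in> Y. f x \<notin> J}" using finite_subset by blast
qed auto

lemma zconv_cong: "(\<And>x. x \<in> X \<Longrightarrow> f x = g x) \<Longrightarrow> zconv f X \<longleftrightarrow> zconv g X"
proof -
  assume *: "\<And>x. x \<in> X \<Longrightarrow> f x = g x"
  then have "{x \<in> X. f x \<notin> J} = {x \<in> X. g x \<notin> J}" for J by auto
  moreover have "f \<in> X \<rightarrow> carrier S \<longleftrightarrow> g \<in> X \<rightarrow> carrier S" using * by (simp add: Pi_def)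
  ultimately show ?thesis by (simp add: zconv_def)
qed

lemma has_csum_cong:
  assumes "\<And>x. x \<in> X \<Longrightarrow> f x = g x"
  shows "has_csum f X l \<longleftrightarrow> has_csum g X l"
proof -
  have "has_csum g X l" if "has_csum f X l" "\<And>x. x \<in> X \<Longrightarrow> f x = g x" for f g
  proof -
    have "finsum S g {x \<in> X. g x \<notin> J} = finsum S f {x \<in> X. f x \<notin> J}" if "oi J" for J
      by (rule finsum_cong')
        (use \<open>has_csum f X l\<close> \<open>\<And>x. x \<in> X \<Longrightarrow> f x = g x\<close> in \<open>auto simp: has_csum_def zconv_def\<close>)
    then show ?thesis using that zconv_cong[of X f g] unfolding has_csum_def by simp
  qed
  from this[of f g] this[of g f] assms show ?thesis by auto
qed

lemma zconv_finite: "\<lbrakk>finite X; f \<in> X \<rightarrow> carrier S\<rbrakk> \<Longrightarrow> zconv f X"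
  by (simp add: zconv_def)

lemma has_csum_finite:
  assumes "finite X" "f \<in> X \<rightarrow> carrier S"
  shows "has_csum f X (finsum S f X)"
  by (rule has_csumI) (use assms in \<open>auto intro!: exI[of _ X] simp: a_minus_def r_neg\<close>)

lemma has_csum_support:
  assumes "Y \<subseteq> X" "\<And>x. x \<in> X - Y \<Longrightarrow> f x = \<zero>"
  shows "has_csum f X l \<longleftrightarrow> has_csum f Y l"
proof -
  have "{x \<in> X. f x \<notin> J} = {x \<in> Y. f x \<notin> J}" if "oi J" for J
    using assms that oi_zero[OF that] by force
  moreover have "f \<in> X \<rightarrow> carrier S \<longleftrightarrow> f \<in> Y \<rightarrow> carrier S"
    using assms by (force simp: Pi_def)
  ultimately show ?thesis unfolding has_csum_def zconv_def by auto
qed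

lemma has_csum_single:
  assumes "x \<in> X" "f x \<in> carrier S" "\<And>y. \<lbrakk>y \<in> X; y \<noteq> x\<rbrakk> \<Longrightarrow> f y = \<zero>"
  shows "has_csum f X (f x)"
proof -
  have "has_csum f {x} (finsum S f {x})" using assms by (intro has_csum_finite) auto
  then show ?thesis using has_csum_support[of "{x}" X f] assms by (auto simp: finsum_insert)
qed

lemma has_csum_add:
  assumes f: "has_csum f X l" and g: "has_csum g X m"
  shows "has_csum (\<lambda>x. f x \<oplus> g x) X (l \<oplus> m)"
proof (rule has_csumI)
  have c: "f \<in> X \<rightarrow> carrier S" "g \<in> X \<rightarrow> carrier S" "l \<in> carrier S" "m \<in> carrier S"
    using assms by (auto simp: has_csum_def zconv_def)
  then show "(\<lambda>x. f x \<oplus> g x) \<in> X \<rightarrow> carrier S" "l \<oplus> m \<in> carrier S" by auto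
  fix J assume J: "oi J"
  let ?F = "{x \<in> X. f x \<notin> J} \<union> {x \<in> X. g x \<notin> J}"
  have fin: "finite ?F" using has_csum_finite_part has_csum_zconv assms J by blast
  have 1: "finsum S f ?F \<ominus> l \<in> J" by (rule has_csumD[OF f J fin]) auto
  have 2: "finsum S g ?F \<ominus> m \<in> J" by (rule has_csumD[OF g J fin]) auto
  have c': "f \<in> ?F \<rightarrow> carrier S" "g \<in> ?F \<rightarrow> carrier S" using c by auto
  have "finsum S (\<lambda>x. f x \<oplus> g x) ?F \<ominus> (l \<oplus> m) = (finsum S f ?F \<ominus> l) \<oplus> (finsum S g ?F \<ominus> m)"
    using c c' fin by (simp add: finsum_addf a_minus_def minus_add a_ac)
  then have "finsum S (\<lambda>x. f x \<oplus> g x) ?F \<ominus> (l \<oplus> m) \<in> J" using 1 2 oi_add[OF J] by simp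
  then show "\<exists>F. finite F \<and> F \<subseteq> X \<and> (\<forall>x\<in>X - F. f x \<oplus> g x \<in> J) \<and>
      finsum S (\<lambda>x. f x \<oplus> g x) F \<ominus> (l \<oplus> m) \<in> J"
    using fin by (intro exI[of _ ?F]) (auto simp: oi_add[OF J])
qed

text \<open>
  An open right ideal \<open>J\<close> need not absorb multiplication from the left; the terms to be kept are those
  outside \<open>colon S J r\<close>.
\<close>

lemma has_csum_lmult:
  assumes f: "has_csum f X l" and r: "r \<in> carrier S"
  shows "has_csum (\<lambda>x. r \<otimes> f x) X (r \<otimes> l)"
proof (rule has_csumI)
  have c: "f \<in> X \<rightarrow> carrier S" "l \<in> carrier S"
    using assms by (auto simp: has_csum_def zconv_def)
  then show "(\<lambda>x. r \<otimes> f x) \<in> X \<rightarrow> carrier S" "r \<otimes> l \<in> carrier S" using r by auto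
  fix J assume "oi J"
  then have K: "oi (colon S J r)" using colon_open r by blast
  let ?F = "{x \<in> X. f x \<notin> colon S J r}"
  have fin: "finite ?F" using has_csum_finite_part has_csum_zconv[OF f] K by blast
  have 1: "finsum S f ?F \<ominus> l \<in> colon S J r" by (rule has_csumD[OF f K fin]) auto
  have c': "f \<in> ?F \<rightarrow> carrier S" using c by auto
  have "finsum S (\<lambda>x. r \<otimes> f x) ?F \<ominus> (r \<otimes> l) = r \<otimes> (finsum S f ?F \<ominus> l)"
    using c c' fin r by (simp add: finsum_rdistr[symmetric] a_minus_def r_distr r_minus)
  then have "finsum S (\<lambda>x. r \<otimes> f x) ?F \<ominus> (r \<otimes> l) \<in> J" using 1 by (simp add: colon_def)
  then show "\<exists>F. finite F \<and> F \<subseteq> X \<and> (\<forall>x\<in>X - F. r \<otimes> f x \<in> J) \<and>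
      finsum S (\<lambda>x. r \<otimes> f x) F \<ominus> (r \<otimes> l) \<in> J"
    using fin by (intro exI[of _ ?F]) (auto simp: colon_def)
qed

lemma has_csum_rmult:
  assumes f: "has_csum f X l" and r: "r \<in> carrier S"
  shows "has_csum (\<lambda>x. f x \<otimes> r) X (l \<otimes> r)"
proof (rule has_csumI)
  have c: "f \<in> X \<rightarrow> carrier S" "l \<in> carrier S"
    using assms by (auto simp: has_csum_def zconv_def)
  then show "(\<lambda>x. f x \<otimes> r) \<in> X \<rightarrow> carrier S" "l \<otimes> r \<in> carrier S" using r by auto
  fix J assume J: "oi J"
  let ?F = "{x \<in> X. f x \<notin> J}"
  have fin: "finite ?F" using has_csum_finite_part has_csum_zconv[OF f] J by blast
  have 1: "finsum S f ?F \<ominus> l \<in> J" by (rule has_csumD[OF f J fin]) auto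
  have c': "f \<in> ?F \<rightarrow> carrier S" using c by auto
  have "finsum S (\<lambda>x. f x \<otimes> r) ?F \<ominus> (l \<otimes> r) = (finsum S f ?F \<ominus> l) \<otimes> r"
    using c c' fin r by (simp add: finsum_ldistr[symmetric] a_minus_def l_distr l_minus)
  then have "finsum S (\<lambda>x. f x \<otimes> r) ?F \<ominus> (l \<otimes> r) \<in> J" using oi_rmult[OF J 1 r] by simp
  then show "\<exists>F. finite F \<and> F \<subseteq> X \<and> (\<forall>x\<in>X - F. f x \<otimes> r \<in> J) \<and>
      finsum S (\<lambda>x. f x \<otimes> r) F \<ominus> (l \<otimes> r) \<in> J"
    using fin by (intro exI[of _ ?F]) (auto simp: oi_rmult[OF J _ r])
qed

lemma has_csum_mem:
  assumes "has_csum f X l" "oi J" "\<And>x. x \<in> X \<Longrightarrow> f x \<in> J"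
  shows "l \<in> J"
proof (rule oi_diff_mem'[OF \<open>oi J\<close>])
  show "finsum S f {} \<ominus> l \<in> J" by (rule has_csumD[OF assms(1,2)]) (use assms in auto)
qed (use assms in \<open>auto simp: has_csum_def\<close>)

text \<open>
  Modulo an open right ideal only finitely many fibres contribute, each of them by a finite sum.
\<close>

lemma has_csum_group:
  assumes f: "has_csum f X l" and h: "h \<in> X \<rightarrow> Y"
    and g: "\<And>y. y \<in> Y \<Longrightarrow> has_csum f {x \<in> X. h x = y} (g y)"
  shows "has_csum g Y l"
proof (rule has_csumI)
  have c: "f \<in> X \<rightarrow> carrier S" and l: "l \<in> carrier S"
    using f by (auto simp: has_csum_def zconv_def)
  show gc: "g \<in> Y \<rightarrow> carrier S" using g by (auto simp: has_csum_def)
  show "l \<in> carrier S" by (rule l)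
  fix J assume J: "oi J"
  let ?B = "{x \<in> X. f x \<notin> J}"
  let ?A = "\<lambda>y. {x \<in> ?B. h x = y}"
  have fin: "finite ?B" using has_csum_finite_part has_csum_zconv[OF f] J by blast
  have sub: "h ` ?B \<subseteq> Y" using h by auto
  have fA: "f \<in> ?A y \<rightarrow> carrier S" for y using c by auto
  have finA: "finite (?A y)" for y using fin by (rule rev_finite_subset) auto
  have 1: "finsum S f ?B \<ominus> l \<in> J" by (rule has_csumD[OF f J fin]) auto
  have 2: "g y \<ominus> finsum S f (?A y) \<in> J" if "y \<in> Y" for y
  proof (rule oi_diff_sym[OF J])
    show "finsum S f (?A y) \<ominus> g y \<in> J"
      by (rule has_csumD[OF g[OF that] J]) (use finA in auto)
  qed (use gc that fA in auto)
  have "?B = (\<Union>y\<in>h ` ?B. ?A y)" by auto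
  then have "finsum S f ?B = finsum S f (\<Union>y\<in>h ` ?B. ?A y)" by metis
  also have "\<dots> = finsum S (\<lambda>y. finsum S f (?A y)) (h ` ?B)"
    by (rule add.finprod_UN_disjoint) (use fin finA c in \<open>auto simp: disjnt_def pairwise_def\<close>)
  finally have 3: "finsum S f ?B = finsum S (\<lambda>y. finsum S f (?A y)) (h ` ?B)" .
  have "finsum S g (h ` ?B) \<ominus> finsum S (\<lambda>y. finsum S f (?A y)) (h ` ?B) \<in> J"
    by (rule oi_finsum_diff[OF J]) (use gc sub fA 2 in \<open>auto intro!: finsum_closed\<close>)
  then have "finsum S g (h ` ?B) \<ominus> finsum S f ?B \<in> J" by (simp only: 3)
  then have "finsum S g (h ` ?B) \<ominus> l \<in> J"
    by (rule oi_diff_trans[OF J _ 1]) (use gc sub c l in \<open>auto intro!: finsum_closed\<close>)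
  moreover have "g y \<in> J" if "y \<in> Y - h ` ?B" for y
    using that by (intro has_csum_mem[OF g J]) auto
  ultimately show "\<exists>F. finite F \<and> F \<subseteq> Y \<and> (\<forall>y\<in>Y - F. g y \<in> J) \<and> finsum S g F \<ominus> l \<in> J"
    using fin sub by (intro exI[of _ "h ` ?B"]) auto
qed

lemma has_csum_reindex:
  assumes "has_csum (\<lambda>x. f (h x)) X l" "inj_on h X"
  shows "has_csum f (h ` X) l"
proof (rule has_csum_group[OF assms(1), of h])
  fix y assume "y \<in> h ` X"
  then obtain x where x: "x \<in> X" "y = h x" by blast
  then have "{x \<in> X. h x = y} = {x}" using assms(2) by (auto simp: inj_on_def)
  moreover have "f (h x) \<in> carrier S" using x assms(1) by (auto simp: has_csum_def zconv_def)
  ultimately show "has_csum (\<lambda>x. f (h x)) {x \<in> X. h x = y} (f y)"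
    using x has_csum_single[of x "{x}" "\<lambda>x. f (h x)"] by simp
qed auto

lemma has_csum_insert:
  assumes f: "has_csum f X l" and x: "x \<notin> X" "f x \<in> carrier S"
  shows "has_csum f (insert x X) (f x \<oplus> l)"
proof -
  have c: "f \<in> X \<rightarrow> carrier S" "l \<in> carrier S" using f by (auto simp: has_csum_def zconv_def)
  let ?g = "\<lambda>y. if y = x then f x else \<zero>" and ?h = "\<lambda>y. if y = x then \<zero> else f y"
  have "has_csum ?g (insert x X) (?g x)" by (rule has_csum_single) (use x in auto)
  moreover have "has_csum ?h X l" using f x has_csum_cong[of X f ?h] by fastforce
  then have "has_csum ?h (insert x X) l" 
    by (subst has_csum_support[of X "insert x X" ?h]) auto
  ultimately have "has_csum (\<lambda>y. ?g y \<oplus> ?h y) (insert x X) (f x \<oplus> l)"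
    using has_csum_add by fastforce
  moreover have "?g y \<oplus> ?h y = f y" if "y \<in> insert x X" for y using that x c by (auto simp: Pi_def)
  ultimately show ?thesis using has_csum_cong by (metis (no_types, lifting))
qed

lemma has_csum_finsum:
  assumes "finite A" "\<And>a. a \<in> A \<Longrightarrow> has_csum (f a) X (l a)"
  shows "has_csum (\<lambda>x. finsum S (\<lambda>a. f a x) A) X (finsum S l A)"
  using assms
proof (induction A)
  case empty
  show ?case
    using has_csum_finite[of "{}" "\<lambda>x. finsum S (\<lambda>a. f a x) {}"]
      has_csum_support[of "{}" X "\<lambda>x. finsum S (\<lambda>a. f a x) {}"] by simp
next
  case (insert a A)
  have fc: "f b x \<in> carrier S" if "b \<in> insert a A" "x \<in> X" for b x
    by (rule zconv_fun[OF has_csum_zconv[OF insert.prems[OF that(1)]] that(2)])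
  have lc: "l b \<in> carrier S" if "b \<in> insert a A" for b
    by (rule has_csum_carrier[OF insert.prems[OF that]])
  have 1: "has_csum (\<lambda>x. f a x \<oplus> finsum S (\<lambda>a. f a x) A) X (l a \<oplus> finsum S l A)"
    by (rule has_csum_add) (use insert in auto)
  have 2: "f a x \<oplus> finsum S (\<lambda>a. f a x) A = finsum S (\<lambda>a. f a x) (insert a A)" if "x \<in> X" for x
    by (rule finsum_insert[symmetric]) (use insert.hyps fc that in auto)
  have 3: "l a \<oplus> finsum S l A = finsum S l (insert a A)"
    by (rule finsum_insert[symmetric]) (use insert.hyps lc in auto)
  show ?case by (rule has_csum_cong[OF 2, THEN iffD1]) (use 1 in \<open>simp_all only: 3\<close>)
qed

lemma has_csum_nat:
  assumes "has_csum (\<lambda>n. f (Suc n)) UNIV l" "f 0 \<in> carrier S"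
  shows "has_csum f UNIV (f 0 \<oplus> l)"
proof -
  have "has_csum f (range Suc) l" using has_csum_reindex[of f Suc UNIV l] assms(1) by simp
  moreover have "insert 0 (range Suc) = UNIV" using not0_implies_Suc by force
  ultimately show ?thesis using has_csum_insert[of f "range Suc" l 0] assms(2) by simp
qed

end

section \<open>Infinite linear combinations and contramodules\<close>

context linear_top_ring
begin

abbreviation FS :: "'x set \<Rightarrow> ('x \<Rightarrow> 's) set" where "FS X \<equiv> formal_sums S T X"

lemma formal_sums_iff: "s \<in> FS X \<longleftrightarrow> s \<in> extensional X \<and> zconv s X"
  by (auto simp: formal_sums_def zconv_def PiE_def)

lemma formal_sums_zconv: "s \<in> FS X \<Longrightarrow> zconv s X"
  by (simp add: formal_sums_iff)

lemma formal_sums_carrier: "s \<in> FS X \<Longrightarrow> x \<in> X \<Longrightarrow> s x \<in> carrier S"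
  by (rule zconv_fun[of s X x]) (simp_all add: formal_sums_zconv)

lemma formal_sums_eqI:
  "\<lbrakk>s \<in> FS X; t \<in> FS X; \<And>x. x \<in> X \<Longrightarrow> s x = t x\<rbrakk> \<Longrightarrow> s = t"
  by (rule extensionalityI[of s X t]) (simp_all add: formal_sums_iff)

lemma fun_FS_carrier: "\<lbrakk>s \<in> I \<rightarrow> FS X; i \<in> I; x \<in> X\<rbrakk> \<Longrightarrow> s i x \<in> carrier S"
  using funcset_mem[of s I "FS X" i] formal_sums_carrier[of "s i" X x] by simp

lemma zconv_support:
  assumes "finite F" "\<And>x. x \<in> X - F \<Longrightarrow> f x = \<zero>" "f \<in> X \<rightarrow> carrier S"
  shows "zconv f X"
  unfolding zconv_def
proof (intro conjI allI impI assms)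
  fix J assume "oi J"
  then have "{x \<in> X. f x \<notin> J} \<subseteq> F" using assms(2) oi_zero by (metis (mono_tags, lifting) Diff_iff mem_Collect_eq subsetI)
  then show "finite {x \<in> X. f x \<notin> J}" using assms(1) finite_subset by blast
qed

lemma formal_unit_FS: "formal_unit S X x \<in> FS X"
proof -
  have "zconv (formal_unit S X x) X"
    by (rule zconv_support[of "{x}"]) (simp_all add: formal_unit_def)
  then show ?thesis unfolding formal_sums_iff by (simp add: formal_unit_def)
qed

lemma formal_zero_FS: "formal_zero S X \<in> FS X"
proof -
  have "zconv (formal_zero S X) X"
    by (rule zconv_support[of "{}"]) (simp_all add: formal_zero_def)
  then show ?thesis unfolding formal_sums_iff by (simp add: formal_zero_def)
qed

lemma formal_add_FS:
  assumes "s \<in> FS X" "t \<in> FS X"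
  shows "formal_add S X s t \<in> FS X"
proof -
  obtain l m where "has_csum s X l" "has_csum t X m"
    using assms has_csum_exists[OF formal_sums_zconv] by blast
  then have "zconv (\<lambda>x. s x \<oplus> t x) X" using has_csum_add has_csum_zconv by blast
  then show ?thesis
    using zconv_cong[of X "\<lambda>x. s x \<oplus> t x" "formal_add S X s t"]
    by (simp add: formal_sums_iff formal_add_def)
qed

lemma formal_scale_FS:
  assumes "s \<in> FS X" "r \<in> carrier S"
  shows "formal_scale S X r s \<in> FS X"
proof -
  obtain l where "has_csum s X l"
    using assms has_csum_exists[OF formal_sums_zconv] by blast
  then have "zconv (\<lambda>x. r \<otimes> s x) X" using has_csum_lmult assms has_csum_zconv by blast
  then show ?thesis
    using zconv_cong[of X "\<lambda>x. r \<otimes> s x" "formal_scale S X r s"]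
    by (simp add: formal_sums_iff formal_scale_def)
qed

lemma formal_module_simps [simp]:
  "carrier (formal_module S T X) = FS X" "add (formal_module S T X) = formal_add S X"
  "zero (formal_module S T X) = formal_zero S X" "smult (formal_module S T X) = formal_scale S X"
  by (simp_all add: formal_module_def)

lemma left_module_formal_module: "left_module S (formal_module S T X)"
proof (rule left_module.intro[OF ring_axioms abelian_groupI], unfold formal_module_simps)
  note c = formal_sums_carrier[where X = X]
  note defs = formal_add_def formal_scale_def formal_zero_def
  show "formal_zero S X \<in> FS X" by (rule formal_zero_FS)
  show "left_module_axioms S (formal_module S T X)"
  proof (rule left_module_axioms.intro, unfold formal_module_simps)
    fix x assume x: "x \<in> FS X"
    show "formal_scale S X \<one> x = x"
      by (rule formal_sums_eqI[OF formal_scale_FS[OF x] x]) (use c[OF x] in \<open>auto simp: defs\<close>)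
    fix a assume a: "a \<in> carrier S"
    show "formal_scale S X a x \<in> FS X" by (rule formal_scale_FS[OF x a])
    show "formal_scale S X a (formal_add S X x y) = formal_add S X (formal_scale S X a x) (formal_scale S X a y)"
      if y: "y \<in> FS X" for y
      using a c[OF x] c[OF y] by (auto simp: defs r_distr intro!: restrict_ext)
    fix b assume b: "b \<in> carrier S"
    show "formal_scale S X (a \<oplus> b) x = formal_add S X (formal_scale S X a x) (formal_scale S X b x)"
      using a b c[OF x] by (auto simp: defs l_distr intro!: restrict_ext)
    show "formal_scale S X (a \<otimes> b) x = formal_scale S X a (formal_scale S X b x)"
      using a b c[OF x] by (auto simp: defs m_assoc intro!: restrict_ext)
  qed
  fix x assume x: "x \<in> FS X"
  show "formal_add S X (formal_zero S X) x = x"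
    by (rule formal_sums_eqI[OF formal_add_FS[OF formal_zero_FS x] x]) (use c[OF x] in \<open>auto simp: defs\<close>)
  have "formal_add S X (formal_scale S X (\<ominus> \<one>) x) x = formal_zero S X"
    using c[OF x] by (auto simp: defs l_minus l_neg intro!: restrict_ext)
  moreover have "formal_scale S X (\<ominus> \<one>) x \<in> FS X" by (rule formal_scale_FS[OF x]) simp
  ultimately show "\<exists>y\<in>FS X. formal_add S X y x = formal_zero S X" by (rule bexI)
  fix y assume y: "y \<in> FS X"
  show "formal_add S X x y \<in> FS X" by (rule formal_add_FS[OF x y])
  show "formal_add S X x y = formal_add S X y x"
    using c[OF x] c[OF y] by (auto simp: defs a_comm intro!: restrict_ext)
  fix z assume z: "z \<in> FS X"
  show "formal_add S X (formal_add S X x y) z = formal_add S X x (formal_add S X y z)"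
    using c[OF x] c[OF y] c[OF z] by (auto simp: defs a_assoc intro!: restrict_ext)
qed

text \<open>
  This is the result of opening the parentheses in \<open>\<Sum> r\<^sub>i [s\<^sub>i]\<close>.  The index set is arbitrary, so that the
  same formal sum may occur several times.
\<close>

definition lincomb :: "'i set \<Rightarrow> ('i \<Rightarrow> 's) \<Rightarrow> 'x set \<Rightarrow> ('i \<Rightarrow> 'x \<Rightarrow> 's) \<Rightarrow> 'x \<Rightarrow> 's" where
  "lincomb I r X s = (\<lambda>x\<in>X. conv_sum S T (\<lambda>i. r i \<otimes> s i x) I)"

lemma zconv_mult:
  assumes r: "zconv r I" and t: "t \<in> I \<rightarrow> carrier S"
  shows "zconv (\<lambda>i. r i \<otimes> t i) I"
  unfolding zconv_def
proof (intro conjI allI impI)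
  show "(\<lambda>i. r i \<otimes> t i) \<in> I \<rightarrow> carrier S" using r t by (auto simp: zconv_def)
  fix J assume J: "oi J"
  have "{i \<in> I. r i \<otimes> t i \<notin> J} \<subseteq> {i \<in> I. r i \<notin> J}"
    using oi_rmult[OF J] t by auto
  then show "finite {i \<in> I. r i \<otimes> t i \<notin> J}"
    using has_csum_finite_part[OF r J] finite_subset by blast
qed

lemma lincomb_has_csum:
  assumes "zconv r I" "s \<in> I \<rightarrow> FS X" "x \<in> X"
  shows "has_csum (\<lambda>i. r i \<otimes> s i x) I (lincomb I r X s x)"
proof -
  have "zconv (\<lambda>i. r i \<otimes> s i x) I"
    by (rule zconv_mult[OF assms(1)]) (use fun_FS_carrier[OF assms(2) _ assms(3)] in auto)
  then show ?thesis using assms(3) by (simp add: lincomb_def has_csum_conv_sum)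
qed

text \<open>
  Given \<open>J\<close>, finitely many \<open>r i\<close> lie outside \<open>J\<close>, and for each of them almost all coefficients of \<open>s i\<close> lie
  in \<open>colon S J (r i)\<close>.
\<close>

lemma lincomb_FS:
  assumes r: "zconv r I" and s: "s \<in> I \<rightarrow> FS X"
  shows "lincomb I r X s \<in> FS X"
  unfolding formal_sums_iff zconv_def
proof (intro conjI allI impI)
  show "lincomb I r X s \<in> X \<rightarrow> carrier S"
    using has_csum_carrier[OF lincomb_has_csum[OF r s]] by auto
  fix J assume J: "oi J"
  let ?B = "{i \<in> I. r i \<notin> J}"
  let ?D = "\<lambda>i. {x \<in> X. s i x \<notin> colon S J (r i)}"
  have "{x \<in> X. lincomb I r X s x \<notin> J} \<subseteq> (\<Union>i\<in>?B. ?D i)"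
  proof (rule subsetI, rule ccontr)
    fix x assume x: "x \<in> {x \<in> X. lincomb I r X s x \<notin> J}" and nx: "x \<notin> (\<Union>i\<in>?B. ?D i)"
    have "r i \<otimes> s i x \<in> J" if "i \<in> I" for i
    proof (cases "r i \<in> J")
      case True
      have "s i x \<in> carrier S" using fun_FS_carrier[OF s that, of x] x by simp
      then show ?thesis using oi_rmult[OF J True] by blast
    next
      case False
      then have "s i x \<in> colon S J (r i)" using nx x that by blast
      then show ?thesis by (simp add: colon_def)
    qed
    moreover have "x \<in> X" using x by simp
    ultimately have "lincomb I r X s x \<in> J" using has_csum_mem[OF lincomb_has_csum[OF r s] J] by blast
    then show False using x by simp
  qed
  moreover have "finite (?D i)" if "i \<in> I" for i
    by (rule has_csum_finite_part[OF formal_sums_zconv])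
       (use that s colon_open[OF J] zconv_fun[OF r] in auto)
  then have "finite (\<Union>i\<in>?B. ?D i)" using has_csum_finite_part[OF r J] by blast
  ultimately show "finite {x \<in> X. lincomb I r X s x \<notin> J}" using finite_subset by blast
qed (simp add: lincomb_def)

lemma lincomb_eqI:
  assumes "t \<in> extensional X" "\<And>x. x \<in> X \<Longrightarrow> has_csum (\<lambda>i. r i \<otimes> s i x) I (t x)"
  shows "lincomb I r X s = t"
  by (rule extensionalityI[of _ X]) (use assms conv_sum_eq in \<open>auto simp: lincomb_def\<close>)

lemma lincomb_empty: "lincomb {} r X s = formal_zero S X"
  by (rule lincomb_eqI) (use has_csum_finite[of "{}"] in \<open>auto simp: formal_zero_def\<close>)

lemma lincomb_insert:
  assumes "finite A" "a \<notin> A" "r \<in> insert a A \<rightarrow> carrier S" "s \<in> insert a A \<rightarrow> FS X"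
  shows "lincomb (insert a A) r X s = formal_add S X (formal_scale S X (r a) (s a)) (lincomb A r X s)"
proof (rule lincomb_eqI)
  fix x assume x: "x \<in> X"
  have "has_csum (\<lambda>i. r i \<otimes> s i x) A (lincomb A r X s x)"
    by (rule lincomb_has_csum) (use x assms in \<open>auto intro: zconv_finite\<close>)
  then have "has_csum (\<lambda>i. r i \<otimes> s i x) (insert a A) (r a \<otimes> s a x \<oplus> lincomb A r X s x)"
    by (rule has_csum_insert) (use assms x formal_sums_carrier[of "s a" X x] in auto)
  then show "has_csum (\<lambda>i. r i \<otimes> s i x) (insert a A)
      (formal_add S X (formal_scale S X (r a) (s a)) (lincomb A r X s) x)"
    using x by (simp add: formal_add_def formal_scale_def)
qed (simp add: formal_add_def)

lemma push_forward_has_csum: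
  assumes "zconv r I" "x \<in> X"
  shows "has_csum r {i \<in> I. d i = x} (push_forward S T I X d r x)"
proof -
  have "zconv r {i \<in> I. d i = x}" by (rule zconv_subset[OF assms(1)]) auto
  then show ?thesis using assms(2) by (simp add: push_forward_def has_csum_conv_sum)
qed

lemma push_forward_eqI:
  assumes "t \<in> extensional X" "\<And>x. x \<in> X \<Longrightarrow> has_csum r {i \<in> I. d i = x} (t x)"
  shows "push_forward S T I X d r = t"
  by (rule extensionalityI[of _ X]) (use assms conv_sum_eq in \<open>auto simp: push_forward_def\<close>)

text \<open>A push-forward is a formal sum because linear combinations are.\<close>

lemma push_forward_lincomb:
  assumes r: "zconv r I" and "d \<in> I \<rightarrow> X"
  shows "push_forward S T I X d r = lincomb I r X (\<lambda>i. formal_unit S X (d i))"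
proof (rule push_forward_eqI)
  fix x assume x: "x \<in> X"
  have "has_csum (\<lambda>i. r i \<otimes> formal_unit S X (d i) x) I (lincomb I r X (\<lambda>i. formal_unit S X (d i)) x)"
    by (rule lincomb_has_csum[OF r _ x]) (auto simp: formal_unit_FS)
  then have "has_csum (\<lambda>i. r i \<otimes> formal_unit S X (d i) x) {i \<in> I. d i = x}
      (lincomb I r X (\<lambda>i. formal_unit S X (d i)) x)"
    by (subst (asm) has_csum_support[of "{i \<in> I. d i = x}"])
       (use x zconv_fun[OF r] in \<open>auto simp: formal_unit_def\<close>)
  then show "has_csum r {i \<in> I. d i = x} (lincomb I r X (\<lambda>i. formal_unit S X (d i)) x)"
    by (subst (asm) has_csum_cong[of _ _ r]) (use x zconv_fun[OF r] in \<open>auto simp: formal_unit_def\<close>)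
qed (simp add: lincomb_def)

lemma push_forward_FS:
  assumes r: "zconv r I" and "d \<in> I \<rightarrow> X"
  shows "push_forward S T I X d r \<in> FS X"
  unfolding push_forward_lincomb[OF assms]
  by (rule lincomb_FS[OF r]) (simp add: formal_unit_FS)

lemma push_forward_comp:
  assumes r: "zconv r I" and d: "d \<in> I \<rightarrow> Y" and e: "e \<in> Y \<rightarrow> X"
  shows "push_forward S T Y X e (push_forward S T I Y d r) = push_forward S T I X (\<lambda>i. e (d i)) r"
proof (rule push_forward_eqI)
  fix x assume x: "x \<in> X"
  show "has_csum (push_forward S T I Y d r) {y \<in> Y. e y = x} (push_forward S T I X (\<lambda>i. e (d i)) r x)"
  proof (rule has_csum_group[OF push_forward_has_csum[OF r x]])
    fix y assume y: "y \<in> {y \<in> Y. e y = x}"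
    then have "{i \<in> {i \<in> I. e (d i) = x}. d i = y} = {i \<in> I. d i = y}" by auto
    then show "has_csum r {i \<in> {i \<in> I. e (d i) = x}. d i = y} (push_forward S T I Y d r y)"
      using push_forward_has_csum[OF r, of y Y d] y by simp
  qed (use d in auto)
qed (simp add: push_forward_def)

lemma open_parens_push_forward:
  assumes r: "zconv r I" and s: "s \<in> I \<rightarrow> FS X"
  shows "open_parens S T X (push_forward S T I (FS X) s r) = lincomb I r X s"
proof -
  let ?w = "push_forward S T I (FS X) s r"
  have "conv_sum S T (\<lambda>\<sigma>. ?w \<sigma> \<otimes> \<sigma> x) (FS X) = lincomb I r X s x" if x: "x \<in> X" for x
  proof (rule conv_sum_eq, rule has_csum_group[OF lincomb_has_csum[OF r s x] s])
    fix \<sigma> assume \<sigma>: "\<sigma> \<in> FS X"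
    have "has_csum (\<lambda>i. r i \<otimes> \<sigma> x) {i \<in> I. s i = \<sigma>} (?w \<sigma> \<otimes> \<sigma> x)"
      by (rule has_csum_rmult[OF push_forward_has_csum[OF r \<sigma>] formal_sums_carrier[OF \<sigma> x]])
    then show "has_csum (\<lambda>i. r i \<otimes> s i x) {i \<in> I. s i = \<sigma>} (?w \<sigma> \<otimes> \<sigma> x)"
      by (subst has_csum_cong[of _ _ "\<lambda>i. r i \<otimes> \<sigma> x"]) auto
  qed
  then show ?thesis
    by (intro extensionalityI[of _ X]) (auto simp: open_parens_def lincomb_def)
qed

end

text \<open>
  The module axioms are identities, except for the existence of inverses, and pass to images.
\<close>

lemma left_module_image:
  assumes M: "left_module S M" and surj: "f ` carrier M = carrier N"
    and add: "\<And>x y. \<lbrakk>x \<in> carrier M; y \<in> carrier M\<rbrakk> \<Longrightarrow> f (x \<oplus>\<^bsub>M\<^esub> y) = f x \<oplus>\<^bsub>N\<^esub> f y"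
    and zero: "f \<zero>\<^bsub>M\<^esub> = \<zero>\<^bsub>N\<^esub>"
    and smult: "\<And>a x. \<lbrakk>a \<in> carrier S; x \<in> carrier M\<rbrakk> \<Longrightarrow> f (a \<odot>\<^bsub>M\<^esub> x) = a \<odot>\<^bsub>N\<^esub> f x"
  shows "left_module S N"
proof -
  interpret M: left_module S M by (rule M)
  note flip = add[symmetric] smult[symmetric] zero[symmetric]
  have N: "(\<forall>y\<in>carrier N. P y) \<longleftrightarrow> (\<forall>x\<in>carrier M. P (f x))" for P unfolding surj[symmetric] by simp
  have ex: "(\<exists>y\<in>carrier N. P y) \<longleftrightarrow> (\<exists>x\<in>carrier M. P (f x))" for P unfolding surj[symmetric] by simp
  have fN: "f x \<in> carrier N" if "x \<in> carrier M" for x using surj that by blast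
  have ab: "abelian_group N"
  proof (rule abelian_groupI)
    show "\<zero>\<^bsub>N\<^esub> \<in> carrier N" using fN[OF M.M.zero_closed] zero by simp
    have "\<forall>x\<in>carrier N. \<forall>y\<in>carrier N. x \<oplus>\<^bsub>N\<^esub> y \<in> carrier N"
      by (simp add: N flip fN)
    then show "\<And>x y. \<lbrakk>x \<in> carrier N; y \<in> carrier N\<rbrakk> \<Longrightarrow> x \<oplus>\<^bsub>N\<^esub> y \<in> carrier N" by blast
    have "\<forall>x\<in>carrier N. \<forall>y\<in>carrier N. \<forall>z\<in>carrier N. x \<oplus>\<^bsub>N\<^esub> y \<oplus>\<^bsub>N\<^esub> z = x \<oplus>\<^bsub>N\<^esub> (y \<oplus>\<^bsub>N\<^esub> z)"
      by (simp add: N flip M.M.a_assoc)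
    then show "\<And>x y z. \<lbrakk>x \<in> carrier N; y \<in> carrier N; z \<in> carrier N\<rbrakk> \<Longrightarrow>
        x \<oplus>\<^bsub>N\<^esub> y \<oplus>\<^bsub>N\<^esub> z = x \<oplus>\<^bsub>N\<^esub> (y \<oplus>\<^bsub>N\<^esub> z)" by blast
    have "\<forall>x\<in>carrier N. \<forall>y\<in>carrier N. x \<oplus>\<^bsub>N\<^esub> y = y \<oplus>\<^bsub>N\<^esub> x"
      unfolding N by (intro ballI) (simp add: flip M.M.a_comm)
    then show "\<And>x y. \<lbrakk>x \<in> carrier N; y \<in> carrier N\<rbrakk> \<Longrightarrow> x \<oplus>\<^bsub>N\<^esub> y = y \<oplus>\<^bsub>N\<^esub> x" by blast
    have "\<forall>x\<in>carrier N. \<zero>\<^bsub>N\<^esub> \<oplus>\<^bsub>N\<^esub> x = x"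
      by (simp add: N flip)
    then show "\<And>x. x \<in> carrier N \<Longrightarrow> \<zero>\<^bsub>N\<^esub> \<oplus>\<^bsub>N\<^esub> x = x" by blast
    have "\<forall>x\<in>carrier N. \<exists>y\<in>carrier N. y \<oplus>\<^bsub>N\<^esub> x = \<zero>\<^bsub>N\<^esub>"
      unfolding N ex
    proof
      fix x assume "x \<in> carrier M"
      then show "\<exists>y\<in>carrier M. f y \<oplus>\<^bsub>N\<^esub> f x = \<zero>\<^bsub>N\<^esub>"
        by (intro bexI[of _ "\<ominus>\<^bsub>M\<^esub> x"]) (simp_all add: flip M.M.l_neg)
    qed
    then show "\<And>x. x \<in> carrier N \<Longrightarrow> \<exists>y\<in>carrier N. y \<oplus>\<^bsub>N\<^esub> x = \<zero>\<^bsub>N\<^esub>" by blast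
  qed
  have "\<forall>a\<in>carrier S. \<forall>x\<in>carrier N. a \<odot>\<^bsub>N\<^esub> x \<in> carrier N \<and> \<one>\<^bsub>S\<^esub> \<odot>\<^bsub>N\<^esub> x = x \<and>
      (\<forall>b\<in>carrier S. (a \<oplus>\<^bsub>S\<^esub> b) \<odot>\<^bsub>N\<^esub> x = a \<odot>\<^bsub>N\<^esub> x \<oplus>\<^bsub>N\<^esub> b \<odot>\<^bsub>N\<^esub> x \<and>
        (a \<otimes>\<^bsub>S\<^esub> b) \<odot>\<^bsub>N\<^esub> x = a \<odot>\<^bsub>N\<^esub> (b \<odot>\<^bsub>N\<^esub> x)) \<and>
      (\<forall>y\<in>carrier N. a \<odot>\<^bsub>N\<^esub> (x \<oplus>\<^bsub>N\<^esub> y) = a \<odot>\<^bsub>N\<^esub> x \<oplus>\<^bsub>N\<^esub> a \<odot>\<^bsub>N\<^esub> y)"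
    by (simp add: N flip fN M.smult_closed M.smult_one M.smult_l_distr M.smult_assoc M.smult_r_distr)
  then show ?thesis
    by (intro left_module.intro[OF M.R.ring_axioms ab] left_module_axioms.intro) blast+
qed

locale topring_contramodule = linear_top_ring S T + contramodule S T C
  for S :: "('s, 'k) ring_scheme" (structure) and T and C :: "('s, 'c, 'i) contramodule_scheme"
begin

abbreviation \<pi> where "\<pi> \<equiv> contra_act C"
abbreviation CM where "CM \<equiv> contra_module S C"

text \<open>
  Contraassociativity for the push-forward of \<open>r\<close> along \<open>s\<close>, which replaces formal sums of formal sums by
  indexed families.
\<close>

lemma act_lincomb:
  assumes r: "zconv r I" and s: "s \<in> I \<rightarrow> FS (carrier C)"
  shows "\<pi> (lincomb I r (carrier C) s) = \<pi> (push_forward S T I (carrier C) (\<lambda>i. \<pi> (s i)) r)"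
proof -
  have pi: "\<pi> \<in> FS (carrier C) \<rightarrow> carrier C" using contra_act_closed by blast
  show ?thesis
    using contra_act_assoc[OF push_forward_FS[OF r s]]
    unfolding push_forward_comp[OF r s pi] open_parens_push_forward[OF r s] by simp
qed

text \<open>
  The value of an infinite linear combination depends only on the values of its members.  Both the module
  structure and the Nakayama lemma are obtained by replacing members by others with the same value.
\<close>

lemma act_lincomb_cong:
  assumes "zconv r I" "s \<in> I \<rightarrow> FS (carrier C)" "s' \<in> I \<rightarrow> FS (carrier C)"
    and eq: "\<And>i. i \<in> I \<Longrightarrow> \<pi> (s i) = \<pi> (s' i)"
  shows "\<pi> (lincomb I r (carrier C) s) = \<pi> (lincomb I r (carrier C) s')"
proof -
  have "{i \<in> I. \<pi> (s i) = c} = {i \<in> I. \<pi> (s' i) = c}" for c using eq by auto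
  then have "push_forward S T I (carrier C) (\<lambda>i. \<pi> (s i)) r
      = push_forward S T I (carrier C) (\<lambda>i. \<pi> (s' i)) r"
    unfolding push_forward_def by simp
  then show ?thesis using act_lincomb[OF assms(1,2)] act_lincomb[OF assms(1,3)] by simp
qed

text \<open>
  Each summand may be replaced by the basis element of its value, and for basis elements this is the
  definition of the addition.
\<close>

lemma act_add:
  assumes "s \<in> FS (carrier C)" "t \<in> FS (carrier C)"
  shows "\<pi> (formal_add S (carrier C) s t) = \<pi> s \<oplus>\<^bsub>CM\<^esub> \<pi> t"
proof -
  have *: "lincomb UNIV (\<lambda>_. \<one>) (carrier C) (\<lambda>b. if b then s else t) = formal_add S (carrier C) s t"
    if "s \<in> FS (carrier C)" "t \<in> FS (carrier C)" for s t
  proof (rule lincomb_eqI)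
    fix x assume x: "x \<in> carrier C"
    have c: "s x \<in> carrier S" "t x \<in> carrier S" using formal_sums_carrier[OF that(1) x] formal_sums_carrier[OF that(2) x] by auto
    then have "finsum S (\<lambda>b. \<one> \<otimes> (if b then s else t) x) UNIV = s x \<oplus> t x"
      by (simp add: UNIV_bool finsum_insert a_comm)
    then show "has_csum (\<lambda>b. \<one> \<otimes> (if b then s else t) x) UNIV (formal_add S (carrier C) s t x)"
      using has_csum_finite[of UNIV "\<lambda>b. \<one> \<otimes> (if b then s else t) x"] x c
      by (simp add: formal_add_def)
  qed (simp add: formal_add_def)
  let ?u = "\<lambda>s. formal_unit S (carrier C) (\<pi> s)"
  have "\<pi> (lincomb UNIV (\<lambda>_. \<one>) (carrier C) (\<lambda>b. if b then s else t)) =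
      \<pi> (lincomb UNIV (\<lambda>_. \<one>) (carrier C) (\<lambda>b. if b then ?u s else ?u t))"
    by (rule act_lincomb_cong)
      (use assms contra_act_closed contra_act_unit formal_unit_FS in \<open>auto intro: zconv_finite\<close>)
  then show ?thesis using assms by (simp add: * formal_unit_FS contra_module_def)
qed

lemma act_scale:
  assumes s: "s \<in> FS (carrier C)" and r: "r \<in> carrier S"
  shows "\<pi> (formal_scale S (carrier C) r s) = r \<odot>\<^bsub>CM\<^esub> \<pi> s"
proof -
  have *: "lincomb UNIV (\<lambda>_::unit. r) (carrier C) (\<lambda>_. s) = formal_scale S (carrier C) r s"
    if "s \<in> FS (carrier C)" for s
  proof (rule lincomb_eqI)
    fix x assume x: "x \<in> carrier C"
    then have "has_csum (\<lambda>_::unit. r \<otimes> s x) UNIV (r \<otimes> s x)"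
      using formal_sums_carrier[OF that x] r has_csum_single[of "()" UNIV "\<lambda>_. r \<otimes> s x"] by simp
    then show "has_csum (\<lambda>_::unit. r \<otimes> s x) UNIV (formal_scale S (carrier C) r s x)"
      using x by (simp add: formal_scale_def)
  qed (simp add: formal_scale_def)
  have "\<pi> (lincomb UNIV (\<lambda>_::unit. r) (carrier C) (\<lambda>_. s)) =
      \<pi> (lincomb UNIV (\<lambda>_::unit. r) (carrier C) (\<lambda>_. formal_unit S (carrier C) (\<pi> s)))"
    by (rule act_lincomb_cong)
      (use assms contra_act_closed contra_act_unit formal_unit_FS in \<open>auto intro: zconv_finite\<close>)
  then show ?thesis using assms by (simp add: * formal_unit_FS contra_module_def)
qed

lemma act_zero: "\<pi> (formal_zero S (carrier C)) = \<zero>\<^bsub>CM\<^esub>"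
  by (simp add: contra_module_def)

lemma carrier_CM [simp]: "carrier CM = carrier C"
  by (simp add: contra_module_def)

text \<open>A contramodule is a quotient of the free module on its underlying set.\<close>

lemma left_module_CM: "left_module S CM"
proof (rule left_module_image[OF left_module_formal_module, where f = \<pi>])
  show "\<pi> ` carrier (formal_module S T (carrier C)) = carrier CM"
  proof (intro equalityI subsetI)
    show "c \<in> carrier CM" if "c \<in> \<pi> ` carrier (formal_module S T (carrier C))" for c
      using that contra_act_closed by auto
    fix c assume "c \<in> carrier CM"
    then show "c \<in> \<pi> ` carrier (formal_module S T (carrier C))"
      by (intro image_eqI[of _ _ "formal_unit S (carrier C) c"]) (simp_all add: contra_act_unit formal_unit_FS)
  qed
qed (simp_all add: act_add act_scale act_zero)

lemma abelian_group_CM: "abelian_group CM"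
  by (rule left_module.axioms(2)[OF left_module_CM])

text \<open>
  The contramodule Nakayama lemma: the assumption on \<open>E\<close> says that its elements are infinite combinations of
  elements of \<open>E\<close> with arbitrarily small coefficients.  The formal sum \<open>u (Suc n)\<close> arises from \<open>u n\<close> by expanding
  every element \<open>e'\<close> of \<open>E\<close> in it into \<open>v n (u n) e'\<close>.  If the sum of all \<open>u n\<close> is written as the
  combination of the basis elements \<open>e'\<close> with coefficients \<open>u n e'\<close>, expanding all of them at once
  does not change its value, but turns it into the sum of all \<open>u (Suc n)\<close>.
\<close>

lemma contra_nakayama:
  fixes J :: "nat \<Rightarrow> 's set"
  assumes J: "\<And>n. oi (J n)" and dec: "\<And>m n. m \<le> n \<Longrightarrow> J n \<subseteq> J m"
    and base: "\<And>K. oi K \<Longrightarrow> \<exists>n. J n \<subseteq> K"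
    and E: "E \<subseteq> carrier C"
    and H: "\<And>K e. \<lbrakk>oi K; e \<in> E\<rbrakk> \<Longrightarrow> \<exists>v\<in>FS (carrier C). \<pi> v = e \<and>
      (\<forall>c\<in>carrier C. v c \<in> K) \<and> (\<forall>c\<in>carrier C - E. v c = \<zero>)"
    and e: "e \<in> E"
  shows "e = \<zero>\<^bsub>CM\<^esub>"
proof -
  let ?X = "carrier C" and ?unit = "formal_unit S (carrier C)"
  let ?P = "\<lambda>K e v. v \<in> FS ?X \<and> \<pi> v = e \<and>
      (\<forall>c\<in>?X. v c \<in> K) \<and> (\<forall>c\<in>?X - E. v c = \<zero>)"
  define V where "V K e = (SOME v. ?P K e v)" for K e
  have PV: "?P K e (V K e)" if "oi K" "e \<in> E" for K e
  proof -
    have "\<exists>v. ?P K e v" using H[OF that] by blast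
    then show ?thesis unfolding V_def by (rule someI_ex)
  qed
  have V: "\<And>K e. \<lbrakk>oi K; e \<in> E\<rbrakk> \<Longrightarrow> V K e \<in> FS ?X"
    "\<And>K e. \<lbrakk>oi K; e \<in> E\<rbrakk> \<Longrightarrow> \<pi> (V K e) = e"
    "\<And>K e c. \<lbrakk>oi K; e \<in> E; c \<in> ?X\<rbrakk> \<Longrightarrow> V K e c \<in> K"
    "\<And>K e c. \<lbrakk>oi K; e \<in> E; c \<in> ?X; c \<notin> E\<rbrakk> \<Longrightarrow> V K e c = \<zero>"
    using PV by blast+
  \<comment> \<open>The colon ideal makes the products \<open>u n e' \<otimes> v n (u n) e' c\<close> lie in \<open>J n\<close>.\<close>
  define v where "v n u e' = V (colon S (J n) (u e')) e'" for n :: nat and u :: "'c \<Rightarrow> 's" and e'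
  define u where "u = rec_nat (?unit e) (\<lambda>n u. lincomb E u ?X (v n u))"
  have u0: "u 0 = ?unit e" and uS: "u (Suc n) = lincomb E (u n) ?X (v n (u n))" for n
    by (simp_all add: u_def)
  have inv: "u n \<in> FS ?X \<and> (\<forall>c\<in>?X - E. u n c = \<zero>)" for n
  proof (induction n)
    case 0
    have "?unit e c = \<zero>" if "c \<in> ?X - E" for c using that e by (auto simp: formal_unit_def)
    then show ?case unfolding u0 by (simp add: formal_unit_FS)
  next
    case (Suc n)
    have z: "zconv (u n) E" 
      by (rule zconv_subset[OF formal_sums_zconv[of _ ?X] E]) (use Suc in blast)
    have oiK: "oi (colon S (J n) (u n e'))" if "e' \<in> E" for e'
      using colon_open[OF J] zconv_fun[OF z that] .
    have vF: "v n (u n) \<in> E \<rightarrow> FS ?X" using oiK V(1) by (auto simp: v_def)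
    have "u (Suc n) c = \<zero>" if c: "c \<in> ?X - E" for c
    proof (rule has_csum_unique)
      show "has_csum (\<lambda>i. u n i \<otimes> v n (u n) i c) E (u (Suc n) c)"
        unfolding uS by (rule lincomb_has_csum[OF z vF]) (use c in auto)
      have "has_csum (\<lambda>i. u n i \<otimes> v n (u n) i c) {} \<zero>"
        using has_csum_finite[of "{}"] by auto
      then show "has_csum (\<lambda>i. u n i \<otimes> v n (u n) i c) E \<zero>"
        by (subst has_csum_support[of "{}"])
           (use c oiK V(4) zconv_fun[OF z] in \<open>auto simp: v_def\<close>)
    qed
    then show ?case using lincomb_FS[OF z vF] by (simp add: uS)
  qed
  have z: "zconv (u n) E" for n 
    by (rule zconv_subset[OF formal_sums_zconv[of _ ?X] E]) (use inv in blast)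
  have oiK: "oi (colon S (J n) (u n e'))" if "e' \<in> E" for e' n
    using colon_open[OF J] zconv_fun[OF z that] .
  have vF: "v n (u n) \<in> E \<rightarrow> FS ?X" for n using oiK V(1) by (auto simp: v_def)
  have uJ: "u (Suc n) c \<in> J n" if c: "c \<in> ?X" for n c
    unfolding uS
  proof (rule has_csum_mem[OF lincomb_has_csum[OF z vF c] J])
    fix e' assume "e' \<in> E"
    then have "v n (u n) e' c \<in> colon S (J n) (u n e')" using V(3)[OF oiK] c by (simp add: v_def)
    then show "u n e' \<otimes> v n (u n) e' c \<in> J n" by (simp add: colon_def)
  qed
  let ?I = "UNIV \<times> E"
  define r where "r p = u (fst p) (snd p)" for p
  define s where "s p = v (fst p) (u (fst p)) (snd p)" for p
  define s' where "s' p = ?unit (snd p)" for p :: "nat \<times> 'c"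
  have rz: "zconv r ?I"
    unfolding zconv_def
  proof (intro conjI allI impI)
    show "r \<in> ?I \<rightarrow> carrier S" using zconv_fun[OF z] by (auto simp: r_def)
    fix K assume K: "oi K"
    then obtain m where m: "J m \<subseteq> K" using base by blast
    have "{p \<in> ?I. r p \<notin> K} \<subseteq> (\<Union>n\<le>m. Pair n ` {e' \<in> E. u n e' \<notin> K})"
    proof
      fix p assume p: "p \<in> {p \<in> ?I. r p \<notin> K}"
      obtain n e' where p': "p = (n, e')" by force
      have "n \<le> m"
      proof (rule ccontr)
        assume "\<not> n \<le> m"
        then obtain k where k: "n = Suc k" "m \<le> k" by (cases n) auto
        then have "u n e' \<in> J m" using uJ[of e' k] dec[of m k] p p' E by auto
        then show False using m p p' by (auto simp: r_def)
      qed
      then show "p \<in> (\<Union>n\<le>m. Pair n ` {e' \<in> E. u n e' \<notin> K})"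
        using p p' by (auto simp: r_def)
    qed
    moreover have "finite (\<Union>n\<le>m. Pair n ` {e' \<in> E. u n e' \<notin> K})"
      using has_csum_finite_part[OF z K] by auto
    ultimately show "finite {p \<in> ?I. r p \<notin> K}" using finite_subset by blast
  qed
  have sF: "s \<in> ?I \<rightarrow> FS ?X" using funcset_mem[OF vF] by (auto simp: s_def)
  have sF': "s' \<in> ?I \<rightarrow> FS ?X" by (simp add: s'_def Pi_def formal_unit_FS)
  have fibre: "{p \<in> ?I. fst p = n} = Pair n ` E" for n by auto
  have sum_s: "has_csum (\<lambda>n. u (Suc n) c) UNIV (lincomb ?I r ?X s c)" if c: "c \<in> ?X" for c
  proof (rule has_csum_group[OF lincomb_has_csum[OF rz sF c], of fst])
    fix n
    have "has_csum (\<lambda>e'. u n e' \<otimes> v n (u n) e' c) E (u (Suc n) c)"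
      unfolding uS by (rule lincomb_has_csum[OF z vF c])
    then show "has_csum (\<lambda>i. r i \<otimes> s i c) {p \<in> ?I. fst p = n} (u (Suc n) c)"
      unfolding fibre by (intro has_csum_reindex) (auto simp: r_def s_def inj_on_def)
  qed auto
  have sum_s': "has_csum (\<lambda>n. u n c) UNIV (lincomb ?I r ?X s' c)" if c: "c \<in> ?X" for c
  proof (rule has_csum_group[OF lincomb_has_csum[OF rz sF' c], of fst])
    fix n
    have uc: "u n c \<in> carrier S" using inv formal_sums_carrier[of "u n" ?X c] c by simp
    have "has_csum (\<lambda>e'. u n e' \<otimes> ?unit e' c) E (u n c)"
    proof (cases "c \<in> E")
      case True
      then show ?thesis
        using has_csum_single[of c E "\<lambda>e'. u n e' \<otimes> ?unit e' c"] uc c zconv_fun[OF z]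
        by (simp add: formal_unit_def)
    next
      case False
      then have "u n c = \<zero>" using inv c by blast
      moreover have "has_csum (\<lambda>e'. u n e' \<otimes> ?unit e' c) {} \<zero>"
        using has_csum_finite[of "{}"] by auto
      then have "has_csum (\<lambda>e'. u n e' \<otimes> ?unit e' c) E \<zero>"
        by (subst has_csum_support[of "{}"])
           (use c False zconv_fun[OF z] in \<open>auto simp: formal_unit_def\<close>)
      ultimately show ?thesis by simp
    qed
    then show "has_csum (\<lambda>i. r i \<otimes> s' i c) {p \<in> ?I. fst p = n} (u n c)"
      unfolding fibre by (intro has_csum_reindex) (auto simp: r_def s'_def inj_on_def)
  qed auto
  have LF: "lincomb ?I r ?X s \<in> FS ?X" "lincomb ?I r ?X s' \<in> FS ?X"
    using lincomb_FS[OF rz] sF sF' by auto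
  \<comment> \<open>Coefficientwise: the sum over all \<open>n\<close> is the term for \<open>0\<close> plus the sum over the successors.\<close>
  have "lincomb ?I r ?X s' = formal_add S ?X (?unit e) (lincomb ?I r ?X s)"
  proof (rule formal_sums_eqI[OF LF(2) formal_add_FS[OF formal_unit_FS LF(1)]])
    fix c assume c: "c \<in> ?X"
    have "has_csum (\<lambda>n. u n c) UNIV (u 0 c \<oplus> lincomb ?I r ?X s c)"
      by (rule has_csum_nat[OF sum_s[OF c]]) (use inv[of 0] formal_sums_carrier[of "u 0" ?X c] c in simp)
    then have "lincomb ?I r ?X s' c = u 0 c \<oplus> lincomb ?I r ?X s c"
      using sum_s'[OF c] has_csum_unique by blast
    then show "lincomb ?I r ?X s' c = formal_add S ?X (?unit e) (lincomb ?I r ?X s) c"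
      using c by (simp add: formal_add_def u0)
  qed
  then have "\<pi> (lincomb ?I r ?X s') = e \<oplus>\<^bsub>CM\<^esub> \<pi> (lincomb ?I r ?X s)"
    using act_add[OF formal_unit_FS LF(1)] contra_act_unit E e by auto
  moreover have "\<pi> (lincomb ?I r ?X s) = \<pi> (lincomb ?I r ?X s')"
    by (rule act_lincomb_cong[OF rz sF sF'])
       (use oiK V(2) E contra_act_unit in \<open>auto simp: s_def s'_def v_def\<close>)
  moreover have "\<pi> (lincomb ?I r ?X s) \<in> carrier CM" "e \<in> carrier CM"
    using contra_act_closed[OF LF(1)] e E by auto
  moreover interpret CM: abelian_group CM by (rule abelian_group_CM)
  have "\<zero>\<^bsub>CM\<^esub> \<oplus>\<^bsub>CM\<^esub> \<pi> (lincomb ?I r ?X s) = e \<oplus>\<^bsub>CM\<^esub> \<pi> (lincomb ?I r ?X s)"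
    using calculation by simp
  ultimately show ?thesis using CM.add.right_cancel CM.zero_closed by metis
qed

end

context linear_top_ring
begin

lemma push_forward_add:
  assumes s: "s \<in> FS X" and t: "t \<in> FS X"
  shows "push_forward S T X Y d (formal_add S X s t) =
    formal_add S Y (push_forward S T X Y d s) (push_forward S T X Y d t)"
proof (rule push_forward_eqI)
  fix y assume y: "y \<in> Y"
  have "has_csum (\<lambda>x. s x \<oplus> t x) {x \<in> X. d x = y}
      (push_forward S T X Y d s y \<oplus> push_forward S T X Y d t y)"
    by (intro has_csum_add push_forward_has_csum formal_sums_zconv s t y)
  then show "has_csum (formal_add S X s t) {x \<in> X. d x = y}
      (formal_add S Y (push_forward S T X Y d s) (push_forward S T X Y d t) y)"
    using y by (subst has_csum_cong[of _ _ "\<lambda>x. s x \<oplus> t x"]) (simp_all add: formal_add_def)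
qed (simp add: formal_add_def)

lemma push_forward_scale:
  assumes s: "s \<in> FS X" and r: "r \<in> carrier S"
  shows "push_forward S T X Y d (formal_scale S X r s) = formal_scale S Y r (push_forward S T X Y d s)"
proof (rule push_forward_eqI)
  fix y assume y: "y \<in> Y"
  have "has_csum (\<lambda>x. r \<otimes> s x) {x \<in> X. d x = y} (r \<otimes> push_forward S T X Y d s y)"
    by (intro has_csum_lmult push_forward_has_csum formal_sums_zconv s r y)
  then show "has_csum (formal_scale S X r s) {x \<in> X. d x = y}
      (formal_scale S Y r (push_forward S T X Y d s) y)"
    using y by (subst has_csum_cong[of _ _ "\<lambda>x. r \<otimes> s x"]) (simp_all add: formal_scale_def)
qed (simp add: formal_scale_def)

lemma push_forward_unit:
  assumes x: "x \<in> X" and d: "d \<in> X \<rightarrow> Y"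
  shows "push_forward S T X Y d (formal_unit S X x) = formal_unit S Y (d x)"
proof (rule push_forward_eqI)
  fix y assume y: "y \<in> Y"
  show "has_csum (formal_unit S X x) {x \<in> X. d x = y} (formal_unit S Y (d x) y)"
  proof (cases "d x = y")
    case True
    then show ?thesis
      using has_csum_single[of x "{x \<in> X. d x = y}" "formal_unit S X x"] x y
      by (auto simp: formal_unit_def)
  next
    case False
    have "has_csum (formal_unit S X x) {} (finsum S (formal_unit S X x) {})"
      by (rule has_csum_finite) auto
    then have "has_csum (formal_unit S X x) {x \<in> X. d x = y} \<zero>"
      by (subst has_csum_support[of "{}"]) (use False in \<open>auto simp: formal_unit_def\<close>)
    then show ?thesis using False y by (simp add: formal_unit_def)
  qed
qed (simp add: formal_unit_def)

end

section \<open>Dense subrings with finitely generated open right ideals\<close>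

text \<open>
  A ring with a countable base \<open>J\<close> of open right ideals, a dense image of another ring \<open>R\<close>, and strong finite
  generation: in \<open>fg\<close> not only is \<open>J n\<close> generated by \<open>\<rho> ` A\<close>, but the coefficients \<open>t a\<close> can be taken from
  \<open>J k\<close> as soon as \<open>s\<close> belongs to the neighbourhood \<open>L k\<close> of zero.
\<close>

locale fg_dense = linear_top_ring S T + R: ring R
  for S :: "('s, 'k) ring_scheme" (structure) and T
    and R :: "('r, 'l) ring_scheme" and \<rho> :: "'r \<Rightarrow> 's" and J :: "nat \<Rightarrow> 's set" +
  assumes rho_hom: "\<rho> \<in> ring_hom R S"
    and J_open: "open_right_ideal (J n) S T"
    and J_dec: "m \<le> n \<Longrightarrow> J n \<subseteq> J m"
    and J_base: "open_right_ideal K S T \<Longrightarrow> \<exists>n. J n \<subseteq> K"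
    and dense: "x \<in> carrier S \<Longrightarrow> \<exists>r\<in>carrier R. x \<ominus> \<rho> r \<in> J n"
    and fg: "\<exists>A L. finite A \<and> A \<subseteq> carrier R \<and> \<rho> ` A \<subseteq> J n \<and> (\<forall>k::nat. open_right_ideal (L k) S T) \<and>
      (\<forall>s\<in>J n. \<exists>t\<in>A \<rightarrow> carrier S. s = finsum S (\<lambda>a. \<rho> a \<otimes> t a) A \<and>
        (\<forall>k. s \<in> L k \<longrightarrow> (\<forall>a\<in>A. t a \<in> J k)))"
begin

lemma rho_closed [simp]: "r \<in> carrier R \<Longrightarrow> \<rho> r \<in> carrier S"
  using rho_hom by (auto simp: ring_hom_def)

text \<open>
  The coefficients are chosen separately for every \<open>x\<close>.  Each of the families \<open>t a\<close> converges to zero because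
  \<open>t a x\<close> lies in \<open>J k\<close> for all \<open>x\<close> with \<open>s x\<close> in \<open>L k\<close>, that is, for almost all \<open>x\<close>.
\<close>

lemma fg_factor:
  assumes s: "s \<in> FS X" and sJ: "\<And>x. x \<in> X \<Longrightarrow> s x \<in> J n"
  obtains A t where "finite A" "A \<subseteq> carrier R" "\<rho> ` A \<subseteq> J n" "t \<in> A \<rightarrow> FS X" "s = lincomb A \<rho> X t"
proof -
  obtain A L where A: "finite A" "A \<subseteq> carrier R" "\<rho> ` A \<subseteq> J n" and L: "\<And>k::nat. oi (L k)"
    and AL: "\<And>s. s \<in> J n \<Longrightarrow> \<exists>t\<in>A \<rightarrow> carrier S. s = finsum S (\<lambda>a. \<rho> a \<otimes> t a) A \<and>
        (\<forall>k. s \<in> L k \<longrightarrow> (\<forall>a\<in>A. t a \<in> J k))"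
    using fg[of n] by blast
  have "\<forall>x\<in>X. \<exists>t. t \<in> A \<rightarrow> carrier S \<and> s x = finsum S (\<lambda>a. \<rho> a \<otimes> t a) A \<and>
        (\<forall>k. s x \<in> L k \<longrightarrow> (\<forall>a\<in>A. t a \<in> J k))"
    using AL[OF sJ] by blast
  then obtain \<tau> where \<tau>: "\<forall>x\<in>X. \<tau> x \<in> A \<rightarrow> carrier S \<and> s x = finsum S (\<lambda>a. \<rho> a \<otimes> \<tau> x a) A \<and>
        (\<forall>k. s x \<in> L k \<longrightarrow> (\<forall>a\<in>A. \<tau> x a \<in> J k))"
    by (rule bchoice[THEN exE])
  define t where "t a = (\<lambda>x\<in>X. \<tau> x a)" for a
  have \<tau>c: "\<tau> x a \<in> carrier S" if "x \<in> X" "a \<in> A" for x a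
    using \<tau> that by auto
  have t: "t a \<in> FS X" if a: "a \<in> A" for a
    unfolding formal_sums_iff zconv_def
  proof (intro conjI allI impI)
    show "t a \<in> X \<rightarrow> carrier S" using \<tau>c a by (simp add: t_def)
    fix K assume "oi K"
    then obtain k where k: "J k \<subseteq> K" using J_base by blast
    have "{x \<in> X. t a x \<notin> K} \<subseteq> {x \<in> X. s x \<notin> L k}"
    proof
      fix x assume x: "x \<in> {x \<in> X. t a x \<notin> K}"
      then have "\<tau> x a \<notin> J k" using k by (auto simp: t_def)
      then have "s x \<notin> L k" using \<tau> x a by blast
      then show "x \<in> {x \<in> X. s x \<notin> L k}" using x by simp
    qed
    then show "finite {x \<in> X. t a x \<notin> K}"
      using has_csum_finite_part[OF formal_sums_zconv[OF s] L] finite_subset by blast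
  qed (simp add: t_def)
  have "lincomb A \<rho> X t = s"
  proof (rule lincomb_eqI)
    fix x assume x: "x \<in> X"
    have c: "(\<lambda>a. \<rho> a \<otimes> t a x) \<in> A \<rightarrow> carrier S"
      using \<tau>c x A by (auto simp: t_def)
    have "s x = finsum S (\<lambda>a. \<rho> a \<otimes> t a x) A" using \<tau> x by (simp add: t_def)
    then show "has_csum (\<lambda>a. \<rho> a \<otimes> t a x) A (s x)"
      using has_csum_finite[OF A(1) c] by simp
  qed (use s in \<open>simp add: formal_sums_iff\<close>)
  then show thesis using that[of A t] A t by auto
qed

text \<open>
  Finitely many coefficients of \<open>s\<close> lie outside \<open>J n\<close>.  Approximating these by elements of \<open>R\<close> leaves
  a remainder with all coefficients in \<open>J n\<close>, to which \<open>fg_factor\<close> applies.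
\<close>

lemma decompose:
  assumes s: "s \<in> FS X"
  obtains F r A t where "finite F" "F \<subseteq> X" "r \<in> F \<rightarrow> carrier R"
    "\<forall>x\<in>X - F. s x \<in> J n" "\<forall>x\<in>F. s x \<ominus> \<rho> (r x) \<in> J n"
    "finite A" "A \<subseteq> carrier R" "\<rho> ` A \<subseteq> J n" "t \<in> A \<rightarrow> FS X"
    "s = formal_add S X (lincomb F (\<lambda>x. \<rho> (r x)) X (formal_unit S X)) (lincomb A \<rho> X t)"
proof -
  let ?F = "{x \<in> X. s x \<notin> J n}"
  have fin: "finite ?F" using has_csum_finite_part[OF formal_sums_zconv[OF s] J_open] .
  have "\<forall>x\<in>?F. \<exists>r. r \<in> carrier R \<and> s x \<ominus> \<rho> r \<in> J n"
    using dense formal_sums_carrier[OF s] by blast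
  then obtain r where r: "\<forall>x\<in>?F. r x \<in> carrier R \<and> s x \<ominus> \<rho> (r x) \<in> J n"
    by (rule bchoice[THEN exE])
  have rc: "\<rho> (r x) \<in> carrier S" if "x \<in> ?F" for x using r that by simp
  define m where "m = (\<lambda>x\<in>X. if x \<in> ?F then \<rho> (r x) else \<zero>)"
  have mF: "m \<in> FS X"
  proof -
    have "zconv m X"
      by (rule zconv_support[OF fin]) (use rc in \<open>auto simp: m_def\<close>)
    then show ?thesis unfolding formal_sums_iff by (simp add: m_def)
  qed
  have m: "lincomb ?F (\<lambda>x. \<rho> (r x)) X (formal_unit S X) = m"
  proof (rule lincomb_eqI)
    fix y assume y: "y \<in> X"
    show "has_csum (\<lambda>i. \<rho> (r i) \<otimes> formal_unit S X i y) ?F (m y)"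
    proof (cases "y \<in> ?F")
      case True
      then show ?thesis
        using has_csum_single[of y ?F "\<lambda>i. \<rho> (r i) \<otimes> formal_unit S X i y"] rc
        by (auto simp: formal_unit_def m_def)
    next
      case False
      have "has_csum (\<lambda>i. \<rho> (r i) \<otimes> formal_unit S X i y) {} (finsum S (\<lambda>i. \<rho> (r i) \<otimes> formal_unit S X i y) {})"
        by (rule has_csum_finite) auto
      then have "has_csum (\<lambda>i. \<rho> (r i) \<otimes> formal_unit S X i y) ?F \<zero>"
        by (subst has_csum_support[of "{}"]) (use False y rc in \<open>auto simp: formal_unit_def\<close>)
      then show ?thesis using False y by (simp add: m_def)
    qed
  qed (simp add: m_def)
  define s' where "s' = formal_add S X s (formal_scale S X (\<ominus> \<one>) m)"
  have s': "s' \<in> FS X" unfolding s'_def by (intro formal_add_FS formal_scale_FS s mF) simp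
  have mc: "m x \<in> carrier S" if "x \<in> X" for x using formal_sums_carrier[OF mF that] .
  have sc: "s x \<in> carrier S" if "x \<in> X" for x using formal_sums_carrier[OF s that] .
  have s'x: "s' x = s x \<ominus> m x" if "x \<in> X" for x
    using that mc[OF that] by (simp add: s'_def formal_add_def formal_scale_def a_minus_def l_minus)
  have s'J: "s' x \<in> J n" if "x \<in> X" for x
    using that r s'x[OF that] sc[OF that] by (auto simp: m_def a_minus_def)
  obtain A t where A: "finite A" "A \<subseteq> carrier R" "\<rho> ` A \<subseteq> J n" "t \<in> A \<rightarrow> FS X" "s' = lincomb A \<rho> X t"
    using fg_factor[OF s' s'J] by blast
  have "s = formal_add S X m s'"
  proof (rule formal_sums_eqI[OF s formal_add_FS[OF mF s']])
    fix x assume x: "x \<in> X"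
    then show "s x = formal_add S X m s' x"
      using s'x[OF x] add_diff_cancel[OF mc[OF x] sc[OF x]] by (simp add: formal_add_def)
  qed
  then show thesis using that[OF fin _ _ _ _ A(1,2,3,4), of r] r A(5) m by auto
qed

definition formal_linear :: "'x set \<Rightarrow> ('r, 'm, 'i) module_scheme \<Rightarrow> (('x \<Rightarrow> 's) \<Rightarrow> 'm) \<Rightarrow> bool" where
  "formal_linear X M g \<longleftrightarrow> g \<in> FS X \<rightarrow> carrier M \<and>
     (\<forall>s\<in>FS X. \<forall>t\<in>FS X. g (formal_add S X s t) = g s \<oplus>\<^bsub>M\<^esub> g t) \<and>
     (\<forall>r\<in>carrier R. \<forall>s\<in>FS X. g (formal_scale S X (\<rho> r) s) = r \<odot>\<^bsub>M\<^esub> g s)"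

lemma formal_linearD:
  assumes "formal_linear X M g"
  shows "s \<in> FS X \<Longrightarrow> g s \<in> carrier M"
    and "\<lbrakk>s \<in> FS X; t \<in> FS X\<rbrakk> \<Longrightarrow> g (formal_add S X s t) = g s \<oplus>\<^bsub>M\<^esub> g t"
    and "\<lbrakk>r \<in> carrier R; s \<in> FS X\<rbrakk> \<Longrightarrow> g (formal_scale S X (\<rho> r) s) = r \<odot>\<^bsub>M\<^esub> g s"
  using assms by (auto simp: formal_linear_def)

lemma linear_lincomb:
  assumes M: "left_module R M" and g: "formal_linear X M g"
    and A: "finite A" and r: "r \<in> A \<rightarrow> carrier R" and t: "t \<in> A \<rightarrow> FS X"
  shows "g (lincomb A (\<lambda>a. \<rho> (r a)) X t) = finsum M (\<lambda>a. r a \<odot>\<^bsub>M\<^esub> g (t a)) A"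
  using A r t
proof (induction A)
  interpret M: left_module R M by (rule M)
  interpret FM: left_module S "formal_module S T X" by (rule left_module_formal_module)
  case empty
  have z: "g (formal_zero S X) \<in> carrier M" by (rule formal_linearD(1)[OF g formal_zero_FS])
  have "g (formal_zero S X) \<oplus>\<^bsub>M\<^esub> g (formal_zero S X) = g (formal_zero S X)"
    using formal_linearD(2)[OF g formal_zero_FS formal_zero_FS] FM.M.l_zero[OF FM.M.zero_closed] by simp
  then have "g (formal_zero S X) = \<zero>\<^bsub>M\<^esub>" using z by (metis M.add.l_cancel_one)
  then show ?case by (simp add: lincomb_empty)
next
  interpret M: left_module R M by (rule M)
  case (insert a A)
  then have c: "\<And>a. a \<in> A \<Longrightarrow> r a \<in> carrier R" "\<And>a. a \<in> A \<Longrightarrow> t a \<in> FS X" "r a \<in> carrier R" "t a \<in> FS X"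
    by auto
  note gc = formal_linearD(1)[OF g]
  have "lincomb (insert a A) (\<lambda>a. \<rho> (r a)) X t =
      formal_add S X (formal_scale S X (\<rho> (r a)) (t a)) (lincomb A (\<lambda>a. \<rho> (r a)) X t)"
    by (rule lincomb_insert) (use insert c in auto)
  moreover have l: "lincomb A (\<lambda>a. \<rho> (r a)) X t \<in> FS X"
    by (rule lincomb_FS) (use insert c in \<open>auto intro!: zconv_finite\<close>)
  ultimately have "g (lincomb (insert a A) (\<lambda>a. \<rho> (r a)) X t) =
      r a \<odot>\<^bsub>M\<^esub> g (t a) \<oplus>\<^bsub>M\<^esub> finsum M (\<lambda>a. r a \<odot>\<^bsub>M\<^esub> g (t a)) A"
    using formal_linearD(2)[OF g formal_scale_FS[OF c(4) rho_closed[OF c(3)]] l]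
      formal_linearD(3)[OF g c(3,4)] insert by simp
  also have "\<dots> = finsum M (\<lambda>a. r a \<odot>\<^bsub>M\<^esub> g (t a)) (insert a A)"
    using insert.hyps c gc M.smult_closed by (subst M.M.finsum_insert) auto
  finally show ?case .
qed

text \<open>
  A map that is only linear over \<open>R\<close> does not commute with infinite sums, but the decomposition is finite.
\<close>

lemma linear_decompose:
  assumes M: "left_module R M" and g: "formal_linear X M g" and s: "s \<in> FS X"
  obtains F r A t where "finite F" "F \<subseteq> X" "r \<in> F \<rightarrow> carrier R"
    "\<forall>x\<in>X - F. s x \<in> J n" "\<forall>x\<in>F. s x \<ominus> \<rho> (r x) \<in> J n"
    "finite A" "A \<subseteq> carrier R" "\<rho> ` A \<subseteq> J n" "t \<in> A \<rightarrow> FS X"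
    "g s = finsum M (\<lambda>x. r x \<odot>\<^bsub>M\<^esub> g (formal_unit S X x)) F \<oplus>\<^bsub>M\<^esub> finsum M (\<lambda>a. a \<odot>\<^bsub>M\<^esub> g (t a)) A"
proof -
  obtain F r A t where F: "finite F" "F \<subseteq> X" and r: "r \<in> F \<rightarrow> carrier R"
    and sJ: "\<forall>x\<in>X - F. s x \<in> J n" and rJ: "\<forall>x\<in>F. s x \<ominus> \<rho> (r x) \<in> J n"
    and A: "finite A" "A \<subseteq> carrier R" "\<rho> ` A \<subseteq> J n" and t: "t \<in> A \<rightarrow> FS X"
    and eq: "s = formal_add S X (lincomb F (\<lambda>x. \<rho> (r x)) X (formal_unit S X)) (lincomb A \<rho> X t)"
    by (rule decompose[OF s, of n]) (rule that; assumption)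
  have u: "formal_unit S X \<in> F \<rightarrow> FS X" by (simp add: Pi_def formal_unit_FS)
  have l1: "lincomb F (\<lambda>x. \<rho> (r x)) X (formal_unit S X) \<in> FS X"
    by (rule lincomb_FS[OF zconv_finite[OF F(1)] u]) (use r in \<open>auto simp: Pi_def\<close>)
  have l2: "lincomb A \<rho> X t \<in> FS X"
    by (rule lincomb_FS[OF zconv_finite[OF A(1)] t]) (use A in auto)
  have "g s = g (lincomb F (\<lambda>x. \<rho> (r x)) X (formal_unit S X)) \<oplus>\<^bsub>M\<^esub> g (lincomb A \<rho> X t)"
    by (subst eq) (rule formal_linearD(2)[OF g l1 l2])
  moreover have "g (lincomb A \<rho> X t) = finsum M (\<lambda>a. a \<odot>\<^bsub>M\<^esub> g (t a)) A"
    by (rule linear_lincomb[OF M g A(1) _ t, of "\<lambda>a. a"]) (use A in auto)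
  ultimately show thesis using that[OF F r sJ rJ A t] linear_lincomb[OF M g F(1) r u] by simp
qed

abbreviation restr :: "('s, 'm, 'i) module_scheme \<Rightarrow> ('r, 'm) module" where
  "restr \<equiv> restrict_scalars \<rho>"

lemma restr_simps [simp]:
  "carrier (restr M) = carrier M" "add (restr M) = add M" "zero (restr M) = zero M"
  "smult (restr M) r x = \<rho> r \<odot>\<^bsub>M\<^esub> x"
  by (simp_all add: restrict_scalars_def)

lemma abelian_group_restr: "abelian_group M \<Longrightarrow> abelian_group (restr M)"
proof -
  assume "abelian_group M"
  then interpret M: abelian_group M .
  show ?thesis
    by (rule abelian_groupI) (auto simp: M.a_assoc intro: M.a_comm M.l_neg)
qed

lemma left_module_restr:
  assumes "left_module S M"
  shows "left_module R (restr M)"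
proof -
  interpret M: left_module S M by fact
  show ?thesis
    by (rule left_module.intro[OF R.ring_axioms abelian_group_restr[OF M.M.abelian_group_axioms]],
        rule left_module_axioms.intro)
      (use rho_hom in \<open>auto simp: ring_hom_def M.smult_closed M.smult_l_distr M.smult_r_distr
        M.smult_assoc M.smult_one\<close>)
qed

end

locale fg_contramodule = fg_dense S T R \<rho> J + topring_contramodule S T C
  for S :: "('s, 'k) ring_scheme" (structure) and T
    and R :: "('r, 'l) ring_scheme" and \<rho> :: "'r \<Rightarrow> 's" and J :: "nat \<Rightarrow> 's set"
    and C :: "('s, 'c, 'i) contramodule_scheme"
begin

lemma left_module_restr_CM: "left_module R (restr CM)"
  by (rule left_module_restr[OF left_module_CM])

lemma act_linear: "formal_linear (carrier C) (restr CM) \<pi>"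
  by (simp add: formal_linear_def contra_act_closed act_add act_scale)

text \<open>A finite combination is a formal sum of finite support.\<close>

lemma contra_nakayama_finite:
  assumes "E \<subseteq> carrier C"
    and "\<And>n e. e \<in> E \<Longrightarrow> \<exists>A t. finite A \<and> A \<subseteq> carrier R \<and> \<rho> ` A \<subseteq> J n \<and> t \<in> A \<rightarrow> E \<and>
      e = finsum (restr CM) (\<lambda>a. \<rho> a \<odot>\<^bsub>CM\<^esub> t a) A"
    and "e \<in> E"
  shows "e = \<zero>\<^bsub>CM\<^esub>"
proof (rule contra_nakayama[OF J_open J_dec J_base assms(1) _ assms(3)])
  fix K e assume "oi K" and e: "e \<in> E"
  then obtain n where n: "J n \<subseteq> K" using J_base by blast
  obtain A t where A: "finite A" "A \<subseteq> carrier R" "\<rho> ` A \<subseteq> J n" and t: "t \<in> A \<rightarrow> E"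
    and e: "e = finsum (restr CM) (\<lambda>a. \<rho> a \<odot>\<^bsub>CM\<^esub> t a) A"
    using assms(2)[OF e, of n] by blast
  let ?u = "\<lambda>a. formal_unit S (carrier C) (t a)"
  let ?v = "lincomb A \<rho> (carrier C) ?u"
  have z: "zconv \<rho> A" by (rule zconv_finite[OF A(1)]) (use A in auto)
  have uF: "?u \<in> A \<rightarrow> FS (carrier C)" by (simp add: Pi_def formal_unit_FS)
  have tc: "t a \<in> carrier C" if "a \<in> A" for a using t assms(1) that by auto
  have "\<pi> ?v = finsum (restr CM) (\<lambda>a. \<rho> a \<odot>\<^bsub>CM\<^esub> \<pi> (?u a)) A"
    using linear_lincomb[OF left_module_restr_CM act_linear A(1) _ uF, of "\<lambda>a. a"] A(2) by auto
  also have "\<dots> = e"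
    unfolding e
    by (rule abelian_monoid.finsum_cong')
      (use A tc contra_act_unit left_module.axioms(2)[OF left_module_restr_CM]
        left_module.smult_closed[OF left_module_CM] in \<open>auto simp: abelian_group_def\<close>)
  finally have 1: "\<pi> ?v = e" .
  have 2: "?v c \<in> K" if c: "c \<in> carrier C" for c
  proof -
    have "?v c \<in> J n"
    proof (rule has_csum_mem[OF lincomb_has_csum[OF z uF c] J_open])
      fix a assume "a \<in> A"
      then show "\<rho> a \<otimes> ?u a c \<in> J n"
        using A(3) oi_rmult[OF J_open, of "\<rho> a" n "?u a c"] formal_sums_carrier[OF formal_unit_FS c] by auto
    qed
    then show ?thesis using n by blast
  qed
  have 3: "?v c = \<zero>" if c: "c \<in> carrier C - E" for c
  proof (rule has_csum_unique)
    show "has_csum (\<lambda>a. \<rho> a \<otimes> ?u a c) A (?v c)"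
      by (rule lincomb_has_csum[OF z uF]) (use c in auto)
    have "has_csum (\<lambda>a. \<rho> a \<otimes> ?u a c) {} (finsum S (\<lambda>a. \<rho> a \<otimes> ?u a c) {})"
      by (rule has_csum_finite) auto
    then show "has_csum (\<lambda>a. \<rho> a \<otimes> ?u a c) A \<zero>"
      by (subst has_csum_support[of "{}"]) (use c t A in \<open>auto simp: formal_unit_def\<close>)
  qed
  show "\<exists>v\<in>FS (carrier C). \<pi> v = e \<and> (\<forall>c\<in>carrier C. v c \<in> K) \<and> (\<forall>c\<in>carrier C - E. v c = \<zero>)"
    using 1 2 3 lincomb_FS[OF z uF] by blast
qed

lemma ideal_contra_subgroup:
  assumes K: "oi K"
  shows "subgroup (ideal_contra S T K C) (add_monoid (restr CM))"
proof -
  interpret CM: left_module R "restr CM" by (rule left_module_restr_CM)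
  let ?P = "{s \<in> FS (carrier C). \<forall>c\<in>carrier C. s c \<in> K}"
  have add: "formal_add S (carrier C) s t \<in> ?P" if "s \<in> ?P" "t \<in> ?P" for s t
    using that formal_add_FS[of s _ t] oi_add[OF K] by (auto simp: formal_add_def)
  have neg: "formal_scale S (carrier C) (\<ominus> \<one>) s \<in> ?P" if "s \<in> ?P" for s
    using that formal_scale_FS[of s "carrier C" "\<ominus> \<one>"] oi_uminus[OF K] formal_sums_carrier[of s]
    by (auto simp: formal_scale_def l_minus)
  have zero: "formal_zero S (carrier C) \<in> ?P"
    using formal_zero_FS[of "carrier C"] oi_zero[OF K] by (auto simp: formal_zero_def)
  show ?thesis
  proof (rule CM.add.subgroupI)
    show "ideal_contra S T K C \<subseteq> carrier (restr CM)"
      using contra_act_closed by (auto simp: ideal_contra_def)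
    show "ideal_contra S T K C \<noteq> {}" using zero by (auto simp: ideal_contra_def)
    fix x assume "x \<in> ideal_contra S T K C"
    then obtain s where s: "s \<in> ?P" "x = \<pi> s" by (auto simp: ideal_contra_def)
    have sF: "s \<in> FS (carrier C)" using s by simp
    have "formal_add S (carrier C) s (formal_scale S (carrier C) (\<ominus> \<one>) s) = formal_zero S (carrier C)"
      using formal_sums_carrier[OF sF]
      by (auto simp: formal_add_def formal_scale_def formal_zero_def l_minus r_neg intro!: restrict_ext)
    then have "x \<oplus>\<^bsub>CM\<^esub> \<pi> (formal_scale S (carrier C) (\<ominus> \<one>) s) = \<zero>\<^bsub>CM\<^esub>"
      using act_add[OF sF formal_scale_FS[OF sF], of "\<ominus> \<one>"] s act_zero by simp
    then have "\<pi> (formal_scale S (carrier C) (\<ominus> \<one>) s) \<oplus>\<^bsub>restr CM\<^esub> x = \<zero>\<^bsub>restr CM\<^esub>"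
      using CM.M.a_comm[of x "\<pi> (formal_scale S (carrier C) (\<ominus> \<one>) s)"]
        contra_act_closed[OF formal_scale_FS[OF sF], of "\<ominus> \<one>"] contra_act_closed[OF sF] s by simp
    then have "\<ominus>\<^bsub>restr CM\<^esub> x = \<pi> (formal_scale S (carrier C) (\<ominus> \<one>) s)"
      by (rule CM.M.minus_equality)
        (use contra_act_closed[OF formal_scale_FS[OF sF], of "\<ominus> \<one>"] contra_act_closed[OF sF] s in auto)
    then show "\<ominus>\<^bsub>restr CM\<^esub> x \<in> ideal_contra S T K C"
      using neg[OF s(1)] unfolding ideal_contra_def by blast
    fix y assume "y \<in> ideal_contra S T K C"
    then obtain t where t: "t \<in> ?P" "y = \<pi> t" by (auto simp: ideal_contra_def)
    have "x \<oplus>\<^bsub>restr CM\<^esub> y = \<pi> (formal_add S (carrier C) s t)"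
      using act_add[of s t] s t by simp
    then show "x \<oplus>\<^bsub>restr CM\<^esub> y \<in> ideal_contra S T K C"
      using add[OF s(1) t(1)] unfolding ideal_contra_def by blast
  qed
qed

text \<open>
  For \<open>J n \<subseteq> K\<close> both kinds of coefficients in the decomposition of a formal sum with coefficients in \<open>K\<close>
  belong to \<open>I\<close>: the generators because \<open>\<rho> ` A \<subseteq> J n\<close>, and the \<open>r x\<close> because they approximate elements of \<open>K\<close>.
\<close>

lemma ideal_smult_eq_ideal_contra:
  assumes K: "oi K" and I: "I = {r \<in> carrier R. \<rho> r \<in> K}"
  shows "ideal_smult I (restr CM) = ideal_contra S T K C"
proof
  interpret RM: left_module R "restr CM" by (rule left_module_restr_CM)
  let ?H = "{r \<odot>\<^bsub>restr CM\<^esub> x | r x. r \<in> I \<and> x \<in> carrier (restr CM)}"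
  have H: "?H \<subseteq> carrier (restr CM)" using I RM.smult_closed by auto
  have "?H \<subseteq> ideal_contra S T K C"
  proof
    fix y assume "y \<in> ?H"
    then obtain r c where r: "r \<in> I" and c: "c \<in> carrier C" and y: "y = \<rho> r \<odot>\<^bsub>CM\<^esub> c" by auto
    let ?s = "formal_scale S (carrier C) (\<rho> r) (formal_unit S (carrier C) c)"
    have rc: "\<rho> r \<in> carrier S" "\<rho> r \<in> K" using r I by auto
    have "\<pi> ?s = y" using act_scale[OF formal_unit_FS rc(1)] contra_act_unit[OF c] y by simp
    moreover have "?s \<in> FS (carrier C)" by (rule formal_scale_FS[OF formal_unit_FS rc(1)])
    moreover have "\<forall>c\<in>carrier C. ?s c \<in> K"
      using rc oi_rmult[OF K] oi_zero[OF K] by (auto simp: formal_scale_def formal_unit_def)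
    ultimately show "y \<in> ideal_contra S T K C" unfolding ideal_contra_def by blast
  qed
  then show "ideal_smult I (restr CM) \<subseteq> ideal_contra S T K C"
    unfolding ideal_smult_def
    by (rule RM.add.generate_subgroup_incl[OF _ ideal_contra_subgroup[OF K]])
  have sub: "subgroup (ideal_smult I (restr CM)) (add_monoid (restr CM))"
    unfolding ideal_smult_def by (rule RM.add.generate_is_subgroup[OF H])
  have HI: "\<rho> r \<odot>\<^bsub>CM\<^esub> x \<in> ideal_smult I (restr CM)" if "r \<in> I" "x \<in> carrier C" for r x
    unfolding ideal_smult_def by (rule generate.incl) (use that in auto)
  have sum: "finsum (restr CM) f A \<in> ideal_smult I (restr CM)"
    if "finite A" "\<And>a. a \<in> A \<Longrightarrow> f a \<in> ideal_smult I (restr CM)" for f :: "'z \<Rightarrow> 'c" and A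
    using that
  proof (induction A)
    case empty
    show ?case using subgroup.one_closed[OF sub] by simp
  next
    case (insert a A)
    have "f \<in> A \<rightarrow> carrier (restr CM)" "f a \<in> carrier (restr CM)"
      using insert subgroup.subset[OF sub] by auto
    then have "finsum (restr CM) f (insert a A) = f a \<oplus>\<^bsub>restr CM\<^esub> finsum (restr CM) f A"
      by (intro RM.M.finsum_insert insert)
    then show ?case using subgroup.m_closed[OF sub] insert by auto
  qed
  show "ideal_contra S T K C \<subseteq> ideal_smult I (restr CM)"
  proof
    fix y assume "y \<in> ideal_contra S T K C"
    then obtain s where s: "s \<in> FS (carrier C)" and sK: "\<And>c. c \<in> carrier C \<Longrightarrow> s c \<in> K" and y: "y = \<pi> s"
      unfolding ideal_contra_def by blast
    obtain n where n: "J n \<subseteq> K" using J_base[OF K] by blast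
    obtain F r A t where F: "finite F" "F \<subseteq> carrier C" and r: "r \<in> F \<rightarrow> carrier R"
      and "\<forall>x\<in>carrier C - F. s x \<in> J n" and rJ: "\<forall>x\<in>F. s x \<ominus> \<rho> (r x) \<in> J n"
      and A: "finite A" "A \<subseteq> carrier R" "\<rho> ` A \<subseteq> J n" and t: "t \<in> A \<rightarrow> FS (carrier C)"
      and eq: "\<pi> s = finsum (restr CM) (\<lambda>x. r x \<odot>\<^bsub>restr CM\<^esub> \<pi> (formal_unit S (carrier C) x)) F
        \<oplus>\<^bsub>restr CM\<^esub> finsum (restr CM) (\<lambda>a. a \<odot>\<^bsub>restr CM\<^esub> \<pi> (t a)) A"
      by (rule linear_decompose[OF left_module_restr_CM act_linear s, of n]) (rule that; assumption)
    have rI: "r x \<in> I" if "x \<in> F" for x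
    proof -
      have "\<rho> (r x) \<in> K"
        by (rule oi_diff_mem'[OF K, of "s x"]) (use rJ n sK F funcset_mem[OF r that] that in auto)
      then show ?thesis using I funcset_mem[OF r that] by simp
    qed
    have AI: "a \<in> I" if "a \<in> A" for a using I A n that by auto
    show "y \<in> ideal_smult I (restr CM)"
      unfolding y eq
    proof (rule subgroup.m_closed[OF sub, simplified monoid_record_simps])
      show "finsum (restr CM) (\<lambda>x. r x \<odot>\<^bsub>restr CM\<^esub> \<pi> (formal_unit S (carrier C) x)) F \<in> ideal_smult I (restr CM)"
        by (rule sum[OF F(1)]) (use HI rI F contra_act_unit in auto)
      show "finsum (restr CM) (\<lambda>a. a \<odot>\<^bsub>restr CM\<^esub> \<pi> (t a)) A \<in> ideal_smult I (restr CM)"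
        by (rule sum[OF A(1)]) (use HI[OF AI contra_act_closed[OF funcset_mem[OF t]]] in auto)
    qed
  qed
qed

end

context fg_dense
begin

text \<open>
  The defect of compatibility with infinite sums is linear over \<open>R\<close> and vanishes on basis elements.  The
  decomposition then places its image in the scope of the Nakayama lemma.
\<close>

lemma lmod_hom_subset_contra_hom:
  assumes C: "contramodule S T C" and D: "contramodule S T D"
  shows "lmod_hom R (restr (contra_module S C)) (restr (contra_module S D)) \<subseteq> contra_hom S T C D"
proof
  interpret C: fg_contramodule S T R \<rho> J C
    by (intro fg_contramodule.intro topring_contramodule.intro fg_dense_axioms linear_top_ring_axioms C)
  interpret D: fg_contramodule S T R \<rho> J D
    by (intro fg_contramodule.intro topring_contramodule.intro fg_dense_axioms linear_top_ring_axioms D)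
  interpret DM: left_module R "restr D.CM" by (rule D.left_module_restr_CM)
  let ?X = "carrier C" and ?Y = "carrier D"
  fix f assume f: "f \<in> lmod_hom R (restr C.CM) (restr D.CM)"
  then have fE: "f \<in> ?X \<rightarrow>\<^sub>E ?Y" and f_add: "\<And>x y. \<lbrakk>x \<in> ?X; y \<in> ?X\<rbrakk> \<Longrightarrow> f (x \<oplus>\<^bsub>C.CM\<^esub> y) = f x \<oplus>\<^bsub>D.CM\<^esub> f y"
    and f_smult: "\<And>r x. \<lbrakk>r \<in> carrier R; x \<in> ?X\<rbrakk> \<Longrightarrow> f (\<rho> r \<odot>\<^bsub>C.CM\<^esub> x) = \<rho> r \<odot>\<^bsub>D.CM\<^esub> f x"
    by (auto simp: lmod_hom_def)
  have fX: "f \<in> ?X \<rightarrow> ?Y" using fE by auto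
  have fc: "f x \<in> ?Y" if "x \<in> ?X" for x using fX that by auto
  let ?p = "push_forward S T ?X ?Y f"
  have pF: "?p s \<in> FS ?Y" if "s \<in> FS ?X" for s
    by (rule push_forward_FS[OF formal_sums_zconv[OF that] fX])
  define g where "g s = f (C.\<pi> s) \<ominus>\<^bsub>restr D.CM\<^esub> D.\<pi> (?p s)" for s
  have c1: "f (C.\<pi> s) \<in> carrier (restr D.CM)" and c2: "D.\<pi> (?p s) \<in> carrier (restr D.CM)"
    if "s \<in> FS ?X" for s
    using fc[OF C.contra_act_closed[OF that]] D.contra_act_closed[OF pF[OF that]] by simp_all
  have gc: "g s \<in> carrier (restr D.CM)" if "s \<in> FS ?X" for s
    unfolding g_def using c1[OF that] c2[OF that] by (rule DM.M.minus_closed)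
  have g_add: "g (formal_add S ?X s t) = g s \<oplus>\<^bsub>restr D.CM\<^esub> g t" if s: "s \<in> FS ?X" and t: "t \<in> FS ?X" for s t
  proof -
    have "f (C.\<pi> (formal_add S ?X s t)) = f (C.\<pi> s) \<oplus>\<^bsub>restr D.CM\<^esub> f (C.\<pi> t)"
      unfolding C.act_add[OF s t] restr_simps by (rule f_add; rule C.contra_act_closed; fact)
    moreover have "D.\<pi> (?p (formal_add S ?X s t)) = D.\<pi> (?p s) \<oplus>\<^bsub>restr D.CM\<^esub> D.\<pi> (?p t)"
      unfolding push_forward_add[OF s t] D.act_add[OF pF[OF s] pF[OF t]] by simp
    ultimately show ?thesis
      unfolding g_def a_minus_def
      using c1[OF s] c1[OF t] c2[OF s] c2[OF t]
      by (simp only: DM.M.minus_add DM.M.a_ac DM.M.a_closed DM.M.a_inv_closed)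
  qed
  have smult_minus: "r \<odot>\<^bsub>restr D.CM\<^esub> (x \<ominus>\<^bsub>restr D.CM\<^esub> y) = r \<odot>\<^bsub>restr D.CM\<^esub> x \<ominus>\<^bsub>restr D.CM\<^esub> r \<odot>\<^bsub>restr D.CM\<^esub> y"
    if r: "r \<in> carrier R" and x: "x \<in> carrier (restr D.CM)" and y: "y \<in> carrier (restr D.CM)" for r x y
  proof -
    have "r \<odot>\<^bsub>restr D.CM\<^esub> (x \<ominus>\<^bsub>restr D.CM\<^esub> y) \<oplus>\<^bsub>restr D.CM\<^esub> r \<odot>\<^bsub>restr D.CM\<^esub> y = r \<odot>\<^bsub>restr D.CM\<^esub> x"
      using DM.smult_r_distr[OF r DM.M.minus_closed[OF x y] y] x y
      by (simp only: a_minus_def DM.M.a_assoc DM.M.l_neg DM.M.r_zero DM.M.a_inv_closed)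
    then show ?thesis
      using DM.smult_closed[OF r DM.M.minus_closed[OF x y]] DM.smult_closed[OF r y]
      by (metis a_minus_def DM.M.a_assoc DM.M.r_neg DM.M.r_zero DM.M.a_inv_closed)
  qed
  have g_scale: "g (formal_scale S ?X (\<rho> r) s) = r \<odot>\<^bsub>restr D.CM\<^esub> g s"
    if r: "r \<in> carrier R" and s: "s \<in> FS ?X" for r s
  proof -
    have "f (C.\<pi> (formal_scale S ?X (\<rho> r) s)) = r \<odot>\<^bsub>restr D.CM\<^esub> f (C.\<pi> s)"
      unfolding C.act_scale[OF s rho_closed[OF r]] restr_simps
      by (rule f_smult[OF r C.contra_act_closed[OF s]])
    moreover have "D.\<pi> (?p (formal_scale S ?X (\<rho> r) s)) = r \<odot>\<^bsub>restr D.CM\<^esub> D.\<pi> (?p s)"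
      unfolding push_forward_scale[OF s rho_closed[OF r]] D.act_scale[OF pF[OF s] rho_closed[OF r]] by simp
    ultimately show ?thesis
      unfolding g_def using smult_minus[OF r c1[OF s] c2[OF s]] by (simp only:)
  qed
  have g_unit: "g (formal_unit S ?X x) = \<zero>\<^bsub>restr D.CM\<^esub>" if x: "x \<in> ?X" for x
    unfolding g_def push_forward_unit[OF x fX] C.contra_act_unit[OF x] D.contra_act_unit[OF fc[OF x]]
    a_minus_def by (rule DM.M.r_neg) (simp add: fc[OF x])
  have g_lin: "formal_linear ?X (restr D.CM) g"
    unfolding formal_linear_def by (intro conjI ballI funcsetI gc g_add g_scale)
  have g_zero: "g s = \<zero>\<^bsub>D.CM\<^esub>" if "s \<in> FS ?X" for s
  proof (rule D.contra_nakayama_finite[of "g ` FS ?X"])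
    show "g ` FS ?X \<subseteq> carrier D" using gc by auto
    show "g s \<in> g ` FS ?X" using that by (rule imageI)
    fix n e assume "e \<in> g ` FS ?X"
    then obtain s where s: "s \<in> FS ?X" "e = g s" by blast
    obtain F r A t where F: "finite F" "F \<subseteq> ?X" and r: "r \<in> F \<rightarrow> carrier R"
      and "\<forall>x\<in>?X - F. s x \<in> J n" "\<forall>x\<in>F. s x \<ominus> \<rho> (r x) \<in> J n"
      and A: "finite A" "A \<subseteq> carrier R" "\<rho> ` A \<subseteq> J n" and t: "t \<in> A \<rightarrow> FS ?X"
      and eq: "g s = finsum (restr D.CM) (\<lambda>x. r x \<odot>\<^bsub>restr D.CM\<^esub> g (formal_unit S ?X x)) F
        \<oplus>\<^bsub>restr D.CM\<^esub> finsum (restr D.CM) (\<lambda>a. a \<odot>\<^bsub>restr D.CM\<^esub> g (t a)) A"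
      by (rule linear_decompose[OF D.left_module_restr_CM g_lin s(1), of n]) (rule that; assumption)
    have smz: "x \<odot>\<^bsub>restr D.CM\<^esub> \<zero>\<^bsub>restr D.CM\<^esub> = \<zero>\<^bsub>restr D.CM\<^esub>" if "x \<in> carrier R" for x
      using DM.smult_r_distr[OF that DM.M.zero_closed DM.M.zero_closed] DM.smult_closed[OF that DM.M.zero_closed]
      by (metis DM.M.r_zero DM.M.zero_closed DM.M.add.l_cancel_one)
    have "finsum (restr D.CM) (\<lambda>x. r x \<odot>\<^bsub>restr D.CM\<^esub> g (formal_unit S ?X x)) F
        = finsum (restr D.CM) (\<lambda>_. \<zero>\<^bsub>restr D.CM\<^esub>) F"
      by (rule DM.M.finsum_cong') (use F g_unit smz[OF funcset_mem[OF r]] in \<open>auto simp del: restr_simps\<close>)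
    moreover have "finsum (restr D.CM) (\<lambda>a. a \<odot>\<^bsub>restr D.CM\<^esub> g (t a)) A \<in> carrier (restr D.CM)"
      by (rule DM.M.finsum_closed, rule funcsetI, rule DM.smult_closed)
        (use A in blast, rule gc[OF funcset_mem[OF t]])
    ultimately have "e = finsum (restr D.CM) (\<lambda>a. a \<odot>\<^bsub>restr D.CM\<^esub> g (t a)) A"
      unfolding s(2) eq by (simp only: DM.M.finsum_zero DM.M.l_zero)
    then show "\<exists>A t. finite A \<and> A \<subseteq> carrier R \<and> \<rho> ` A \<subseteq> J n \<and> t \<in> A \<rightarrow> g ` FS ?X \<and>
        e = finsum (restr D.CM) (\<lambda>a. \<rho> a \<odot>\<^bsub>D.CM\<^esub> t a) A"
      using A t by (intro exI[of _ A] exI[of _ "\<lambda>a. g (t a)"]) auto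
  qed
  have "f (C.\<pi> s) = D.\<pi> (?p s)" if s: "s \<in> FS ?X" for s
  proof -
    have "f (C.\<pi> s) \<ominus>\<^bsub>restr D.CM\<^esub> D.\<pi> (?p s) = \<zero>\<^bsub>restr D.CM\<^esub>" using g_zero[OF s] by (simp add: g_def)
    then have "\<ominus>\<^bsub>restr D.CM\<^esub> (\<ominus>\<^bsub>restr D.CM\<^esub> D.\<pi> (?p s)) = f (C.\<pi> s)"
      unfolding a_minus_def
      by (rule DM.M.minus_equality) (use c1[OF s] c2[OF s] DM.M.a_inv_closed[OF c2[OF s]] in auto)
    then show ?thesis using DM.M.minus_minus[OF c2[OF s]] by simp
  qed
  then show "f \<in> contra_hom S T C D" using fE by (simp add: contra_hom_def)
qed

lemma contra_hom_subset_lmod_hom: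
  assumes C: "contramodule S T C" and D: "contramodule S T D"
  shows "contra_hom S T C D \<subseteq> lmod_hom R (restr (contra_module S C)) (restr (contra_module S D))"
proof
  interpret C: fg_contramodule S T R \<rho> J C
    by (intro fg_contramodule.intro topring_contramodule.intro fg_dense_axioms linear_top_ring_axioms C)
  interpret D: fg_contramodule S T R \<rho> J D
    by (intro fg_contramodule.intro topring_contramodule.intro fg_dense_axioms linear_top_ring_axioms D)
  let ?X = "carrier C" and ?Y = "carrier D"
  fix f assume f: "f \<in> contra_hom S T C D"
  then have fE: "f \<in> ?X \<rightarrow>\<^sub>E ?Y"
    and fp: "\<And>s. s \<in> FS ?X \<Longrightarrow> f (C.\<pi> s) = D.\<pi> (push_forward S T ?X ?Y f s)"
    by (auto simp: contra_hom_def)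
  have fX: "f \<in> ?X \<rightarrow> ?Y" using fE by auto
  have fc: "f x \<in> ?Y" if "x \<in> ?X" for x using fX that by auto
  have add: "f (x \<oplus>\<^bsub>C.CM\<^esub> y) = f x \<oplus>\<^bsub>D.CM\<^esub> f y" if x: "x \<in> ?X" and y: "y \<in> ?X" for x y
  proof -
    have "f (C.\<pi> (formal_add S ?X (formal_unit S ?X x) (formal_unit S ?X y))) =
        D.\<pi> (formal_add S ?Y (formal_unit S ?Y (f x)) (formal_unit S ?Y (f y)))"
      unfolding fp[OF formal_add_FS[OF formal_unit_FS formal_unit_FS]]
        push_forward_add[OF formal_unit_FS formal_unit_FS]
        push_forward_unit[OF x fX] push_forward_unit[OF y fX] ..
    then show ?thesis
      unfolding C.act_add[OF formal_unit_FS formal_unit_FS] D.act_add[OF formal_unit_FS formal_unit_FS]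
        C.contra_act_unit[OF x] C.contra_act_unit[OF y]
        D.contra_act_unit[OF fc[OF x]] D.contra_act_unit[OF fc[OF y]] .
  qed
  have smult: "f (\<rho> r \<odot>\<^bsub>C.CM\<^esub> x) = \<rho> r \<odot>\<^bsub>D.CM\<^esub> f x" if r: "r \<in> carrier R" and x: "x \<in> ?X" for r x
  proof -
    have "f (C.\<pi> (formal_scale S ?X (\<rho> r) (formal_unit S ?X x))) =
        D.\<pi> (formal_scale S ?Y (\<rho> r) (formal_unit S ?Y (f x)))"
      unfolding fp[OF formal_scale_FS[OF formal_unit_FS rho_closed[OF r]]]
        push_forward_scale[OF formal_unit_FS rho_closed[OF r]] push_forward_unit[OF x fX] ..
    then show ?thesis
      unfolding C.act_scale[OF formal_unit_FS rho_closed[OF r]] D.act_scale[OF formal_unit_FS rho_closed[OF r]]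
        C.contra_act_unit[OF x] D.contra_act_unit[OF fc[OF x]] .
  qed
  show "f \<in> lmod_hom R (restr C.CM) (restr D.CM)"
    using fE add smult by (simp add: lmod_hom_def)
qed

end

section \<open>The completion with respect to a Gabriel topology\<close>

lemma (in ring) right_ideal_subset: "right_ideal I R \<Longrightarrow> I \<subseteq> carrier R"
  by (simp add: right_ideal_def additive_subgroup.a_subset)

lemma (in ring) right_ideal_zero: "right_ideal I R \<Longrightarrow> \<zero> \<in> I"
  by (simp add: right_ideal_def additive_subgroup.zero_closed)

lemma (in ring) right_ideal_add: "\<lbrakk>right_ideal I R; x \<in> I; y \<in> I\<rbrakk> \<Longrightarrow> x \<oplus> y \<in> I"
  by (simp add: right_ideal_def additive_subgroup.a_closed)

lemma (in ring) right_ideal_uminus: "\<lbrakk>right_ideal I R; x \<in> I\<rbrakk> \<Longrightarrow> \<ominus> x \<in> I"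
  by (simp add: right_ideal_def additive_subgroup.a_inv_closed abelian_group_axioms)

lemma (in ring) right_ideal_mult: "\<lbrakk>right_ideal I R; x \<in> I; r \<in> carrier R\<rbrakk> \<Longrightarrow> x \<otimes> r \<in> I"
  by (simp add: right_ideal_def)

lemma (in ring) right_idealI:
  assumes "I \<subseteq> carrier R" "\<zero> \<in> I" "\<And>x y. \<lbrakk>x \<in> I; y \<in> I\<rbrakk> \<Longrightarrow> x \<oplus> y \<in> I"
    "\<And>x r. \<lbrakk>x \<in> I; r \<in> carrier R\<rbrakk> \<Longrightarrow> x \<otimes> r \<in> I"
  shows "right_ideal I R"
  unfolding right_ideal_def
proof (intro conjI ballI additive_subgroupI add.subgroupI)
  fix x assume x: "x \<in> I"
  then have "x \<otimes> (\<ominus> \<one>) \<in> I" by (rule assms(4)) simp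
  then show "\<ominus> x \<in> I" using x assms(1) by (simp add: r_minus subsetD)
qed (use assms in auto)

lemma (in ring) right_ideal_colon:
  assumes I: "right_ideal I R" and s: "s \<in> carrier R"
  shows "right_ideal (colon R I s) R"
proof (rule right_idealI)
  fix x r assume "x \<in> colon R I s" "r \<in> carrier R"
  then show "x \<otimes> r \<in> colon R I s"
    using right_ideal_mult[OF I, of "s \<otimes> x" r] s by (simp add: colon_def m_assoc)
qed (use s right_ideal_zero[OF I] right_ideal_add[OF I] in \<open>auto simp: colon_def r_distr\<close>)

lemma (in ring) right_ideal_finsum:
  assumes I: "right_ideal I R" and "\<And>x. x \<in> F \<Longrightarrow> f x \<in> I"
  shows "finsum R f F \<in> I"
  using assms(2)
proof (induction F rule: infinite_finite_induct)
  case (insert x F)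
  then have "f x \<in> carrier R" "f \<in> F \<rightarrow> carrier R" using right_ideal_subset[OF I] by auto
  with insert show ?case by (simp add: right_ideal_add[OF I])
qed (use right_ideal_zero[OF I] in auto)

locale gabriel_ring = ring R + right_gabriel_topology R \<G>
  for R :: "('a, 'm) ring_scheme" (structure) and \<G> :: "'a set set"
begin

abbreviation "\<RR> \<equiv> gabriel_completion R \<G>"
abbreviation "\<TT> \<equiv> completion_topology R \<G>"
abbreviation "\<rho> \<equiv> completion_map R \<G>"
abbreviation "\<NN> \<equiv> completion_ideal R \<G>"

lemma abelian_subgroup_G: "I \<in> \<G> \<Longrightarrow> abelian_subgroup I R"
  using right_ideals[of I] by (intro abelian_subgroupI3) (auto simp: right_ideal_def abelian_group_axioms)

lemma coset_iff:
  assumes "I \<in> \<G>" "a \<in> carrier R"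
  shows "b \<in> I +> a \<longleftrightarrow> b \<in> carrier R \<and> b \<ominus> a \<in> I"
proof -
  interpret I: abelian_subgroup I R by (rule abelian_subgroup_G[OF assms(1)])
  have "b \<in> carrier R" if "b \<in> I +> a" using that assms a_r_coset_subset_G I.a_subset by blast
  then show ?thesis using I.a_rcos_module_minus[OF ring_axioms assms(2)] by blast
qed

lemma coset_self: "\<lbrakk>I \<in> \<G>; a \<in> carrier R\<rbrakk> \<Longrightarrow> a \<in> I +> a"
  using right_ideal_zero[OF right_ideals, of I] by (simp add: coset_iff a_minus_def r_neg)

lemma coset_eq:
  assumes "I \<in> \<G>" "a \<in> carrier R" "b \<in> I +> a"
  shows "I +> b = I +> a"
proof -
  interpret I: abelian_subgroup I R by (rule abelian_subgroup_G[OF assms(1)])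
  show ?thesis using I.a_repr_independence'[OF assms(3,2)] by simp
qed

lemma coset_eq_iff:
  assumes "I \<in> \<G>" "a \<in> carrier R" "b \<in> carrier R"
  shows "I +> b = I +> a \<longleftrightarrow> b \<ominus> a \<in> I"
proof
  assume "I +> b = I +> a"
  then have "b \<in> I +> a" using coset_self[OF assms(1,3)] by simp
  then show "b \<ominus> a \<in> I" using coset_iff[OF assms(1,2)] by simp
next
  assume "b \<ominus> a \<in> I"
  then have "b \<in> I +> a" using coset_iff[OF assms(1,2)] assms(3) by simp
  then show "I +> b = I +> a" by (rule coset_eq[OF assms(1,2)])
qed

lemma coset_zero: "I \<in> \<G> \<Longrightarrow> I +> \<zero> = I"
  using right_ideal_subset[OF right_ideals] by (simp add: a_coset_add_zero)

lemma coset_add: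
  "\<lbrakk>I \<in> \<G>; a \<in> carrier R; b \<in> carrier R\<rbrakk> \<Longrightarrow> (I +> a) <+>\<^bsub>R\<^esub> (I +> b) = I +> (a \<oplus> b)"
  using abelian_subgroup.a_rcos_sum[OF abelian_subgroup_G] by blast

lemma coset_transition:
  assumes "I \<in> \<G>" "J \<in> \<G>" "I \<subseteq> J" "a \<in> carrier R"
  shows "J <+>\<^bsub>R\<^esub> (I +> a) = J +> a"
proof
  note rI = right_ideals[OF assms(1)] and rJ = right_ideals[OF assms(2)]
  show "J <+>\<^bsub>R\<^esub> (I +> a) \<subseteq> J +> a"
  proof
    fix z assume "z \<in> J <+>\<^bsub>R\<^esub> (I +> a)"
    then obtain j b where j: "j \<in> J" and b: "b \<in> I +> a" and z: "z = j \<oplus> b" by (auto simp: set_add_def')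
    have c: "j \<in> carrier R" "b \<in> carrier R" "b \<ominus> a \<in> J"
      using j b right_ideal_subset[OF rJ] coset_iff[OF assms(1,4)] assms(3) by auto
    have "z \<ominus> a = j \<oplus> (b \<ominus> a)" using c assms(4) by (simp add: z a_minus_def a_assoc)
    then show "z \<in> J +> a"
      using right_ideal_add[OF rJ j c(3)] c by (simp add: coset_iff[OF assms(2,4)] z)
  qed
  show "J +> a \<subseteq> J <+>\<^bsub>R\<^esub> (I +> a)"
  proof
    fix z assume "z \<in> J +> a"
    then obtain j where "j \<in> J" "z = j \<oplus> a" by (auto simp: a_r_coset_def')
    then show "z \<in> J <+>\<^bsub>R\<^esub> (I +> a)" using coset_self[OF assms(1,4)] by (auto simp: set_add_def')
  qed
qed

subsection \<open>Elements of the completion and their approximations\<close>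

text \<open>
  The elements of the coset \<open>x I\<close> are the approximations of \<open>x\<close> modulo \<open>I\<close>.  If \<open>a\<close> approximates \<open>x\<close> modulo
  \<open>I\<close> and \<open>b\<close> approximates \<open>y\<close> modulo \<open>colon R I a\<close>, then \<open>a \<otimes> b\<close> approximates the product modulo \<open>I\<close>.
\<close>

lemma carrier_completion:
  "x \<in> carrier \<RR> \<longleftrightarrow> x \<in> extensional \<G> \<and> (\<forall>I\<in>\<G>. \<exists>a\<in>carrier R. x I = I +> a) \<and>
     (\<forall>I\<in>\<G>. \<forall>J\<in>\<G>. I \<subseteq> J \<longrightarrow> J <+>\<^bsub>R\<^esub> x I = x J)"
proof -
  have coset: "A \<in> a_rcosets I \<longleftrightarrow> (\<exists>a\<in>carrier R. A = I +> a)" for A I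
    by (simp add: A_RCOSETS_def')
  show ?thesis
    unfolding gabriel_completion_def PiE_iff coset by (simp add: conj_ac)
qed

lemma approx:
  assumes "x \<in> carrier \<RR>" "I \<in> \<G>" "a \<in> x I"
  shows "a \<in> carrier R" "x I = I +> a"
proof -
  obtain b where b: "b \<in> carrier R" "x I = I +> b" using assms by (auto simp: carrier_completion)
  then show "a \<in> carrier R" using assms coset_iff by blast
  show "x I = I +> a" using assms b coset_eq by metis
qed

lemma approx_exists:
  assumes "x \<in> carrier \<RR>" "I \<in> \<G>"
  obtains a where "a \<in> x I"
proof -
  obtain a where "a \<in> carrier R" "x I = I +> a" using assms by (auto simp: carrier_completion)
  then show thesis using that[of a] coset_self[OF assms(2)] by simp
qed

lemma approx_mono:
  assumes "x \<in> carrier \<RR>" "I \<in> \<G>" "J \<in> \<G>" "I \<subseteq> J" "a \<in> x I"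
  shows "a \<in> x J"
proof -
  note a = approx[OF assms(1,2,5)]
  have "x J = J <+>\<^bsub>R\<^esub> x I" using assms(1-4) by (simp add: carrier_completion)
  also have "\<dots> = J +> a" unfolding a(2) by (rule coset_transition[OF assms(2-4) a(1)])
  finally show ?thesis using coset_self[OF assms(3) a(1)] by simp
qed

lemma completion_memI:
  assumes "x \<in> extensional \<G>" "\<And>I. I \<in> \<G> \<Longrightarrow> \<exists>a\<in>carrier R. x I = I +> a"
    "\<And>I J. \<lbrakk>I \<in> \<G>; J \<in> \<G>; I \<subseteq> J\<rbrakk> \<Longrightarrow> \<exists>a. a \<in> x I \<and> a \<in> x J"
  shows "x \<in> carrier \<RR>"
  unfolding carrier_completion
proof (intro conjI ballI impI)
  fix I J assume IJ: "I \<in> \<G>" "J \<in> \<G>" "I \<subseteq> J"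
  obtain a where a: "a \<in> x I" "a \<in> x J" using assms(3)[OF IJ] by blast
  obtain b c where b: "b \<in> carrier R" "x I = I +> b" and c: "c \<in> carrier R" "x J = J +> c"
    using assms(2) IJ by metis
  have ac: "a \<in> carrier R" using a b coset_iff IJ by blast
  have "J <+>\<^bsub>R\<^esub> x I = J <+>\<^bsub>R\<^esub> (I +> a)" using coset_eq[OF IJ(1) b(1), of a] a b by simp
  also have "\<dots> = J +> a" by (rule coset_transition[OF IJ ac])
  also have "\<dots> = x J" using coset_eq[OF IJ(2) c(1), of a] a c by simp
  finally show "J <+>\<^bsub>R\<^esub> x I = x J" .
qed (rule assms(1), rule assms(2))

lemma completion_eqI:
  assumes "x \<in> carrier \<RR>" "y \<in> carrier \<RR>" "\<And>I. I \<in> \<G> \<Longrightarrow> \<exists>a. a \<in> x I \<and> a \<in> y I"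
  shows "x = y"
proof (rule extensionalityI[of _ \<G>])
  fix I assume I: "I \<in> \<G>"
  then obtain a where "a \<in> x I" "a \<in> y I" using assms(3) by blast
  then show "x I = y I" using approx(2)[OF _ I] assms(1,2) by metis
next
  show "x \<in> extensional \<G>" using assms(1) by (simp add: carrier_completion)
  show "y \<in> extensional \<G>" using assms(2) by (simp add: carrier_completion)
qed

lemma completion_zero: "\<zero>\<^bsub>\<RR>\<^esub> = (\<lambda>I\<in>\<G>. I)"
  and completion_one: "\<one>\<^bsub>\<RR>\<^esub> = (\<lambda>I\<in>\<G>. I +> \<one>)"
  and completion_add: "x \<oplus>\<^bsub>\<RR>\<^esub> y = (\<lambda>I\<in>\<G>. x I <+>\<^bsub>R\<^esub> y I)"
  and completion_mult: "x \<otimes>\<^bsub>\<RR>\<^esub> y = (\<lambda>I\<in>\<G>. \<Union>a\<in>x I. \<Union>b\<in>y (colon R I a). I +> (a \<otimes> b))"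
  by (simp_all add: gabriel_completion_def)

lemma add_eval:
  assumes "x \<in> carrier \<RR>" "y \<in> carrier \<RR>" "I \<in> \<G>" "a \<in> x I" "b \<in> y I"
  shows "(x \<oplus>\<^bsub>\<RR>\<^esub> y) I = I +> (a \<oplus> b)"
proof -
  have "x I <+>\<^bsub>R\<^esub> y I = I +> (a \<oplus> b)"
    unfolding approx(2)[OF assms(1,3,4)] approx(2)[OF assms(2,3,5)]
    by (rule coset_add[OF assms(3) approx(1)[OF assms(1,3,4)] approx(1)[OF assms(2,3,5)]])
  then show ?thesis using assms(3) by (simp add: completion_add)
qed

text \<open>
  Both products are compared with the products by some \<open>c\<close> that approximates \<open>y\<close> modulo
  \<open>colon R I a \<inter> colon R I a'\<close>.
\<close>

lemma mult_well_defined: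
  assumes x: "x \<in> carrier \<RR>" and y: "y \<in> carrier \<RR>" and I: "I \<in> \<G>"
    and a: "a \<in> x I" and b: "b \<in> y (colon R I a)" and a': "a' \<in> x I" and b': "b' \<in> y (colon R I a')"
  shows "I +> (a' \<otimes> b') = I +> (a \<otimes> b)"
proof -
  have ac: "a \<in> carrier R" "a' \<in> carrier R" using approx[OF x I] a a' by auto
  have K: "colon R I a \<in> \<G>" "colon R I a' \<in> \<G>" using T3[OF I] ac by auto
  have bc: "b \<in> carrier R" "b' \<in> carrier R" using approx[OF y] K b b' by auto
  have KK: "colon R I a \<inter> colon R I a' \<in> \<G>" by (rule T2[OF K])
  obtain c where c: "c \<in> y (colon R I a \<inter> colon R I a')" using approx_exists[OF y KK] .
  have cc: "c \<in> carrier R" using approx[OF y KK c] by simp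
  have 1: "c \<in> y (colon R I a)" and 2: "c \<in> y (colon R I a')"
    using approx_mono[OF y KK _ _ c] K by auto
  note rI = right_ideals[OF I]
  have "c \<in> colon R I a +> b" using 1 approx(2)[OF y K(1) b] by simp
  then have "a \<otimes> (c \<ominus> b) \<in> I" using coset_iff[OF K(1) bc(1)] by (simp add: colon_def)
  then have m1: "a \<otimes> c \<ominus> a \<otimes> b \<in> I" using ac bc cc by (simp add: a_minus_def r_distr r_minus)
  have "c \<in> colon R I a' +> b'" using 2 approx(2)[OF y K(2) b'] by simp
  then have "a' \<otimes> (c \<ominus> b') \<in> I" using coset_iff[OF K(2) bc(2)] by (simp add: colon_def)
  then have m2: "a' \<otimes> c \<ominus> a' \<otimes> b' \<in> I" using ac bc cc by (simp add: a_minus_def r_distr r_minus)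
  have "a' \<in> I +> a" using a' approx(2)[OF x I a] by simp
  then have "(a' \<ominus> a) \<otimes> c \<in> I" using coset_iff[OF I ac(1)] right_ideal_mult[OF rI _ cc] by blast
  then have m3: "a' \<otimes> c \<ominus> a \<otimes> c \<in> I" using ac bc cc by (simp add: a_minus_def l_distr l_minus)
  have "I +> (a' \<otimes> c) = I +> (a' \<otimes> b')" "I +> (a' \<otimes> c) = I +> (a \<otimes> c)" "I +> (a \<otimes> c) = I +> (a \<otimes> b)"
    using m1 m2 m3 coset_eq_iff[OF I] ac bc cc by auto
  then show ?thesis by simp
qed

lemma mult_eval:
  assumes x: "x \<in> carrier \<RR>" and y: "y \<in> carrier \<RR>" and I: "I \<in> \<G>"
    and a: "a \<in> x I" and b: "b \<in> y (colon R I a)"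
  shows "(x \<otimes>\<^bsub>\<RR>\<^esub> y) I = I +> (a \<otimes> b)"
proof -
  have "(\<Union>a\<in>x I. \<Union>b\<in>y (colon R I a). I +> (a \<otimes> b)) = I +> (a \<otimes> b)"
  proof (intro equalityI UN_least)
    fix a' b' assume "a' \<in> x I" "b' \<in> y (colon R I a')"
    then have "I +> (a' \<otimes> b') = I +> (a \<otimes> b)" by (rule mult_well_defined[OF x y I a b])
    then show "I +> (a' \<otimes> b') \<subseteq> I +> (a \<otimes> b)" by (rule equalityD1)
  next
    show "I +> (a \<otimes> b) \<subseteq> (\<Union>a\<in>x I. \<Union>b\<in>y (colon R I a). I +> (a \<otimes> b))"
      by (rule subsetI) (rule UN_I[OF a], rule UN_I[OF b])
  qed
  then show ?thesis using I by (simp add: completion_mult)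
qed

lemma add_approx:
  assumes "x \<in> carrier \<RR>" "y \<in> carrier \<RR>" "I \<in> \<G>" "a \<in> x I" "b \<in> y I"
  shows "a \<oplus> b \<in> (x \<oplus>\<^bsub>\<RR>\<^esub> y) I"
  unfolding add_eval[OF assms]
  by (intro coset_self a_closed assms(3) approx(1)[OF assms(1,3,4)] approx(1)[OF assms(2,3,5)])

lemma mult_approx:
  assumes "x \<in> carrier \<RR>" "y \<in> carrier \<RR>" "I \<in> \<G>" "a \<in> x I" "b \<in> y (colon R I a)"
  shows "a \<otimes> b \<in> (x \<otimes>\<^bsub>\<RR>\<^esub> y) I"
proof -
  have a: "a \<in> carrier R" by (rule approx(1)[OF assms(1,3,4)])
  have "b \<in> carrier R" by (rule approx(1)[OF assms(2) T3[OF assms(3) a] assms(5)])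
  then show ?thesis unfolding mult_eval[OF assms] using a assms(3) by (simp add: coset_self)
qed

lemma zero_approx: "I \<in> \<G> \<Longrightarrow> \<zero> \<in> \<zero>\<^bsub>\<RR>\<^esub> I"
  using right_ideal_zero[OF right_ideals] by (simp add: completion_zero)

lemma rho_eval: "I \<in> \<G> \<Longrightarrow> \<rho> r I = I +> r"
  by (simp add: completion_map_def)

lemma rho_approx: "\<lbrakk>I \<in> \<G>; r \<in> carrier R\<rbrakk> \<Longrightarrow> r \<in> \<rho> r I"
  unfolding rho_eval by (rule coset_self)

lemma rho_one: "\<rho> \<one> = \<one>\<^bsub>\<RR>\<^esub>"
  by (simp add: completion_map_def completion_one)

lemma completion_zero_closed: "\<zero>\<^bsub>\<RR>\<^esub> \<in> carrier \<RR>"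
proof (rule completion_memI)
  show "\<zero>\<^bsub>\<RR>\<^esub> \<in> extensional \<G>" by (simp add: completion_zero)
  show "\<exists>a\<in>carrier R. \<zero>\<^bsub>\<RR>\<^esub> I = I +> a" if "I \<in> \<G>" for I
    using coset_zero[OF that] that by (intro bexI[of _ \<zero>]) (simp_all add: completion_zero)
  fix I J assume "I \<in> \<G>" "J \<in> \<G>"
  then show "\<exists>a. a \<in> \<zero>\<^bsub>\<RR>\<^esub> I \<and> a \<in> \<zero>\<^bsub>\<RR>\<^esub> J"
    by (intro exI[of _ \<zero>] conjI zero_approx)
qed

lemma rho_in: "r \<in> carrier R \<Longrightarrow> \<rho> r \<in> carrier \<RR>"
proof (rule completion_memI)
  assume r: "r \<in> carrier R"
  show "\<rho> r \<in> extensional \<G>" by (simp add: completion_map_def)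
  show "\<exists>a\<in>carrier R. \<rho> r I = I +> a" if "I \<in> \<G>" for I
    using rho_eval[OF that] r by blast
  show "\<exists>a. a \<in> \<rho> r I \<and> a \<in> \<rho> r J" if "I \<in> \<G>" "J \<in> \<G>" for I J
    by (intro exI[of _ r] conjI rho_approx that r)
qed

lemma completion_add_closed:
  assumes x: "x \<in> carrier \<RR>" and y: "y \<in> carrier \<RR>"
  shows "x \<oplus>\<^bsub>\<RR>\<^esub> y \<in> carrier \<RR>"
proof (rule completion_memI)
  show "x \<oplus>\<^bsub>\<RR>\<^esub> y \<in> extensional \<G>" by (simp add: completion_add)
  fix I assume I: "I \<in> \<G>"
  obtain a b where a: "a \<in> x I" and b: "b \<in> y I" using approx_exists[OF x I] approx_exists[OF y I] by metis
  show "\<exists>c\<in>carrier R. (x \<oplus>\<^bsub>\<RR>\<^esub> y) I = I +> c"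
    using add_eval[OF x y I a b] approx(1)[OF x I a] approx(1)[OF y I b] by blast
  fix J assume J: "J \<in> \<G>" "I \<subseteq> J"
  show "\<exists>a. a \<in> (x \<oplus>\<^bsub>\<RR>\<^esub> y) I \<and> a \<in> (x \<oplus>\<^bsub>\<RR>\<^esub> y) J"
    using add_approx[OF x y I a b] add_approx[OF x y J(1) approx_mono[OF x I J a] approx_mono[OF y I J b]] by blast
qed

lemma completion_mult_closed:
  assumes x: "x \<in> carrier \<RR>" and y: "y \<in> carrier \<RR>"
  shows "x \<otimes>\<^bsub>\<RR>\<^esub> y \<in> carrier \<RR>"
proof (rule completion_memI)
  show "x \<otimes>\<^bsub>\<RR>\<^esub> y \<in> extensional \<G>" by (simp add: completion_mult)
  fix I assume I: "I \<in> \<G>"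
  obtain a where a: "a \<in> x I" using approx_exists[OF x I] .
  have K: "colon R I a \<in> \<G>" by (rule T3[OF I approx(1)[OF x I a]])
  obtain b where b: "b \<in> y (colon R I a)" using approx_exists[OF y K] .
  show "\<exists>c\<in>carrier R. (x \<otimes>\<^bsub>\<RR>\<^esub> y) I = I +> c"
    using mult_eval[OF x y I a b] approx(1)[OF x I a] approx(1)[OF y K b] by blast
  fix J assume J: "J \<in> \<G>" "I \<subseteq> J"
  have KJ: "colon R J a \<in> \<G>" by (rule T3[OF J(1) approx(1)[OF x I a]])
  have "b \<in> y (colon R J a)"
    by (rule approx_mono[OF y K KJ _ b]) (use J in \<open>auto simp: colon_def\<close>)
  then show "\<exists>a. a \<in> (x \<otimes>\<^bsub>\<RR>\<^esub> y) I \<and> a \<in> (x \<otimes>\<^bsub>\<RR>\<^esub> y) J"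
    using mult_approx[OF x y I a b] mult_approx[OF x y J(1) approx_mono[OF x I J a]] by blast
qed

lemma colon_colon: "\<lbrakk>a \<in> carrier R; b \<in> carrier R\<rbrakk> \<Longrightarrow> colon R (colon R I a) b = colon R I (a \<otimes> b)"
  by (auto simp: colon_def m_assoc)

text \<open>
  Associativity and commutativity of the addition hold in every \<open>R/I\<close>.  The other identities are verified on
  approximations modulo each \<open>I\<close>, where the second factor of a product is approximated modulo a colon ideal.
\<close>

lemma ring_completion: "ring \<RR>"
proof (rule ringI)
  have one: "\<one>\<^bsub>\<RR>\<^esub> \<in> carrier \<RR>" using rho_in[of \<one>] rho_one by simp
  have one_approx: "\<one> \<in> \<one>\<^bsub>\<RR>\<^esub> I" if "I \<in> \<G>" for I using rho_approx[OF that, of \<one>] rho_one by simp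
  show "abelian_group \<RR>"
  proof (rule abelian_groupI)
    show "\<zero>\<^bsub>\<RR>\<^esub> \<in> carrier \<RR>" by (rule completion_zero_closed)
    fix x assume x: "x \<in> carrier \<RR>"
    show "\<zero>\<^bsub>\<RR>\<^esub> \<oplus>\<^bsub>\<RR>\<^esub> x = x"
    proof (rule completion_eqI[OF completion_add_closed[OF completion_zero_closed x] x])
      fix I assume I: "I \<in> \<G>"
      obtain a where a: "a \<in> x I" using approx_exists[OF x I] .
      then show "\<exists>a. a \<in> (\<zero>\<^bsub>\<RR>\<^esub> \<oplus>\<^bsub>\<RR>\<^esub> x) I \<and> a \<in> x I"
        using add_approx[OF completion_zero_closed x I zero_approx[OF I] a] approx(1)[OF x I a] by auto
    qed
    \<comment> \<open>The negative of \<open>x\<close> is its product with the image of \<open>-1\<close>.\<close>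
    have m: "\<rho> (\<ominus> \<one>) \<in> carrier \<RR>" by (rule rho_in) simp
    note xm = completion_mult_closed[OF x m]
    have "x \<otimes>\<^bsub>\<RR>\<^esub> \<rho> (\<ominus> \<one>) \<oplus>\<^bsub>\<RR>\<^esub> x = \<zero>\<^bsub>\<RR>\<^esub>"
    proof (rule completion_eqI[OF completion_add_closed[OF xm x] completion_zero_closed])
      fix I assume I: "I \<in> \<G>"
      obtain a where a: "a \<in> x I" using approx_exists[OF x I] .
      note ac = approx(1)[OF x I a]
      have "a \<otimes> \<ominus> \<one> \<oplus> a \<in> (x \<otimes>\<^bsub>\<RR>\<^esub> \<rho> (\<ominus> \<one>) \<oplus>\<^bsub>\<RR>\<^esub> x) I"
        by (intro add_approx mult_approx xm x m I a rho_approx T3 ac a_inv_closed one_closed)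
      then show "\<exists>a. a \<in> (x \<otimes>\<^bsub>\<RR>\<^esub> \<rho> (\<ominus> \<one>) \<oplus>\<^bsub>\<RR>\<^esub> x) I \<and> a \<in> \<zero>\<^bsub>\<RR>\<^esub> I"
        using zero_approx[OF I] ac by (intro exI[of _ \<zero>]) (simp add: r_minus l_neg)
    qed
    then show "\<exists>y\<in>carrier \<RR>. y \<oplus>\<^bsub>\<RR>\<^esub> x = \<zero>\<^bsub>\<RR>\<^esub>" using xm by (rule bexI)
    fix y assume y: "y \<in> carrier \<RR>"
    show "x \<oplus>\<^bsub>\<RR>\<^esub> y \<in> carrier \<RR>" by (rule completion_add_closed[OF x y])
    have coset_in: "x I \<in> carrier (R A_Mod I)" if "x \<in> carrier \<RR>" "I \<in> \<G>" for x I
      using that by (auto simp: A_FactGroup_def' carrier_completion A_RCOSETS_def')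
    show "x \<oplus>\<^bsub>\<RR>\<^esub> y = y \<oplus>\<^bsub>\<RR>\<^esub> x"
      unfolding completion_add
    proof (rule restrict_ext)
      fix I assume I: "I \<in> \<G>"
      show "x I <+>\<^bsub>R\<^esub> y I = y I <+>\<^bsub>R\<^esub> x I"
        using comm_monoid.m_comm[OF comm_group.axioms(1)[OF
            abelian_subgroup.a_factorgroup_is_comm_group[OF abelian_subgroup_G[OF I]]]
            coset_in[OF x I] coset_in[OF y I]] by simp
    qed
    fix z assume z: "z \<in> carrier \<RR>"
    show "(x \<oplus>\<^bsub>\<RR>\<^esub> y) \<oplus>\<^bsub>\<RR>\<^esub> z = x \<oplus>\<^bsub>\<RR>\<^esub> (y \<oplus>\<^bsub>\<RR>\<^esub> z)"
      unfolding completion_add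
    proof (rule restrict_ext)
      fix I assume I: "I \<in> \<G>"
      have "x I <+>\<^bsub>R\<^esub> y I <+>\<^bsub>R\<^esub> z I = x I <+>\<^bsub>R\<^esub> (y I <+>\<^bsub>R\<^esub> z I)"
        using monoid.m_assoc[OF comm_monoid.axioms(1)[OF comm_group.axioms(1)[OF
            abelian_subgroup.a_factorgroup_is_comm_group[OF abelian_subgroup_G[OF I]]]]
            coset_in[OF x I] coset_in[OF y I] coset_in[OF z I]] by simp
      then show "(\<lambda>I\<in>\<G>. x I <+>\<^bsub>R\<^esub> y I) I <+>\<^bsub>R\<^esub> z I = x I <+>\<^bsub>R\<^esub> (\<lambda>I\<in>\<G>. y I <+>\<^bsub>R\<^esub> z I) I"
        using I by simp
    qed
  qed
  show "Group.monoid \<RR>"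
  proof (rule monoidI)
    show "x \<otimes>\<^bsub>\<RR>\<^esub> y \<in> carrier \<RR>" if "x \<in> carrier \<RR>" "y \<in> carrier \<RR>" for x y
      by (rule completion_mult_closed[OF that])
    show "\<one>\<^bsub>\<RR>\<^esub> \<in> carrier \<RR>" by (rule one)
    fix x assume x: "x \<in> carrier \<RR>"
    show "\<one>\<^bsub>\<RR>\<^esub> \<otimes>\<^bsub>\<RR>\<^esub> x = x"
    proof (rule completion_eqI[OF completion_mult_closed[OF one x] x])
      fix I assume I: "I \<in> \<G>"
      have K: "colon R I \<one> = I"
        using right_ideal_subset[OF right_ideals[OF I]] by (auto simp: colon_def)
      obtain a where a: "a \<in> x I" using approx_exists[OF x I] .
      then have "\<one> \<otimes> a \<in> (\<one>\<^bsub>\<RR>\<^esub> \<otimes>\<^bsub>\<RR>\<^esub> x) I"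
        by (intro mult_approx one x I one_approx) (simp add: K)
      then show "\<exists>a. a \<in> (\<one>\<^bsub>\<RR>\<^esub> \<otimes>\<^bsub>\<RR>\<^esub> x) I \<and> a \<in> x I" using a approx(1)[OF x I a] by auto
    qed
    show "x \<otimes>\<^bsub>\<RR>\<^esub> \<one>\<^bsub>\<RR>\<^esub> = x"
    proof (rule completion_eqI[OF completion_mult_closed[OF x one] x])
      fix I assume I: "I \<in> \<G>"
      obtain a where a: "a \<in> x I" using approx_exists[OF x I] .
      have "a \<otimes> \<one> \<in> (x \<otimes>\<^bsub>\<RR>\<^esub> \<one>\<^bsub>\<RR>\<^esub>) I"
        by (intro mult_approx one x I a one_approx T3[OF I] approx(1)[OF x I a])
      then show "\<exists>a. a \<in> (x \<otimes>\<^bsub>\<RR>\<^esub> \<one>\<^bsub>\<RR>\<^esub>) I \<and> a \<in> x I" using a approx(1)[OF x I a] by auto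
    qed
    fix y z assume y: "y \<in> carrier \<RR>" and z: "z \<in> carrier \<RR>"
    show "x \<otimes>\<^bsub>\<RR>\<^esub> y \<otimes>\<^bsub>\<RR>\<^esub> z = x \<otimes>\<^bsub>\<RR>\<^esub> (y \<otimes>\<^bsub>\<RR>\<^esub> z)"
    proof (rule completion_eqI)
      fix I assume I: "I \<in> \<G>"
      obtain a where a: "a \<in> x I" using approx_exists[OF x I] .
      note ac = approx(1)[OF x I a]
      note K = T3[OF I ac]
      obtain b where b: "b \<in> y (colon R I a)" using approx_exists[OF y K] .
      note bc = approx(1)[OF y K b]
      note L = T3[OF K bc]
      obtain c where c: "c \<in> z (colon R (colon R I a) b)" using approx_exists[OF z L] .
      have "a \<otimes> b \<otimes> c \<in> (x \<otimes>\<^bsub>\<RR>\<^esub> y \<otimes>\<^bsub>\<RR>\<^esub> z) I"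
        using c by (intro mult_approx completion_mult_closed x y z I a b) (simp add: colon_colon ac bc)
      moreover have "a \<otimes> (b \<otimes> c) \<in> (x \<otimes>\<^bsub>\<RR>\<^esub> (y \<otimes>\<^bsub>\<RR>\<^esub> z)) I"
        by (intro mult_approx completion_mult_closed x y z I a b c K)
      ultimately show "\<exists>a. a \<in> (x \<otimes>\<^bsub>\<RR>\<^esub> y \<otimes>\<^bsub>\<RR>\<^esub> z) I \<and> a \<in> (x \<otimes>\<^bsub>\<RR>\<^esub> (y \<otimes>\<^bsub>\<RR>\<^esub> z)) I"
        using m_assoc ac bc approx(1)[OF z L c] by auto
    qed (intro completion_mult_closed x y z)+
  qed
  fix x y z assume x: "x \<in> carrier \<RR>" and y: "y \<in> carrier \<RR>" and z: "z \<in> carrier \<RR>"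
  show "(x \<oplus>\<^bsub>\<RR>\<^esub> y) \<otimes>\<^bsub>\<RR>\<^esub> z = x \<otimes>\<^bsub>\<RR>\<^esub> z \<oplus>\<^bsub>\<RR>\<^esub> y \<otimes>\<^bsub>\<RR>\<^esub> z"
  proof (rule completion_eqI)
    fix I assume I: "I \<in> \<G>"
    obtain a b where a: "a \<in> x I" and b: "b \<in> y I" using approx_exists[OF x I] approx_exists[OF y I] by metis
    note ac = approx(1)[OF x I a] and bc = approx(1)[OF y I b]
    have K: "colon R I a \<in> \<G>" "colon R I b \<in> \<G>" "colon R I (a \<oplus> b) \<in> \<G>"
      using T3[OF I] ac bc by auto
    let ?K = "colon R I a \<inter> (colon R I b \<inter> colon R I (a \<oplus> b))"
    have KK: "?K \<in> \<G>" using T2 K by blast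
    obtain c where c: "c \<in> z ?K" using approx_exists[OF z KK] .
    have cK: "c \<in> z (colon R I a)" "c \<in> z (colon R I b)" "c \<in> z (colon R I (a \<oplus> b))"
      using approx_mono[OF z KK _ _ c] K by auto
    have "(a \<oplus> b) \<otimes> c \<in> ((x \<oplus>\<^bsub>\<RR>\<^esub> y) \<otimes>\<^bsub>\<RR>\<^esub> z) I"
      by (intro mult_approx add_approx completion_add_closed x y z I a b cK)
    moreover have "a \<otimes> c \<oplus> b \<otimes> c \<in> (x \<otimes>\<^bsub>\<RR>\<^esub> z \<oplus>\<^bsub>\<RR>\<^esub> y \<otimes>\<^bsub>\<RR>\<^esub> z) I"
      by (intro mult_approx add_approx completion_mult_closed x y z I a b cK)
    ultimately show "\<exists>a. a \<in> ((x \<oplus>\<^bsub>\<RR>\<^esub> y) \<otimes>\<^bsub>\<RR>\<^esub> z) I \<and> a \<in> (x \<otimes>\<^bsub>\<RR>\<^esub> z \<oplus>\<^bsub>\<RR>\<^esub> y \<otimes>\<^bsub>\<RR>\<^esub> z) I"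
      using l_distr[OF ac bc] approx(1)[OF z KK c] by auto
  qed (intro completion_mult_closed completion_add_closed x y z)+
  show "z \<otimes>\<^bsub>\<RR>\<^esub> (x \<oplus>\<^bsub>\<RR>\<^esub> y) = z \<otimes>\<^bsub>\<RR>\<^esub> x \<oplus>\<^bsub>\<RR>\<^esub> z \<otimes>\<^bsub>\<RR>\<^esub> y"
  proof (rule completion_eqI)
    fix I assume I: "I \<in> \<G>"
    obtain c where c: "c \<in> z I" using approx_exists[OF z I] .
    note cc = approx(1)[OF z I c]
    note K = T3[OF I cc]
    obtain a b where a: "a \<in> x (colon R I c)" and b: "b \<in> y (colon R I c)"
      using approx_exists[OF x K] approx_exists[OF y K] by metis
    have "c \<otimes> (a \<oplus> b) \<in> (z \<otimes>\<^bsub>\<RR>\<^esub> (x \<oplus>\<^bsub>\<RR>\<^esub> y)) I"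
      by (intro mult_approx add_approx completion_add_closed x y z I K a b c)
    moreover have "c \<otimes> a \<oplus> c \<otimes> b \<in> (z \<otimes>\<^bsub>\<RR>\<^esub> x \<oplus>\<^bsub>\<RR>\<^esub> z \<otimes>\<^bsub>\<RR>\<^esub> y) I"
      by (intro mult_approx add_approx completion_mult_closed x y z I a b c)
    ultimately show "\<exists>a. a \<in> (z \<otimes>\<^bsub>\<RR>\<^esub> (x \<oplus>\<^bsub>\<RR>\<^esub> y)) I \<and> a \<in> (z \<otimes>\<^bsub>\<RR>\<^esub> x \<oplus>\<^bsub>\<RR>\<^esub> z \<otimes>\<^bsub>\<RR>\<^esub> y) I"
      using r_distr[OF approx(1)[OF x K a] approx(1)[OF y K b] cc] by auto
  qed (intro completion_mult_closed completion_add_closed x y z)+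
qed

subsection \<open>The topology of the completion\<close>

lemma minus_approx:
  assumes x: "x \<in> carrier \<RR>" and I: "I \<in> \<G>" and a: "a \<in> x I"
  shows "\<ominus> a \<in> (\<ominus>\<^bsub>\<RR>\<^esub> x) I"
proof -
  interpret C: ring \<RR> by (rule ring_completion)
  obtain b where b: "b \<in> (\<ominus>\<^bsub>\<RR>\<^esub> x) I" using approx_exists[OF C.a_inv_closed[OF x] I] .
  have ac: "a \<in> carrier R" "b \<in> carrier R"
    using approx(1)[OF x I a] approx(1)[OF C.a_inv_closed[OF x] I b] by auto
  have "b \<oplus> a \<in> (\<ominus>\<^bsub>\<RR>\<^esub> x \<oplus>\<^bsub>\<RR>\<^esub> x) I" by (rule add_approx[OF C.a_inv_closed[OF x] x I b a])
  then have "b \<oplus> a \<in> I" using x I by (simp add: C.l_neg completion_zero)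
  then have "\<ominus> (b \<oplus> a) \<in> I" by (rule right_ideal_uminus[OF right_ideals[OF I]])
  then have "\<ominus> a \<ominus> b \<in> I" using ac by (simp add: a_minus_def minus_add a_comm)
  then have "\<ominus> a \<in> I +> b" using coset_iff[OF I ac(2)] ac by simp
  then show ?thesis using approx(2)[OF C.a_inv_closed[OF x] I b] by simp
qed

lemma diff_approx:
  assumes x: "x \<in> carrier \<RR>" and y: "y \<in> carrier \<RR>" and I: "I \<in> \<G>" and a: "a \<in> x I" and b: "b \<in> y I"
  shows "a \<ominus> b \<in> (x \<ominus>\<^bsub>\<RR>\<^esub> y) I"
proof -
  interpret C: ring \<RR> by (rule ring_completion)
  show ?thesis unfolding a_minus_def
    by (intro add_approx minus_approx x y I a b C.a_inv_closed)
qed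

lemma completion_ideal_iff:
  "I \<in> \<G> \<Longrightarrow> x \<in> \<NN> I \<longleftrightarrow> x \<in> carrier \<RR> \<and> x I = I"
  by (simp add: completion_ideal_def kernel_def A_FactGroup_def')

lemma completion_ideal_approx:
  assumes x: "x \<in> carrier \<RR>" and I: "I \<in> \<G>" and a: "a \<in> x I"
  shows "x \<in> \<NN> I \<longleftrightarrow> a \<in> I"
proof -
  have ac: "a \<in> carrier R" by (rule approx(1)[OF x I a])
  have "x I = I \<longleftrightarrow> I +> a = I +> \<zero>" using approx(2)[OF x I a] coset_zero[OF I] by simp
  also have "\<dots> \<longleftrightarrow> a \<in> I" using coset_eq_iff[OF I zero_closed ac] ac by (simp add: a_minus_def)
  finally show ?thesis using completion_ideal_iff[OF I] x by blast
qed

lemma completion_ideal_diff: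
  assumes x: "x \<in> carrier \<RR>" and y: "y \<in> carrier \<RR>" and I: "I \<in> \<G>"
  shows "x \<ominus>\<^bsub>\<RR>\<^esub> y \<in> \<NN> I \<longleftrightarrow> x I = y I"
proof -
  interpret C: ring \<RR> by (rule ring_completion)
  obtain a b where a: "a \<in> x I" and b: "b \<in> y I" using approx_exists[OF x I] approx_exists[OF y I] by metis
  have "x \<ominus>\<^bsub>\<RR>\<^esub> y \<in> \<NN> I \<longleftrightarrow> a \<ominus> b \<in> I"
    by (rule completion_ideal_approx[OF C.minus_closed[OF x y] I diff_approx[OF x y I a b]])
  also have "\<dots> \<longleftrightarrow> I +> a = I +> b"
    using coset_eq_iff[OF I approx(1)[OF y I b] approx(1)[OF x I a]] by simp
  finally show ?thesis using approx(2)[OF x I a] approx(2)[OF y I b] by simp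
qed

lemma completion_ideal_mono:
  assumes "I \<in> \<G>" "J \<in> \<G>" "I \<subseteq> J"
  shows "\<NN> I \<subseteq> \<NN> J"
proof
  fix x assume x: "x \<in> \<NN> I"
  then have xc: "x \<in> carrier \<RR>" and xI: "x I = I" using completion_ideal_iff assms by auto
  have "\<zero> \<in> x I" using xI right_ideal_zero[OF right_ideals[OF assms(1)]] by simp
  then have "\<zero> \<in> x J" by (rule approx_mono[OF xc assms])
  then show "x \<in> \<NN> J"
    using completion_ideal_approx[OF xc assms(2)] right_ideal_zero[OF right_ideals[OF assms(2)]] by blast
qed

lemma eval_mono:
  assumes x: "x \<in> carrier \<RR>" and y: "y \<in> carrier \<RR>" and "I \<in> \<G>" "J \<in> \<G>" "I \<subseteq> J" "x I = y I"
  shows "x J = y J"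
  using completion_ideal_diff[OF x y] completion_ideal_mono[OF assms(3-5)] assms by blast

lemma right_ideal_completion_ideal:
  assumes I: "I \<in> \<G>"
  shows "right_ideal (\<NN> I) \<RR>"
proof -
  interpret C: ring \<RR> by (rule ring_completion)
  note rI = right_ideals[OF I]
  have z: "\<zero> \<in> x I" if "x \<in> \<NN> I" for x
    using that completion_ideal_iff[OF I] right_ideal_zero[OF rI] by auto
  show ?thesis
  proof (rule C.right_idealI)
    show "\<NN> I \<subseteq> carrier \<RR>" using completion_ideal_iff[OF I] by blast
    show "\<zero>\<^bsub>\<RR>\<^esub> \<in> \<NN> I"
      using completion_ideal_iff[OF I] completion_zero_closed I by (simp add: completion_zero)
    fix x assume x: "x \<in> \<NN> I"
    then have xc: "x \<in> carrier \<RR>" using completion_ideal_iff[OF I] by blast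
    show "x \<oplus>\<^bsub>\<RR>\<^esub> y \<in> \<NN> I" if y: "y \<in> \<NN> I" for y
    proof -
      have yc: "y \<in> carrier \<RR>" using y completion_ideal_iff[OF I] by blast
      have "\<zero> \<oplus> \<zero> \<in> (x \<oplus>\<^bsub>\<RR>\<^esub> y) I" by (rule add_approx[OF xc yc I z[OF x] z[OF y]])
      then show ?thesis
        using completion_ideal_approx[OF C.a_closed[OF xc yc] I] right_ideal_zero[OF rI] by simp
    qed
    show "x \<otimes>\<^bsub>\<RR>\<^esub> y \<in> \<NN> I" if yc: "y \<in> carrier \<RR>" for y
    proof -
      have K: "colon R I \<zero> \<in> \<G>" by (rule T3[OF I zero_closed])
      obtain b where b: "b \<in> y (colon R I \<zero>)" using approx_exists[OF yc K] .
      have "\<zero> \<otimes> b \<in> (x \<otimes>\<^bsub>\<RR>\<^esub> y) I" by (rule mult_approx[OF xc yc I z[OF x] b])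
      then show ?thesis
        using completion_ideal_approx[OF C.m_closed[OF xc yc] I] right_ideal_zero[OF rI]
          approx(1)[OF yc K b] by simp
    qed
  qed
qed

lemma G_finite_Inter:
  assumes "finite F" "F \<subseteq> \<G>"
  shows "\<exists>I\<in>\<G>. \<forall>K\<in>F. I \<subseteq> K"
  using assms
proof (induction F)
  case empty
  then show ?case using T0 by blast
next
  case (insert K F)
  then obtain I where "I \<in> \<G>" "\<forall>K\<in>F. I \<subseteq> K" by auto
  then show ?case using T2[of I K] insert by (intro bexI[of _ "I \<inter> K"]) auto
qed

abbreviation "\<PP> \<equiv> product_topology (\<lambda>I. discrete_topology (a_rcosets I)) \<G>"

lemma completion_eval_in: "\<lbrakk>x \<in> carrier \<RR>; I \<in> \<G>\<rbrakk> \<Longrightarrow> x I \<in> a_rcosets I"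
  by (auto simp: carrier_completion A_RCOSETS_def')

lemma carrier_subset_topspace: "carrier \<RR> \<subseteq> topspace \<PP>"
  by (auto simp: gabriel_completion_def)

text \<open>
  Any finitely many members of \<open>\<G>\<close> contain a common member of \<open>\<G>\<close>, so that on the completion the basic
  open sets of the product topology are unions of sets given by the value at one \<open>I\<close>.
\<close>

lemma completion_openin_iff:
  "openin \<TT> U \<longleftrightarrow> U \<subseteq> carrier \<RR> \<and>
     (\<forall>x\<in>U. \<exists>I\<in>\<G>. \<forall>y\<in>carrier \<RR>. y I = x I \<longrightarrow> y \<in> U)"
proof
  assume "openin \<TT> U"
  then obtain W where W: "openin \<PP> W" and U: "U = W \<inter> carrier \<RR>"
    unfolding completion_topology_def openin_subtopology by blast
  have "\<exists>I\<in>\<G>. \<forall>y\<in>carrier \<RR>. y I = x I \<longrightarrow> y \<in> U" if x: "x \<in> U" for x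
  proof -
    have "x \<in> W" using x U by blast
    then have "\<exists>V. finite {I \<in> \<G>. V I \<noteq> topspace (discrete_topology (a_rcosets I))} \<and>
        (\<forall>I\<in>\<G>. openin (discrete_topology (a_rcosets I)) (V I)) \<and> x \<in> Pi\<^sub>E \<G> V \<and> Pi\<^sub>E \<G> V \<subseteq> W"
      using openin_product_topology_alt[THEN iffD1, OF W] by (rule bspec[rotated])
    then obtain V where fin: "finite {I \<in> \<G>. V I \<noteq> topspace (discrete_topology (a_rcosets I))}"
      and xV: "x \<in> Pi\<^sub>E \<G> V" and VW: "Pi\<^sub>E \<G> V \<subseteq> W"
      by (elim exE conjE) rule
    have "{I \<in> \<G>. V I \<noteq> topspace (discrete_topology (a_rcosets I))} \<subseteq> \<G>" by (rule Collect_restrict)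
    note G_finite_Inter[OF fin this]
    then
    obtain I where I: "I \<in> \<G>" "\<And>K. \<lbrakk>K \<in> \<G>; V K \<noteq> topspace (discrete_topology (a_rcosets K))\<rbrakk> \<Longrightarrow> I \<subseteq> K"
      by (elim bexE) simp
    have "y \<in> U" if y: "y \<in> carrier \<RR>" and yx: "y I = x I" for y
    proof -
      have xc: "x \<in> carrier \<RR>" using x U by blast
      have "y K \<in> V K" if K: "K \<in> \<G>" for K
      proof (cases "V K = topspace (discrete_topology (a_rcosets K))")
        case True
        then show ?thesis using completion_eval_in[OF y K] by simp
      next
        case False
        then have "y K = x K" using eval_mono[OF y xc I(1) K I(2)[OF K]] yx by blast
        moreover have "x K \<in> V K" using xV K by (rule PiE_mem)
        ultimately show ?thesis by simp
      qed
      then have "y \<in> Pi\<^sub>E \<G> V" using y by (simp add: PiE_iff carrier_completion)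
      then show ?thesis using VW U y by blast
    qed
    then show ?thesis using I(1) by blast
  qed
  then show "U \<subseteq> carrier \<RR> \<and> (\<forall>x\<in>U. \<exists>I\<in>\<G>. \<forall>y\<in>carrier \<RR>. y I = x I \<longrightarrow> y \<in> U)"
    using U by blast
next
  assume U: "U \<subseteq> carrier \<RR> \<and> (\<forall>x\<in>U. \<exists>I\<in>\<G>. \<forall>y\<in>carrier \<RR>. y I = x I \<longrightarrow> y \<in> U)"
  show "openin \<TT> U"
  proof (subst openin_subopen, rule ballI)
    fix x assume x: "x \<in> U"
    then obtain I where I: "I \<in> \<G>" "\<And>y. \<lbrakk>y \<in> carrier \<RR>; y I = x I\<rbrakk> \<Longrightarrow> y \<in> U" using U by blast
    have xc: "x \<in> carrier \<RR>" using x U by blast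
    let ?W = "{y \<in> topspace \<PP>. y I \<in> {x I}}"
    have "openin \<PP> ?W"
    proof (rule openin_continuous_map_preimage[OF continuous_map_product_projection[OF I(1)]])
      show "openin (discrete_topology (a_rcosets I)) {x I}"
        using completion_eval_in[OF xc I(1)] by simp
    qed
    then have "openin \<TT> (?W \<inter> carrier \<RR>)"
      unfolding completion_topology_def openin_subtopology by blast
    moreover have "x \<in> ?W \<inter> carrier \<RR>" using xc carrier_subset_topspace by blast
    moreover have "?W \<inter> carrier \<RR> \<subseteq> U" using I(2) by blast
    ultimately show "\<exists>V. openin \<TT> V \<and> x \<in> V \<and> V \<subseteq> U" by blast
  qed
qed

lemma open_right_ideal_iff:
  "open_right_ideal J \<RR> \<TT> \<longleftrightarrow> right_ideal J \<RR> \<and> (\<exists>I\<in>\<G>. \<NN> I \<subseteq> J)"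
proof -
  interpret C: ring \<RR> by (rule ring_completion)
  have "openin \<TT> J \<longleftrightarrow> (\<exists>I\<in>\<G>. \<NN> I \<subseteq> J)" if J: "right_ideal J \<RR>"
  proof
    assume "openin \<TT> J"
    then obtain I where I: "I \<in> \<G>" "\<forall>y\<in>carrier \<RR>. y I = \<zero>\<^bsub>\<RR>\<^esub> I \<longrightarrow> y \<in> J"
      using C.right_ideal_zero[OF J] unfolding completion_openin_iff by blast
    then have "\<NN> I \<subseteq> J" by (auto simp: completion_ideal_iff completion_zero)
    then show "\<exists>I\<in>\<G>. \<NN> I \<subseteq> J" using I(1) by blast
  next
    assume "\<exists>I\<in>\<G>. \<NN> I \<subseteq> J"
    then obtain I where I: "I \<in> \<G>" "\<NN> I \<subseteq> J" by blast
    have Jc: "J \<subseteq> carrier \<RR>" by (rule C.right_ideal_subset[OF J])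
    have "y \<in> J" if "x \<in> J" "y \<in> carrier \<RR>" "y I = x I" for x y
    proof -
      have xc: "x \<in> carrier \<RR>" using that Jc by blast
      have "y \<ominus>\<^bsub>\<RR>\<^esub> x \<in> J" using completion_ideal_diff[OF that(2) xc I(1)] that I(2) by blast
      then have "(y \<ominus>\<^bsub>\<RR>\<^esub> x) \<oplus>\<^bsub>\<RR>\<^esub> x \<in> J" using that(1) by (rule C.right_ideal_add[OF J])
      then show ?thesis using that(2) xc by (simp add: a_minus_def C.a_assoc C.l_neg)
    qed
    then show "openin \<TT> J" unfolding completion_openin_iff using Jc I(1) by blast
  qed
  then show ?thesis by (auto simp: open_right_ideal_def)
qed

lemma completion_ideal_open: "I \<in> \<G> \<Longrightarrow> open_right_ideal (\<NN> I) \<RR> \<TT>"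
  using open_right_ideal_iff right_ideal_completion_ideal by blast

lemma linear_top_ring_completion: "linear_top_ring \<RR> \<TT>"
proof (rule linear_top_ring.intro[OF ring_completion], rule linear_top_ring_axioms.intro)
  interpret C: ring \<RR> by (rule ring_completion)
  show "topspace \<TT> = carrier \<RR>"
    unfolding completion_topology_def topspace_subtopology using carrier_subset_topspace by blast
  show "openin \<TT> U \<longleftrightarrow> U \<subseteq> carrier \<RR> \<and>
      (\<forall>x\<in>U. \<exists>J. open_right_ideal J \<RR> \<TT> \<and> (\<forall>j\<in>J. x \<oplus>\<^bsub>\<RR>\<^esub> j \<in> U))" for U
  proof
    assume "openin \<TT> U"
    then have U: "U \<subseteq> carrier \<RR>" "\<And>x. x \<in> U \<Longrightarrow> \<exists>I\<in>\<G>. \<forall>y\<in>carrier \<RR>. y I = x I \<longrightarrow> y \<in> U"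
      unfolding completion_openin_iff by blast+
    have "\<exists>J. open_right_ideal J \<RR> \<TT> \<and> (\<forall>j\<in>J. x \<oplus>\<^bsub>\<RR>\<^esub> j \<in> U)" if x: "x \<in> U" for x
    proof -
      obtain I where I: "I \<in> \<G>" "\<forall>y\<in>carrier \<RR>. y I = x I \<longrightarrow> y \<in> U" using U(2)[OF x] by blast
      have xc: "x \<in> carrier \<RR>" using x U by blast
      have "x \<oplus>\<^bsub>\<RR>\<^esub> j \<in> U" if j: "j \<in> \<NN> I" for j
      proof -
        have jc: "j \<in> carrier \<RR>" using j completion_ideal_iff[OF I(1)] by blast
        have "(x \<oplus>\<^bsub>\<RR>\<^esub> j) \<ominus>\<^bsub>\<RR>\<^esub> x = j" using xc jc by (simp add: a_minus_def C.a_comm[of x j] C.a_assoc C.r_neg)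
        then have "(x \<oplus>\<^bsub>\<RR>\<^esub> j) I = x I"
          using completion_ideal_diff[OF C.a_closed[OF xc jc] xc I(1)] j by simp
        then show ?thesis using I(2) C.a_closed[OF xc jc] by blast
      qed
      then show ?thesis using completion_ideal_open[OF I(1)] by blast
    qed
    then show "U \<subseteq> carrier \<RR> \<and> (\<forall>x\<in>U. \<exists>J. open_right_ideal J \<RR> \<TT> \<and> (\<forall>j\<in>J. x \<oplus>\<^bsub>\<RR>\<^esub> j \<in> U))"
      using U(1) by blast
  next
    assume U: "U \<subseteq> carrier \<RR> \<and> (\<forall>x\<in>U. \<exists>J. open_right_ideal J \<RR> \<TT> \<and> (\<forall>j\<in>J. x \<oplus>\<^bsub>\<RR>\<^esub> j \<in> U))"
    have "\<exists>I\<in>\<G>. \<forall>y\<in>carrier \<RR>. y I = x I \<longrightarrow> y \<in> U" if x: "x \<in> U" for x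
    proof -
      obtain J where J: "open_right_ideal J \<RR> \<TT>" "\<forall>j\<in>J. x \<oplus>\<^bsub>\<RR>\<^esub> j \<in> U" using U x by blast
      then obtain I where I: "I \<in> \<G>" "\<NN> I \<subseteq> J" unfolding open_right_ideal_iff by blast
      have xc: "x \<in> carrier \<RR>" using x U by blast
      have "y \<in> U" if y: "y \<in> carrier \<RR>" "y I = x I" for y
      proof -
        have "y \<ominus>\<^bsub>\<RR>\<^esub> x \<in> J" using completion_ideal_diff[OF y(1) xc I(1)] y(2) I(2) by blast
        then have "x \<oplus>\<^bsub>\<RR>\<^esub> (y \<ominus>\<^bsub>\<RR>\<^esub> x) \<in> U" using J(2) by blast
        then show ?thesis using y(1) xc by (simp add: a_minus_def C.a_comm[of y] C.r_neg2)
      qed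
      then show ?thesis using I(1) by blast
    qed
    then show "openin \<TT> U" unfolding completion_openin_iff using U by blast
  qed
  show "open_right_ideal (colon \<RR> J s) \<RR> \<TT>" if J: "open_right_ideal J \<RR> \<TT>" and s: "s \<in> carrier \<RR>" for J s
  proof -
    obtain I where I: "I \<in> \<G>" "\<NN> I \<subseteq> J" using J unfolding open_right_ideal_iff by blast
    have rJ: "right_ideal J \<RR>" using J by (simp add: open_right_ideal_def)
    obtain a where a: "a \<in> s I" using approx_exists[OF s I(1)] .
    have ac: "a \<in> carrier R" by (rule approx(1)[OF s I(1) a])
    have K: "colon R I a \<in> \<G>" by (rule T3[OF I(1) ac])
    have "\<NN> (colon R I a) \<subseteq> colon \<RR> J s"
    proof
      fix y assume "y \<in> \<NN> (colon R I a)"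
      then have yc: "y \<in> carrier \<RR>" and "y (colon R I a) = colon R I a" using completion_ideal_iff[OF K] by auto
      then have "\<zero> \<in> y (colon R I a)" using right_ideal_zero[OF right_ideals[OF K]] by simp
      then have "a \<otimes> \<zero> \<in> (s \<otimes>\<^bsub>\<RR>\<^esub> y) I" by (rule mult_approx[OF s yc I(1) a])
      then have "s \<otimes>\<^bsub>\<RR>\<^esub> y \<in> \<NN> I"
        using completion_ideal_approx[OF C.m_closed[OF s yc] I(1)] right_ideal_zero[OF right_ideals[OF I(1)]] ac by simp
      then show "y \<in> colon \<RR> J s" using yc I(2) by (auto simp: colon_def)
    qed
    then show ?thesis unfolding open_right_ideal_iff using C.right_ideal_colon[OF rJ s] K by blast
  qed
  show "x = \<zero>\<^bsub>\<RR>\<^esub>" if x: "x \<in> carrier \<RR>" and xJ: "\<And>J. open_right_ideal J \<RR> \<TT> \<Longrightarrow> x \<in> J" for x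
  proof (rule completion_eqI[OF x completion_zero_closed])
    fix I assume I: "I \<in> \<G>"
    have "x I = I" using xJ[OF completion_ideal_open[OF I]] completion_ideal_iff[OF I] by blast
    then have "\<zero> \<in> x I" using right_ideal_zero[OF right_ideals[OF I]] by simp
    then show "\<exists>a. a \<in> x I \<and> a \<in> \<zero>\<^bsub>\<RR>\<^esub> I" using zero_approx[OF I] by blast
  qed
  show "\<exists>l\<in>carrier \<RR>. \<forall>J. open_right_ideal J \<RR> \<TT> \<longrightarrow> l \<ominus>\<^bsub>\<RR>\<^esub> a J \<in> J"
    if ac: "\<And>J. open_right_ideal J \<RR> \<TT> \<Longrightarrow> a J \<in> carrier \<RR>"
      and comp: "\<And>J J'. \<lbrakk>open_right_ideal J \<RR> \<TT>; open_right_ideal J' \<RR> \<TT>; J \<subseteq> J'\<rbrakk> \<Longrightarrow> a J \<ominus>\<^bsub>\<RR>\<^esub> a J' \<in> J'"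
    for a
  proof -
    \<comment> \<open>The component at \<open>I\<close> is read off from the element prescribed modulo \<open>\<NN> I\<close>.\<close>
    define l where "l = (\<lambda>I\<in>\<G>. a (\<NN> I) I)"
    have aN: "a (\<NN> I) \<in> carrier \<RR>" if "I \<in> \<G>" for I by (rule ac[OF completion_ideal_open[OF that]])
    have lI: "l I = a (\<NN> I) I" if "I \<in> \<G>" for I using that by (simp add: l_def)
    have lc: "l \<in> carrier \<RR>"
    proof (rule completion_memI)
      show "l \<in> extensional \<G>" by (simp add: l_def)
      show "\<exists>b\<in>carrier R. l I = I +> b" if I: "I \<in> \<G>" for I
        unfolding lI[OF I] using aN[OF I] I by (simp add: carrier_completion)
      fix I J assume IJ: "I \<in> \<G>" "J \<in> \<G>" "I \<subseteq> J"
      obtain b where b: "b \<in> a (\<NN> I) I" using approx_exists[OF aN[OF IJ(1)] IJ(1)] .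
      have "a (\<NN> I) \<ominus>\<^bsub>\<RR>\<^esub> a (\<NN> J) \<in> \<NN> J"
        by (rule comp[OF completion_ideal_open[OF IJ(1)] completion_ideal_open[OF IJ(2)] completion_ideal_mono[OF IJ]])
      then have "a (\<NN> I) J = a (\<NN> J) J"
        using completion_ideal_diff[OF aN[OF IJ(1)] aN[OF IJ(2)] IJ(2)] by blast
      moreover have "b \<in> a (\<NN> I) J" by (rule approx_mono[OF aN[OF IJ(1)] IJ b])
      ultimately show "\<exists>b. b \<in> l I \<and> b \<in> l J" using b lI IJ by auto
    qed
    moreover have "l \<ominus>\<^bsub>\<RR>\<^esub> a J \<in> J" if J: "open_right_ideal J \<RR> \<TT>" for J
    proof -
      obtain I where I: "I \<in> \<G>" "\<NN> I \<subseteq> J" using J unfolding open_right_ideal_iff by blast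
      have rJ: "right_ideal J \<RR>" using J by (simp add: open_right_ideal_def)
      have "l \<ominus>\<^bsub>\<RR>\<^esub> a (\<NN> I) \<in> \<NN> I" using completion_ideal_diff[OF lc aN[OF I(1)] I(1)] lI[OF I(1)] by blast
      then have "l \<ominus>\<^bsub>\<RR>\<^esub> a (\<NN> I) \<in> J" using I(2) by blast
      moreover have "a (\<NN> I) \<ominus>\<^bsub>\<RR>\<^esub> a J \<in> J" by (rule comp[OF completion_ideal_open[OF I(1)] J I(2)])
      ultimately have "(l \<ominus>\<^bsub>\<RR>\<^esub> a (\<NN> I)) \<oplus>\<^bsub>\<RR>\<^esub> (a (\<NN> I) \<ominus>\<^bsub>\<RR>\<^esub> a J) \<in> J"
        by (rule C.right_ideal_add[OF rJ])
      then show ?thesis using lc aN[OF I(1)] ac[OF J] by (simp add: a_minus_def C.a_assoc C.r_neg1)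
    qed
    ultimately show ?thesis by blast
  qed
qed

lemma rho_hom: "\<rho> \<in> ring_hom R \<RR>"
proof (rule ring_hom_memI)
  interpret C: ring \<RR> by (rule ring_completion)
  show "\<rho> r \<in> carrier \<RR>" if "r \<in> carrier R" for r by (rule rho_in[OF that])
  show "\<rho> \<one> = \<one>\<^bsub>\<RR>\<^esub>" by (rule rho_one)
  fix r s assume r: "r \<in> carrier R" and s: "s \<in> carrier R"
  show "\<rho> (r \<otimes> s) = \<rho> r \<otimes>\<^bsub>\<RR>\<^esub> \<rho> s"
  proof (rule completion_eqI[OF rho_in[OF m_closed[OF r s]] C.m_closed[OF rho_in[OF r] rho_in[OF s]]])
    fix I assume I: "I \<in> \<G>"
    show "\<exists>a. a \<in> \<rho> (r \<otimes> s) I \<and> a \<in> (\<rho> r \<otimes>\<^bsub>\<RR>\<^esub> \<rho> s) I"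
      by (intro exI[of _ "r \<otimes> s"] conjI mult_approx rho_approx rho_in T3 m_closed I r s)
  qed
  show "\<rho> (r \<oplus> s) = \<rho> r \<oplus>\<^bsub>\<RR>\<^esub> \<rho> s"
  proof (rule completion_eqI[OF rho_in[OF a_closed[OF r s]] C.a_closed[OF rho_in[OF r] rho_in[OF s]]])
    fix I assume I: "I \<in> \<G>"
    show "\<exists>a. a \<in> \<rho> (r \<oplus> s) I \<and> a \<in> (\<rho> r \<oplus>\<^bsub>\<RR>\<^esub> \<rho> s) I"
      by (intro exI[of _ "r \<oplus> s"] conjI add_approx rho_approx rho_in a_closed I r s)
  qed
qed

lemma rho_finsum:
  assumes "f \<in> A \<rightarrow> carrier R"
  shows "\<rho> (finsum R f A) = finsum \<RR> (\<lambda>a. \<rho> (f a)) A"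
proof -
  interpret h: ring_hom_ring R \<RR> \<rho>
    by (rule ring_hom_ringI2[OF ring_axioms ring_completion rho_hom])
  show ?thesis
    using assms by (induction A rule: infinite_finite_induct) (auto simp: Pi_def)
qed

lemma rho_completion_ideal: "\<lbrakk>r \<in> carrier R; I \<in> \<G>\<rbrakk> \<Longrightarrow> \<rho> r \<in> \<NN> I \<longleftrightarrow> r \<in> I"
  by (rule completion_ideal_approx[OF rho_in _ rho_approx])

lemma rho_approximates:
  assumes x: "x \<in> carrier \<RR>" and I: "I \<in> \<G>"
  shows "r \<in> x I \<Longrightarrow> x \<ominus>\<^bsub>\<RR>\<^esub> \<rho> r \<in> \<NN> I"
proof -
  assume r: "r \<in> x I"
  have rc: "r \<in> carrier R" by (rule approx(1)[OF x I r])
  show ?thesis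
    using completion_ideal_diff[OF x rho_in[OF rc] I] approx(2)[OF x I r] rho_eval[OF I] by simp
qed

subsection \<open>Finitely generated right ideals\<close>

text \<open>
  The image of \<open>K\<^sup>A\<close> under \<open>t \<mapsto> \<Sum> a t\<^sub>a\<close>; for \<open>K = carrier R\<close> this is the right ideal generated by \<open>A\<close>.
\<close>

definition right_span :: "'a set \<Rightarrow> 'a set \<Rightarrow> 'a set" where
  "right_span A K = {finsum R (\<lambda>a. a \<otimes> t a) A | t. t \<in> A \<rightarrow> K}"

lemma right_ideal_span:
  assumes A: "finite A" "A \<subseteq> carrier R" and K: "right_ideal K R"
  shows "right_ideal (right_span A K) R"
proof (rule right_idealI)
  have Kc: "K \<subseteq> carrier R" by (rule right_ideal_subset[OF K])
  have c: "(\<lambda>a. a \<otimes> t a) \<in> A \<rightarrow> carrier R" if "t \<in> A \<rightarrow> K" for t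
    using A Kc funcset_mem[OF that] by auto
  show "right_span A K \<subseteq> carrier R" using c by (auto simp: right_span_def intro!: finsum_closed)
  have "finsum R (\<lambda>a. a \<otimes> \<zero>) A = \<zero>"
    using A by (subst finsum_cong'[of A A "\<lambda>_. \<zero>"]) (auto simp: finsum_zero)
  then show "\<zero> \<in> right_span A K"
    unfolding right_span_def using right_ideal_zero[OF K] by (auto intro!: exI[of _ "\<lambda>_. \<zero>"])
  fix x assume "x \<in> right_span A K"
  then obtain t where t: "t \<in> A \<rightarrow> K" and x: "x = finsum R (\<lambda>a. a \<otimes> t a) A" by (auto simp: right_span_def)
  have tc: "t a \<in> carrier R" if "a \<in> A" for a using funcset_mem[OF t that] Kc by blast
  show "x \<oplus> y \<in> right_span A K" if ys: "y \<in> right_span A K" for y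
  proof -
    obtain u where u: "u \<in> A \<rightarrow> K" and y: "y = finsum R (\<lambda>a. a \<otimes> u a) A" using ys by (auto simp: right_span_def)
    have uc: "u a \<in> carrier R" if "a \<in> A" for a using funcset_mem[OF u that] Kc by blast
    have "x \<oplus> y = finsum R (\<lambda>a. a \<otimes> t a \<oplus> a \<otimes> u a) A"
      unfolding x y by (rule finsum_addf[OF c[OF t] c[OF u], symmetric])
    also have "\<dots> = finsum R (\<lambda>a. a \<otimes> (t a \<oplus> u a)) A"
      by (rule finsum_cong') (use A tc uc in \<open>auto simp: r_distr\<close>)
    finally show ?thesis
      unfolding right_span_def using right_ideal_add[OF K] funcset_mem[OF t] funcset_mem[OF u]
      by (auto intro!: exI[of _ "\<lambda>a. t a \<oplus> u a"])
  qed
  show "x \<otimes> r \<in> right_span A K" if r: "r \<in> carrier R" for r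
  proof -
    have "x \<otimes> r = finsum R (\<lambda>a. (a \<otimes> t a) \<otimes> r) A"
      unfolding x by (rule finsum_ldistr[OF A(1) r c[OF t]])
    also have "\<dots> = finsum R (\<lambda>a. a \<otimes> (t a \<otimes> r)) A"
      by (rule finsum_cong') (use A tc r in \<open>auto simp: m_assoc\<close>)
    finally show ?thesis
      unfolding right_span_def using right_ideal_mult[OF K] funcset_mem[OF t] r
      by (auto intro!: exI[of _ "\<lambda>a. t a \<otimes> r"])
  qed
qed

lemma right_span_mono: "K \<subseteq> L \<Longrightarrow> right_span A K \<subseteq> right_span A L"
  by (fastforce simp: right_span_def)

lemma right_span_subset:
  assumes "right_ideal I R" "\<And>a k. \<lbrakk>a \<in> A; k \<in> K\<rbrakk> \<Longrightarrow> a \<otimes> k \<in> I"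
  shows "right_span A K \<subseteq> I"
  using assms(2) by (auto simp: right_span_def intro!: right_ideal_finsum[OF assms(1)])

lemma gen_right_ideal_span:
  assumes A: "finite A" "A \<subseteq> carrier R"
  shows "gen_right_ideal R A = right_span A (carrier R)"
proof
  have cR: "right_ideal (carrier R) R" by (rule right_idealI) auto
  have "a \<in> right_span A (carrier R)" if a: "a \<in> A" for a
  proof -
    have "finsum R (\<lambda>b. b \<otimes> (if b = a then \<one> else \<zero>)) A = finsum R (\<lambda>b. if a = b then b else \<zero>) A"
      by (rule finsum_cong') (use A in auto)
    also have "\<dots> = a" using add.finprod_singleton[OF a A(1), of "\<lambda>b. b"] A by auto
    finally show ?thesis
      unfolding right_span_def by (auto intro!: exI[of _ "\<lambda>b. if b = a then \<one> else \<zero>"])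
  qed
  then show "gen_right_ideal R A \<subseteq> right_span A (carrier R)"
    unfolding gen_right_ideal_def using right_ideal_span[OF A cR] by blast
  show "right_span A (carrier R) \<subseteq> gen_right_ideal R A"
    unfolding gen_right_ideal_def
    by (intro Inter_greatest right_span_subset) (auto intro: right_ideal_mult)
qed

text \<open>
  This is the use of T4: for \<open>s = \<Sum> a t\<^sub>a\<close> the ideal \<open>colon R (right_span A K) s\<close> contains the intersection of
  the ideals \<open>colon R K (t a)\<close>, as \<open>s r = \<Sum> a (t\<^sub>a r)\<close>.
\<close>

lemma right_span_G:
  assumes A: "finite A" "A \<subseteq> carrier R" and gen: "right_span A (carrier R) \<in> \<G>" and K: "K \<in> \<G>"
  shows "right_span A K \<in> \<G>"
proof (rule T4[OF right_ideal_span[OF A right_ideals[OF K]] gen])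
  fix s assume "s \<in> right_span A (carrier R)"
  then obtain t where t: "t \<in> A \<rightarrow> carrier R" and s: "s = finsum R (\<lambda>a. a \<otimes> t a) A" by (auto simp: right_span_def)
  have c: "(\<lambda>a. a \<otimes> t a) \<in> A \<rightarrow> carrier R" using A funcset_mem[OF t] by auto
  have sc: "s \<in> carrier R" unfolding s by (rule finsum_closed[OF c])
  have "finite ((\<lambda>a. colon R K (t a)) ` A)" "(\<lambda>a. colon R K (t a)) ` A \<subseteq> \<G>"
    using A T3[OF K] funcset_mem[OF t] by auto
  then obtain L where L: "L \<in> \<G>" "\<And>a. a \<in> A \<Longrightarrow> L \<subseteq> colon R K (t a)"
    using G_finite_Inter[of "(\<lambda>a. colon R K (t a)) ` A"] by auto
  show "colon R (right_span A K) s \<in> \<G>"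
  proof (rule T1[OF L(1) right_ideal_colon[OF right_ideal_span[OF A right_ideals[OF K]] sc]], rule subsetI)
    fix r assume r: "r \<in> L"
    then have rc: "r \<in> carrier R" using right_ideal_subset[OF right_ideals[OF L(1)]] by blast
    have tr: "t a \<otimes> r \<in> K" if "a \<in> A" for a using L(2)[OF that] r by (auto simp: colon_def)
    have "s \<otimes> r = finsum R (\<lambda>a. (a \<otimes> t a) \<otimes> r) A"
      unfolding s by (rule finsum_ldistr[OF A(1) rc c])
    also have "\<dots> = finsum R (\<lambda>a. a \<otimes> (t a \<otimes> r)) A"
      by (rule finsum_cong') (use A funcset_mem[OF t] rc in \<open>auto simp: m_assoc\<close>)
    finally have "s \<otimes> r \<in> right_span A K"
      unfolding right_span_def using tr by (auto intro!: exI[of _ "\<lambda>a. t a \<otimes> r"])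
    then show "r \<in> colon R (right_span A K) s" using rc by (simp add: colon_def)
  qed
qed

text \<open>Left multiplication by each of the finitely many generators is continuous.\<close>

lemma right_span_cofinal:
  assumes A: "finite A" "A \<subseteq> carrier R" and K: "K \<in> \<G>"
  shows "\<exists>L\<in>\<G>. right_span A L \<subseteq> K"
proof -
  have "finite ((\<lambda>a. colon R K a) ` A)" "(\<lambda>a. colon R K a) ` A \<subseteq> \<G>"
    using A T3[OF K] by auto
  then obtain L where L: "L \<in> \<G>" "\<And>a. a \<in> A \<Longrightarrow> L \<subseteq> colon R K a"
    using G_finite_Inter[of "(\<lambda>a. colon R K a) ` A"] by auto
  have "right_span A L \<subseteq> K"
    by (rule right_span_subset[OF right_ideals[OF K]]) (use L(2) in \<open>auto simp: colon_def\<close>)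
  then show ?thesis using L(1) by blast
qed

lemma telescope_finsum:
  assumes "\<And>j. y j \<in> carrier R" "y 0 = \<zero>"
  shows "finsum R (\<lambda>j. y (Suc j) \<ominus> y j) {..<m::nat} = y m"
proof (induction m)
  case (Suc m)
  have "finsum R (\<lambda>j. y (Suc j) \<ominus> y j) (insert m {..<m}) =
      (y (Suc m) \<ominus> y m) \<oplus> finsum R (\<lambda>j. y (Suc j) \<ominus> y j) {..<m}"
    by (rule finsum_insert) (use assms in auto)
  then show ?case using Suc assms(1) by (simp add: lessThan_Suc a_minus_def a_assoc l_neg)
qed (use assms in simp)

text \<open>
  An element of \<open>\<NN> (right_span A (B n))\<close> is a convergent series whose \<open>j\<close>-th term comes from
  \<open>right_span A (B (n + j))\<close>, because these ideals form a base.  Every term is a combination of the elements of \<open>A\<close>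
  with coefficients in \<open>B (n + j)\<close>, and the series of the coefficients converge separately.
\<close>

lemma completion_span_series:
  fixes B :: "nat \<Rightarrow> 'a set"
  assumes B: "\<And>n. B n \<in> \<G>" and dec: "\<And>m n. m \<le> n \<Longrightarrow> B n \<subseteq> B m" and base: "\<And>K. K \<in> \<G> \<Longrightarrow> \<exists>n. B n \<subseteq> K"
    and A: "finite A" "A \<subseteq> carrier R" and gen: "right_span A (carrier R) \<in> \<G>"
    and s: "s \<in> \<NN> (right_span A (B n))"
  obtains t where "t \<in> A \<rightarrow> \<NN> (B n)" "s = finsum \<RR> (\<lambda>a. \<rho> a \<otimes>\<^bsub>\<RR>\<^esub> t a) A"
proof -
  interpret L: linear_top_ring \<RR> \<TT> by (rule linear_top_ring_completion)
  define Q where "Q k = right_span A (B k)" for k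
  have Q: "Q k \<in> \<G>" for k unfolding Q_def by (rule right_span_G[OF A gen B])
  have Qdec: "Q m \<subseteq> Q k" if "k \<le> m" for k m unfolding Q_def by (rule right_span_mono[OF dec[OF that]])
  have Qbase: "\<exists>k. Q k \<subseteq> K" if K: "K \<in> \<G>" for K
  proof -
    obtain L where "L \<in> \<G>" "right_span A L \<subseteq> K" using right_span_cofinal[OF A K] by blast
    moreover from this obtain k where "B k \<subseteq> L" using base by blast
    ultimately show ?thesis unfolding Q_def using right_span_mono by blast
  qed
  have sc: "s \<in> carrier \<RR>" and sQ: "s (Q n) = Q n"
    using s completion_ideal_iff[OF Q[of n]] by (auto simp: Q_def)
  \<comment> \<open>The partial sums; starting with \<open>0\<close> is possible because \<open>s\<close> vanishes modulo \<open>Q n\<close>.\<close>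
  define y where "y j = (if j = 0 then \<zero> else (SOME a. a \<in> s (Q (n + j))))" for j :: nat
  have y: "y j \<in> s (Q (n + j))" for j
  proof (cases "j = 0")
    case True
    then show ?thesis using sQ right_ideal_zero[OF right_ideals[OF Q]] by (simp add: y_def)
  next
    case False
    obtain a where "a \<in> s (Q (n + j))" using approx_exists[OF sc Q] .
    then have "(SOME a. a \<in> s (Q (n + j))) \<in> s (Q (n + j))" by (rule someI)
    then show ?thesis using False by (simp add: y_def)
  qed
  have yc: "y j \<in> carrier R" for j by (rule approx(1)[OF sc Q y])
  have step: "y (Suc j) \<ominus> y j \<in> Q (n + j)" for j
  proof -
    have "y (Suc j) \<in> s (Q (n + j))"
      by (rule approx_mono[OF sc Q Q _ y]) (simp add: Qdec)
    then have "y (Suc j) \<in> Q (n + j) +> y j" using approx(2)[OF sc Q y] by simp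
    then show ?thesis using coset_iff[OF Q yc] by blast
  qed
  have "\<forall>j. \<exists>t. t \<in> A \<rightarrow> B (n + j) \<and> y (Suc j) \<ominus> y j = finsum R (\<lambda>a. a \<otimes> t a) A"
    using step unfolding Q_def right_span_def by blast
  then obtain \<tau> where \<tau>: "\<forall>j. \<tau> j \<in> A \<rightarrow> B (n + j) \<and> y (Suc j) \<ominus> y j = finsum R (\<lambda>a. a \<otimes> \<tau> j a) A"
    by (rule choice[THEN exE])
  have \<tau>B: "\<tau> j a \<in> B (n + j)" if "a \<in> A" for a j using \<tau> that by auto
  have \<tau>c: "\<tau> j a \<in> carrier R" if "a \<in> A" for a j
    using \<tau>B[OF that] right_ideal_subset[OF right_ideals[OF B]] by blast
  have ac: "a \<in> carrier R" if "a \<in> A" for a using A that by blast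
  have rB: "\<rho> (\<tau> j a) \<in> \<NN> (B (n + j))" if "a \<in> A" for a j
    using \<tau>B[OF that] rho_completion_ideal[OF \<tau>c[OF that] B] by blast
  have z: "L.zconv (\<lambda>j. \<rho> (\<tau> j a)) UNIV" if a: "a \<in> A" for a
    unfolding L.zconv_def
  proof (intro conjI allI impI)
    show "(\<lambda>j. \<rho> (\<tau> j a)) \<in> UNIV \<rightarrow> carrier \<RR>" using rho_in \<tau>c[OF a] by simp
    fix J assume "L.oi J"
    then obtain K where K: "K \<in> \<G>" "\<NN> K \<subseteq> J" unfolding open_right_ideal_iff by blast
    obtain m where m: "B m \<subseteq> K" using base[OF K(1)] by blast
    have "\<rho> (\<tau> j a) \<in> J" if "m \<le> j" for j
    proof -
      have "B (n + j) \<subseteq> K" using dec[of m "n + j"] that m by auto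
      then show ?thesis using rB[OF a, of j] completion_ideal_mono[OF B K(1)] K(2) by blast
    qed
    then have "{j \<in> UNIV. \<rho> (\<tau> j a) \<notin> J} \<subseteq> {..<m}" using not_le_imp_less by blast
    then show "finite {j \<in> UNIV. \<rho> (\<tau> j a) \<notin> J}" using finite_subset by blast
  qed
  define t where "t a = conv_sum \<RR> \<TT> (\<lambda>j. \<rho> (\<tau> j a)) UNIV" for a
  have tsum: "L.has_csum (\<lambda>j. \<rho> (\<tau> j a)) UNIV (t a)" if "a \<in> A" for a
    unfolding t_def by (rule L.has_csum_conv_sum[OF z[OF that]])
  have tB: "t a \<in> \<NN> (B n)" if a: "a \<in> A" for a
  proof (rule L.has_csum_mem[OF tsum[OF a] completion_ideal_open[OF B]])
    fix j show "\<rho> (\<tau> j a) \<in> \<NN> (B n)"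
      using rB[OF a, of j] completion_ideal_mono[OF B B dec[of n "n + j"]] by auto
  qed
  have 1: "L.has_csum (\<lambda>j. finsum \<RR> (\<lambda>a. \<rho> a \<otimes>\<^bsub>\<RR>\<^esub> \<rho> (\<tau> j a)) A) UNIV
      (finsum \<RR> (\<lambda>a. \<rho> a \<otimes>\<^bsub>\<RR>\<^esub> t a) A)"
    by (rule L.has_csum_finsum[OF A(1)]) (rule L.has_csum_lmult[OF tsum rho_in[OF ac]])
  have eq: "finsum \<RR> (\<lambda>a. \<rho> a \<otimes>\<^bsub>\<RR>\<^esub> \<rho> (\<tau> j a)) A = \<rho> (y (Suc j) \<ominus> y j)" for j
  proof -
    have "\<rho> (y (Suc j) \<ominus> y j) = \<rho> (finsum R (\<lambda>a. a \<otimes> \<tau> j a) A)" using \<tau> by simp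
    also have "\<dots> = finsum \<RR> (\<lambda>a. \<rho> (a \<otimes> \<tau> j a)) A"
      by (rule rho_finsum) (use ac \<tau>c in auto)
    also have "\<dots> = finsum \<RR> (\<lambda>a. \<rho> a \<otimes>\<^bsub>\<RR>\<^esub> \<rho> (\<tau> j a)) A"
      by (rule L.finsum_cong') (use ac \<tau>c rho_in ring_hom_mult[OF rho_hom] in auto)
    finally show ?thesis by simp
  qed
  have 2: "L.has_csum (\<lambda>j. \<rho> (y (Suc j) \<ominus> y j)) UNIV s"
  proof (rule L.has_csumI)
    show "(\<lambda>j. \<rho> (y (Suc j) \<ominus> y j)) \<in> UNIV \<rightarrow> carrier \<RR>" using rho_in yc by simp
    show "s \<in> carrier \<RR>" by (rule sc)
    fix J assume J: "L.oi J"
    then obtain K where K: "K \<in> \<G>" "\<NN> K \<subseteq> J" unfolding open_right_ideal_iff by blast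
    obtain m where m: "Q m \<subseteq> K" using Qbase[OF K(1)] by blast
    have QK: "Q (n + j) \<subseteq> K" if "m \<le> j" for j using Qdec[of m "n + j"] that m by auto
    have "\<rho> (y (Suc j) \<ominus> y j) \<in> J" if "m \<le> j" for j
      using step[of j] QK[OF that] K(2) rho_completion_ideal[OF minus_closed[OF yc yc] K(1)] by blast
    moreover have "finsum \<RR> (\<lambda>j. \<rho> (y (Suc j) \<ominus> y j)) {..<m} \<ominus>\<^bsub>\<RR>\<^esub> s \<in> J"
    proof -
      have "finsum \<RR> (\<lambda>j. \<rho> (y (Suc j) \<ominus> y j)) {..<m} = \<rho> (finsum R (\<lambda>j. y (Suc j) \<ominus> y j) {..<m})"
        by (rule rho_finsum[symmetric]) (use yc in auto)
      also have "\<dots> = \<rho> (y m)" by (subst telescope_finsum[OF yc]) (simp_all add: y_def)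
      finally have "finsum \<RR> (\<lambda>j. \<rho> (y (Suc j) \<ominus> y j)) {..<m} = \<rho> (y m)" .
      moreover have "s \<ominus>\<^bsub>\<RR>\<^esub> \<rho> (y m) \<in> \<NN> (Q (n + m))" by (rule rho_approximates[OF sc Q y])
      then have "s \<ominus>\<^bsub>\<RR>\<^esub> \<rho> (y m) \<in> J" using completion_ideal_mono[OF Q K(1) QK[of m]] K(2) by blast
      then have "\<rho> (y m) \<ominus>\<^bsub>\<RR>\<^esub> s \<in> J" by (rule L.oi_diff_sym[OF J _ sc rho_in[OF yc]])
      ultimately show ?thesis by simp
    qed
    ultimately show "\<exists>F. finite F \<and> F \<subseteq> UNIV \<and> (\<forall>j\<in>UNIV - F. \<rho> (y (Suc j) \<ominus> y j) \<in> J) \<and>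
        finsum \<RR> (\<lambda>j. \<rho> (y (Suc j) \<ominus> y j)) F \<ominus>\<^bsub>\<RR>\<^esub> s \<in> J"
      by (intro exI[of _ "{..<m}"]) auto
  qed
  have "s = finsum \<RR> (\<lambda>a. \<rho> a \<otimes>\<^bsub>\<RR>\<^esub> t a) A"
    by (rule L.has_csum_unique[OF 2]) (use 1 in \<open>simp only: eq\<close>)
  then show thesis using that[of t] tB by blast
qed

text \<open>
  To make the coefficients as small as the size of \<open>s\<close> requires, \<open>s\<close> is expanded into a series from the last
  \<open>n\<close> on for which it belongs to \<open>\<NN> (right_span A (B n))\<close>.  There is a last one unless \<open>s\<close> is zero.
\<close>

lemma completion_fg_lift:
  fixes B :: "nat \<Rightarrow> 'a set"
  assumes B: "\<And>n. B n \<in> \<G>" and dec: "\<And>m n. m \<le> n \<Longrightarrow> B n \<subseteq> B m" and base: "\<And>K. K \<in> \<G> \<Longrightarrow> \<exists>n. B n \<subseteq> K"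
    and B0: "B 0 = carrier R"
    and A: "finite A" "A \<subseteq> carrier R" and gen: "right_span A (carrier R) \<in> \<G>"
    and s: "s \<in> \<NN> (right_span A (carrier R))"
  shows "\<exists>t\<in>A \<rightarrow> carrier \<RR>. s = finsum \<RR> (\<lambda>a. \<rho> a \<otimes>\<^bsub>\<RR>\<^esub> t a) A \<and>
    (\<forall>k. s \<in> \<NN> (right_span A (B k)) \<longrightarrow> (\<forall>a\<in>A. t a \<in> \<NN> (B k)))"
proof (cases "s = \<zero>\<^bsub>\<RR>\<^esub>")
  interpret C: ring \<RR> by (rule ring_completion)
  case True
  have "finsum \<RR> (\<lambda>a. \<rho> a \<otimes>\<^bsub>\<RR>\<^esub> \<zero>\<^bsub>\<RR>\<^esub>) A = finsum \<RR> (\<lambda>a. \<zero>\<^bsub>\<RR>\<^esub>) A"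
    by (rule C.finsum_cong') (use A rho_in in auto)
  moreover have "\<zero>\<^bsub>\<RR>\<^esub> \<in> \<NN> (B k)" for k
    by (rule C.right_ideal_zero[OF right_ideal_completion_ideal[OF B]])
  ultimately show ?thesis using True by (intro bexI[of _ "\<lambda>_. \<zero>\<^bsub>\<RR>\<^esub>"]) auto
next
  case False
  have Q: "right_span A (B k) \<in> \<G>" for k by (rule right_span_G[OF A gen B])
  have sc: "s \<in> carrier \<RR>" using s completion_ideal_iff[OF gen] by blast
  have "\<exists>k. s \<notin> \<NN> (right_span A (B k))"
  proof (rule ccontr)
    assume "\<nexists>k. s \<notin> \<NN> (right_span A (B k))"
    then have all: "s \<in> \<NN> (right_span A (B k))" for k by blast
    have "s = \<zero>\<^bsub>\<RR>\<^esub>"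
    proof (rule completion_eqI[OF sc completion_zero_closed])
      fix K assume K: "K \<in> \<G>"
      obtain L where L: "L \<in> \<G>" "right_span A L \<subseteq> K" using right_span_cofinal[OF A K] by blast
      obtain k where "B k \<subseteq> L" using base[OF L(1)] by blast
      then have "right_span A (B k) \<subseteq> K" using right_span_mono[of "B k" L A] L(2) by blast
      then have "s \<in> \<NN> K" using all[of k] completion_ideal_mono[OF Q K] by blast
      then have "s K = K" using completion_ideal_iff[OF K] by blast
      then have "\<zero> \<in> s K" using right_ideal_zero[OF right_ideals[OF K]] by simp
      then show "\<exists>a. a \<in> s K \<and> a \<in> \<zero>\<^bsub>\<RR>\<^esub> K" using zero_approx[OF K] by blast
    qed
    then show False using False by blast
  qed
  then obtain k0 where k0: "s \<notin> \<NN> (right_span A (B k0))" and least: "\<And>k. k < k0 \<Longrightarrow> s \<in> \<NN> (right_span A (B k))"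
    using exists_least_iff[of "\<lambda>k. s \<notin> \<NN> (right_span A (B k))"] by blast
  have "k0 \<noteq> 0" using k0 s B0 by (metis)
  then obtain n where n: "k0 = Suc n" using not0_implies_Suc by blast
  obtain t where t: "t \<in> A \<rightarrow> \<NN> (B n)" "s = finsum \<RR> (\<lambda>a. \<rho> a \<otimes>\<^bsub>\<RR>\<^esub> t a) A"
    using completion_span_series[OF B dec base A gen least[of n]] n by blast
  have "t a \<in> \<NN> (B k)" if "s \<in> \<NN> (right_span A (B k))" "a \<in> A" for a k
  proof -
    have "k \<le> n"
    proof (rule ccontr)
      assume "\<not> k \<le> n"
      then have "k0 \<le> k" using n by simp
      then have "s \<in> \<NN> (right_span A (B k0))"
        using that(1) completion_ideal_mono[OF Q Q right_span_mono[OF dec]] by blast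
      then show False using k0 by blast
    qed
    then show ?thesis using funcset_mem[OF t(1) that(2)] completion_ideal_mono[OF B B dec] by blast
  qed
  moreover have "t \<in> A \<rightarrow> carrier \<RR>" using funcset_mem[OF t(1)] completion_ideal_iff[OF B] by auto
  ultimately show ?thesis using t(2) by blast
qed

text \<open>
  The sequence starts with \<open>R\<close> itself, so that \<open>right_span A (B 0)\<close> is the whole ideal generated by \<open>A\<close>.
\<close>

lemma fg_base_sequence:
  assumes "gabriel_base \<G> \<B>" "countable \<B>" "\<And>I. I \<in> \<B> \<Longrightarrow> fg_right_ideal I R"
  obtains B :: "nat \<Rightarrow> 'a set" where "B 0 = carrier R" "\<And>n. B n \<in> \<G>" "\<And>m n. m \<le> n \<Longrightarrow> B n \<subseteq> B m"
    "\<And>K. K \<in> \<G> \<Longrightarrow> \<exists>n. B n \<subseteq> K" "\<And>n. fg_right_ideal (B n) R"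
proof -
  have BG: "\<B> \<subseteq> \<G>" and ex: "\<And>I. I \<in> \<G> \<Longrightarrow> \<exists>J\<in>\<B>. J \<subseteq> I" using assms(1) by (auto simp: gabriel_base_def)
  have ne: "\<B> \<noteq> {}" using ex[OF T0] by blast
  define e where "e = from_nat_into \<B>"
  have e: "e n \<in> \<B>" for n unfolding e_def by (rule from_nat_into[OF ne])
  have surj: "\<exists>n. e n = I" if "I \<in> \<B>" for I
    unfolding e_def using from_nat_into_surj[OF assms(2) that] .
  define g where "g I = (SOME J. J \<in> \<B> \<and> J \<subseteq> I)" for I
  have g: "g I \<in> \<B> \<and> g I \<subseteq> I" if "I \<in> \<G>" for I
  proof -
    have "\<exists>J. J \<in> \<B> \<and> J \<subseteq> I" using ex[OF that] by blast
    then show ?thesis unfolding g_def by (rule someI_ex)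
  qed
  define B where "B = rec_nat (carrier R) (\<lambda>n I. g (I \<inter> e n))"
  have B0: "B 0 = carrier R" and BS: "B (Suc n) = g (B n \<inter> e n)" for n by (simp_all add: B_def)
  have BGn: "B n \<in> \<G>" for n
  proof (induction n)
    case 0
    show ?case unfolding B0 by (rule T0)
  next
    case (Suc n)
    then show ?case unfolding BS using g[OF T2[OF Suc, of "e n"]] e[of n] BG by blast
  qed
  have sub: "B (Suc n) \<in> \<B>" "B (Suc n) \<subseteq> B n" "B (Suc n) \<subseteq> e n" for n
    unfolding BS using g[OF T2[OF BGn, of "e n" n]] e[of n] BG by blast+
  have dec: "B n \<subseteq> B m" if "m \<le> n" for m n
    by (rule lift_Suc_antimono_le[OF _ that]) (rule sub(2))
  have base: "\<exists>n. B n \<subseteq> K" if "K \<in> \<G>" for K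
  proof -
    obtain J where J: "J \<in> \<B>" "J \<subseteq> K" using ex[OF \<open>K \<in> \<G>\<close>] by blast
    then obtain n where "e n = J" using surj by blast
    then show ?thesis using sub(3)[of n] J(2) by blast
  qed
  have fg: "fg_right_ideal (B n) R" for n
  proof (cases n)
    case 0
    have cR: "right_ideal (carrier R) R" by (rule right_idealI) auto
    have "carrier R \<subseteq> gen_right_ideal R {\<one>}"
    proof
      fix x assume x: "x \<in> carrier R"
      have "x \<in> I" if "right_ideal I R" "\<one> \<in> I" for I
        using right_ideal_mult[OF that x] x by simp
      then show "x \<in> gen_right_ideal R {\<one>}" by (simp add: gen_right_ideal_def)
    qed
    moreover have "gen_right_ideal R {\<one>} \<subseteq> carrier R" using cR by (auto simp: gen_right_ideal_def)
    ultimately have "carrier R = gen_right_ideal R {\<one>}" by blast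
    then show ?thesis using 0 B0 cR unfolding fg_right_ideal_def by (metis finite.emptyI finite_insert empty_subsetI insert_subset one_closed)
  next
    case (Suc k)
    then show ?thesis using assms(3)[OF sub(1)] by simp
  qed
  show thesis by (rule that[OF B0 BGn dec base fg])
qed

lemma fg_dense_completion:
  fixes B :: "nat \<Rightarrow> 'a set"
  assumes B0: "B 0 = carrier R" and B: "\<And>n. B n \<in> \<G>" and dec: "\<And>m n. m \<le> n \<Longrightarrow> B n \<subseteq> B m"
    and base: "\<And>K. K \<in> \<G> \<Longrightarrow> \<exists>n. B n \<subseteq> K" and fg: "\<And>n. fg_right_ideal (B n) R"
  shows "fg_dense \<RR> \<TT> R \<rho> (\<lambda>n. \<NN> (B n))"
proof (rule fg_dense.intro[OF linear_top_ring_completion ring_axioms], rule fg_dense_axioms.intro)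
  show "\<rho> \<in> ring_hom R \<RR>" by (rule rho_hom)
  show "open_right_ideal (\<NN> (B n)) \<RR> \<TT>" for n by (rule completion_ideal_open[OF B])
  show "\<NN> (B n) \<subseteq> \<NN> (B m)" if "m \<le> n" for m n by (rule completion_ideal_mono[OF B B dec[OF that]])
  show "\<exists>n. \<NN> (B n) \<subseteq> K" if "open_right_ideal K \<RR> \<TT>" for K
  proof -
    obtain I where I: "I \<in> \<G>" "\<NN> I \<subseteq> K" using \<open>open_right_ideal K \<RR> \<TT>\<close> unfolding open_right_ideal_iff by blast
    obtain n where "B n \<subseteq> I" using base[OF I(1)] by blast
    then show ?thesis using completion_ideal_mono[OF B I(1)] I(2) by blast
  qed
  show "\<exists>r\<in>carrier R. x \<ominus>\<^bsub>\<RR>\<^esub> \<rho> r \<in> \<NN> (B n)" if x: "x \<in> carrier \<RR>" for x n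
  proof -
    obtain r where r: "r \<in> x (B n)" using approx_exists[OF x B] .
    show ?thesis using rho_approximates[OF x B r] approx(1)[OF x B r] by blast
  qed
  fix n
  obtain A where A: "finite A" "A \<subseteq> carrier R" and An: "B n = gen_right_ideal R A"
    using fg[of n] by (auto simp: fg_right_ideal_def)
  have sp: "B n = right_span A (carrier R)" unfolding An by (rule gen_right_ideal_span[OF A])
  have gen: "right_span A (carrier R) \<in> \<G>" using B[of n] sp by simp
  have "A \<subseteq> B n" unfolding An gen_right_ideal_def by blast
  then have "\<rho> ` A \<subseteq> \<NN> (B n)" using rho_completion_ideal[OF _ B] A(2) by blast
  moreover have "open_right_ideal (\<NN> (right_span A (B k))) \<RR> \<TT>" for k
    by (rule completion_ideal_open[OF right_span_G[OF A gen B]])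
  moreover have "\<exists>t\<in>A \<rightarrow> carrier \<RR>. s = finsum \<RR> (\<lambda>a. \<rho> a \<otimes>\<^bsub>\<RR>\<^esub> t a) A \<and>
      (\<forall>k. s \<in> \<NN> (right_span A (B k)) \<longrightarrow> (\<forall>a\<in>A. t a \<in> \<NN> (B k)))" if "s \<in> \<NN> (B n)" for s
    by (rule completion_fg_lift[OF B dec base B0 A gen]) (use that sp in simp_all)
  ultimately show "\<exists>A L. finite A \<and> A \<subseteq> carrier R \<and> \<rho> ` A \<subseteq> \<NN> (B n) \<and>
      (\<forall>k::nat. open_right_ideal (L k) \<RR> \<TT>) \<and>
      (\<forall>s\<in>\<NN> (B n). \<exists>t\<in>A \<rightarrow> carrier \<RR>. s = finsum \<RR> (\<lambda>a. \<rho> a \<otimes>\<^bsub>\<RR>\<^esub> t a) A \<and>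
        (\<forall>k. s \<in> L k \<longrightarrow> (\<forall>a\<in>A. t a \<in> \<NN> (B k))))"
    using A by (intro exI[of _ A] exI[of _ "\<lambda>k. \<NN> (right_span A (B k))"]) blast
qed

end

section \<open>Tensor products and the contratensor product\<close>

definition balanced_map ::
    "('r, 'k) ring_scheme \<Rightarrow> ('r, 'n, 'i) module_scheme \<Rightarrow> ('r, 'm, 'j) module_scheme
      \<Rightarrow> ('g, 'l) monoid_scheme \<Rightarrow> ('n \<Rightarrow> 'm \<Rightarrow> 'g) \<Rightarrow> bool" where
  "balanced_map A N M G \<phi> \<longleftrightarrow>
     (\<forall>x\<in>carrier N. \<forall>y\<in>carrier M. \<phi> x y \<in> carrier G) \<and>
     (\<forall>x\<in>carrier N. \<forall>x'\<in>carrier N. \<forall>y\<in>carrier M. \<phi> (x \<oplus>\<^bsub>N\<^esub> x') y = \<phi> x y \<otimes>\<^bsub>G\<^esub> \<phi> x' y) \<and>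
     (\<forall>x\<in>carrier N. \<forall>y\<in>carrier M. \<forall>y'\<in>carrier M. \<phi> x (y \<oplus>\<^bsub>M\<^esub> y') = \<phi> x y \<otimes>\<^bsub>G\<^esub> \<phi> x y') \<and>
     (\<forall>a\<in>carrier A. \<forall>x\<in>carrier N. \<forall>y\<in>carrier M. \<phi> (a \<odot>\<^bsub>N\<^esub> x) y = \<phi> x (a \<odot>\<^bsub>M\<^esub> y))"

lemma balanced_mapD:
  assumes "balanced_map A N M G \<phi>"
  shows "\<And>x y. \<lbrakk>x \<in> carrier N; y \<in> carrier M\<rbrakk> \<Longrightarrow> \<phi> x y \<in> carrier G"
    "\<And>x x' y. \<lbrakk>x \<in> carrier N; x' \<in> carrier N; y \<in> carrier M\<rbrakk> \<Longrightarrow> \<phi> (x \<oplus>\<^bsub>N\<^esub> x') y = \<phi> x y \<otimes>\<^bsub>G\<^esub> \<phi> x' y"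
    "\<And>x y y'. \<lbrakk>x \<in> carrier N; y \<in> carrier M; y' \<in> carrier M\<rbrakk> \<Longrightarrow> \<phi> x (y \<oplus>\<^bsub>M\<^esub> y') = \<phi> x y \<otimes>\<^bsub>G\<^esub> \<phi> x y'"
    "\<And>a x y. \<lbrakk>a \<in> carrier A; x \<in> carrier N; y \<in> carrier M\<rbrakk> \<Longrightarrow> \<phi> (a \<odot>\<^bsub>N\<^esub> x) y = \<phi> x (a \<odot>\<^bsub>M\<^esub> y)"
  using assms by (auto simp: balanced_map_def)

lemma balanced_mapI:
  assumes "\<And>x y. \<lbrakk>x \<in> carrier N; y \<in> carrier M\<rbrakk> \<Longrightarrow> \<phi> x y \<in> carrier G"
    "\<And>x x' y. \<lbrakk>x \<in> carrier N; x' \<in> carrier N; y \<in> carrier M\<rbrakk> \<Longrightarrow> \<phi> (x \<oplus>\<^bsub>N\<^esub> x') y = \<phi> x y \<otimes>\<^bsub>G\<^esub> \<phi> x' y"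
    "\<And>x y y'. \<lbrakk>x \<in> carrier N; y \<in> carrier M; y' \<in> carrier M\<rbrakk> \<Longrightarrow> \<phi> x (y \<oplus>\<^bsub>M\<^esub> y') = \<phi> x y \<otimes>\<^bsub>G\<^esub> \<phi> x y'"
    "\<And>a x y. \<lbrakk>a \<in> carrier A; x \<in> carrier N; y \<in> carrier M\<rbrakk> \<Longrightarrow> \<phi> (a \<odot>\<^bsub>N\<^esub> x) y = \<phi> x (a \<odot>\<^bsub>M\<^esub> y)"
  shows "balanced_map A N M G \<phi>"
  using assms unfolding balanced_map_def by simp

lemma tensor_relationsE:
  assumes "u \<in> tensor_relations A N M"
  obtains (add_left) x x' y where "u = frag_of (x \<oplus>\<^bsub>N\<^esub> x', y) - frag_of (x, y) - frag_of (x', y)"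
      "x \<in> carrier N" "x' \<in> carrier N" "y \<in> carrier M"
    | (add_right) x y y' where "u = frag_of (x, y \<oplus>\<^bsub>M\<^esub> y') - frag_of (x, y) - frag_of (x, y')"
      "x \<in> carrier N" "y \<in> carrier M" "y' \<in> carrier M"
    | (balanced) a x y where "u = frag_of (a \<odot>\<^bsub>N\<^esub> x, y) - frag_of (x, a \<odot>\<^bsub>M\<^esub> y)"
      "a \<in> carrier A" "x \<in> carrier N" "y \<in> carrier M"
  using assms unfolding tensor_relations_def
  by (elim UnE CollectE exE conjE) (erule add_left add_right balanced; assumption)+

locale tensor_data = N: abelian_group N + M: abelian_group M
  for A :: "('r, 'k) ring_scheme" and N :: "('r, 'n, 'i) module_scheme" and M :: "('r, 'm, 'j) module_scheme" +
  assumes N_smult: "\<lbrakk>a \<in> carrier A; x \<in> carrier N\<rbrakk> \<Longrightarrow> a \<odot>\<^bsub>N\<^esub> x \<in> carrier N"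
    and M_smult: "\<lbrakk>a \<in> carrier A; y \<in> carrier M\<rbrakk> \<Longrightarrow> a \<odot>\<^bsub>M\<^esub> y \<in> carrier M"
begin

abbreviation Fr where "Fr \<equiv> free_Abelian_group (carrier N \<times> carrier M)"
abbreviation Ker where "Ker \<equiv> tensor_kernel A N M"
abbreviation Te where "Te \<equiv> tensor A N M"
abbreviation pt where "pt \<equiv> pure_tensor A N M"

lemma comm_group_Fr: "comm_group Fr"
  by (rule abelian_free_Abelian_group)

lemma frag_pair_closed: "\<lbrakk>x \<in> carrier N; y \<in> carrier M\<rbrakk> \<Longrightarrow> frag_of (x, y) \<in> carrier Fr"
  by simp

lemma Fr_diff_closed: "\<lbrakk>a \<in> carrier Fr; b \<in> carrier Fr\<rbrakk> \<Longrightarrow> a - b \<in> carrier Fr"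
  unfolding carrier_free_Abelian_group_iff using keys_diff[of a b] by blast

lemma Fr_diff: "\<lbrakk>a \<in> carrier Fr; b \<in> carrier Fr\<rbrakk> \<Longrightarrow> a \<otimes>\<^bsub>Fr\<^esub> inv\<^bsub>Fr\<^esub> b = a - b"
  by simp

lemma relations_closed: "tensor_relations A N M \<subseteq> carrier Fr"
proof
  fix u assume u: "u \<in> tensor_relations A N M"
  from u show "u \<in> carrier Fr"
  proof (cases rule: tensor_relationsE)
    case (add_left x x' y)
    show ?thesis unfolding add_left(1) by (intro Fr_diff_closed frag_pair_closed N.a_closed add_left(2-4))
  next
    case (add_right x y y')
    show ?thesis unfolding add_right(1) by (intro Fr_diff_closed frag_pair_closed M.a_closed add_right(2-4))
  next
    case (balanced a x y)
    show ?thesis unfolding balanced(1) by (intro Fr_diff_closed frag_pair_closed N_smult M_smult balanced(2-4))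
  qed
qed

lemma subgroup_Ker: "subgroup Ker Fr"
proof -
  interpret F: comm_group Fr by (rule comm_group_Fr)
  show ?thesis unfolding tensor_kernel_def by (rule F.generate_is_subgroup[OF relations_closed])
qed

lemma normal_Ker: "Ker \<lhd> Fr"
  by (rule comm_group.subgroup_imp_normal[OF comm_group_Fr subgroup_Ker])

lemma comm_group_tensor: "comm_group Te"
  unfolding tensor_def by (rule comm_group.abelian_FactGroup[OF comm_group_Fr subgroup_Ker])

lemma proj_hom: "(\<lambda>u. Ker #>\<^bsub>Fr\<^esub> u) \<in> hom Fr Te"
  unfolding tensor_def by (rule normal.r_coset_hom_Mod[OF normal_Ker])

lemma tensor_carrier: "carrier Te = (\<lambda>u. Ker #>\<^bsub>Fr\<^esub> u) ` carrier Fr"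
  unfolding tensor_def carrier_FactGroup by simp

lemma pure_closed: "\<lbrakk>x \<in> carrier N; y \<in> carrier M\<rbrakk> \<Longrightarrow> pt x y \<in> carrier Te"
  unfolding tensor_carrier pure_tensor_def by (rule imageI) (rule frag_pair_closed)

lemma proj_relation:
  assumes "u - v \<in> Ker" "u \<in> carrier Fr" "v \<in> carrier Fr"
  shows "Ker #>\<^bsub>Fr\<^esub> u = Ker #>\<^bsub>Fr\<^esub> v"
proof -
  interpret F: comm_group Fr by (rule comm_group_Fr)
  have "u = (u - v) \<otimes>\<^bsub>Fr\<^esub> v" by simp
  then have "u \<in> Ker #>\<^bsub>Fr\<^esub> v" using assms(1) unfolding r_coset_def by blast
  then show ?thesis using F.repr_independence[OF _ assms(3) subgroup_Ker] by simp
qed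

lemma pure_balanced: "balanced_map A N M Te pt"
proof (rule balanced_mapI)
  interpret F: comm_group Fr by (rule comm_group_Fr)
  have mult: "Ker #>\<^bsub>Fr\<^esub> (u + v) = (Ker #>\<^bsub>Fr\<^esub> u) \<otimes>\<^bsub>Te\<^esub> (Ker #>\<^bsub>Fr\<^esub> v)"
    if "u \<in> carrier Fr" "v \<in> carrier Fr" for u v
    using hom_mult[OF proj_hom that] by simp
  have plus: "u + v \<in> carrier Fr" if "u \<in> carrier Fr" "v \<in> carrier Fr" for u v
    using F.m_closed[OF that] by simp
  have rel: "u \<in> Ker" if "u \<in> tensor_relations A N M" for u
    unfolding tensor_kernel_def using that by (rule generate.incl)
  show "pt x y \<in> carrier Te" if "x \<in> carrier N" "y \<in> carrier M" for x y by (rule pure_closed[OF that])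
  show "pt (x \<oplus>\<^bsub>N\<^esub> x') y = pt x y \<otimes>\<^bsub>Te\<^esub> pt x' y"
    if "x \<in> carrier N" "x' \<in> carrier N" "y \<in> carrier M" for x x' y
  proof -
    have "frag_of (x \<oplus>\<^bsub>N\<^esub> x', y) - (frag_of (x, y) + frag_of (x', y)) \<in> tensor_relations A N M"
      unfolding tensor_relations_def diff_diff_add[symmetric] using that by blast
    then have "Ker #>\<^bsub>Fr\<^esub> frag_of (x \<oplus>\<^bsub>N\<^esub> x', y) = Ker #>\<^bsub>Fr\<^esub> (frag_of (x, y) + frag_of (x', y))"
      by (intro proj_relation rel plus frag_pair_closed N.a_closed that)
    then show ?thesis
      unfolding pure_tensor_def using mult[OF frag_pair_closed frag_pair_closed] that by simp
  qed
  show "pt x (y \<oplus>\<^bsub>M\<^esub> y') = pt x y \<otimes>\<^bsub>Te\<^esub> pt x y'"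
    if "x \<in> carrier N" "y \<in> carrier M" "y' \<in> carrier M" for x y y'
  proof -
    have "frag_of (x, y \<oplus>\<^bsub>M\<^esub> y') - (frag_of (x, y) + frag_of (x, y')) \<in> tensor_relations A N M"
      unfolding tensor_relations_def diff_diff_add[symmetric] using that by blast
    then have "Ker #>\<^bsub>Fr\<^esub> frag_of (x, y \<oplus>\<^bsub>M\<^esub> y') = Ker #>\<^bsub>Fr\<^esub> (frag_of (x, y) + frag_of (x, y'))"
      by (intro proj_relation rel plus frag_pair_closed M.a_closed that)
    then show ?thesis
      unfolding pure_tensor_def using mult[OF frag_pair_closed frag_pair_closed] that by simp
  qed
  show "pt (a \<odot>\<^bsub>N\<^esub> x) y = pt x (a \<odot>\<^bsub>M\<^esub> y)"
    if "a \<in> carrier A" "x \<in> carrier N" "y \<in> carrier M" for a x y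
  proof -
    have "frag_of (a \<odot>\<^bsub>N\<^esub> x, y) - frag_of (x, a \<odot>\<^bsub>M\<^esub> y) \<in> tensor_relations A N M"
      unfolding tensor_relations_def using that by blast
    then show ?thesis
      unfolding pure_tensor_def by (intro proj_relation rel frag_pair_closed N_smult M_smult that)
  qed
qed

lemma tensor_hom_eq:
  assumes G: "group G" and h: "h \<in> hom Te G" and k: "k \<in> hom Te G"
    and eq: "\<And>x y. \<lbrakk>x \<in> carrier N; y \<in> carrier M\<rbrakk> \<Longrightarrow> h (pt x y) = k (pt x y)"
    and t: "t \<in> carrier Te"
  shows "h t = k t"
proof -
  interpret F: comm_group Fr by (rule comm_group_Fr)
  interpret G: group G by (rule G)
  let ?h = "\<lambda>u. h (Ker #>\<^bsub>Fr\<^esub> u)" and ?k = "\<lambda>u. k (Ker #>\<^bsub>Fr\<^esub> u)"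
  have hh: "?h \<in> hom Fr G" and kh: "?k \<in> hom Fr G"
    using hom_compose[OF proj_hom h] hom_compose[OF proj_hom k] by (simp_all add: comp_def)
  interpret H: group_hom Fr G ?h by (intro group_hom.intro group_hom_axioms.intro hh G) simp
  interpret K: group_hom Fr G ?k by (intro group_hom.intro group_hom_axioms.intro kh G) simp
  have "?h u = ?k u" if "u \<in> carrier Fr" for u
  proof (rule free_Abelian_group_induct[of u "carrier N \<times> carrier M"])
    show "Poly_Mapping.keys u \<subseteq> carrier N \<times> carrier M" using that by simp
    show "?h 0 = ?k 0" using H.hom_one K.hom_one by simp
    show "?h (frag_of p) = ?k (frag_of p)" if "p \<in> carrier N \<times> carrier M" for p
      using that eq unfolding pure_tensor_def by auto
    fix a b :: "'n \<times> 'm \<Rightarrow>\<^sub>0 int"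
    assume ab: "Poly_Mapping.keys a \<subseteq> carrier N \<times> carrier M" "Poly_Mapping.keys b \<subseteq> carrier N \<times> carrier M"
      "?h a = ?k a" "?h b = ?k b"
    then have c: "a \<in> carrier Fr" "b \<in> carrier Fr" by auto
    have "?h (a - b) = ?h a \<otimes>\<^bsub>G\<^esub> inv\<^bsub>G\<^esub> ?h b"
      using H.hom_mult[OF c(1) F.inv_closed[OF c(2)]] H.hom_inv[OF c(2)] Fr_diff[OF c] by simp
    moreover have "?k (a - b) = ?k a \<otimes>\<^bsub>G\<^esub> inv\<^bsub>G\<^esub> ?k b"
      using K.hom_mult[OF c(1) F.inv_closed[OF c(2)]] K.hom_inv[OF c(2)] Fr_diff[OF c] by simp
    ultimately show "?h (a - b) = ?k (a - b)" using ab by simp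
  qed
  then show ?thesis using t unfolding tensor_carrier by blast
qed

lemma tensor_lift_exists:
  assumes G: "comm_group G" and \<phi>: "balanced_map A N M G \<phi>"
  shows "\<exists>h\<in>hom Te G. \<forall>x\<in>carrier N. \<forall>y\<in>carrier M. h (pt x y) = \<phi> x y"
proof -
  interpret F: comm_group Fr by (rule comm_group_Fr)
  interpret G: comm_group G by (rule G)
  note \<phi> = balanced_mapD[OF \<phi>]
  have "(\<lambda>(x, y). \<phi> x y) ` (carrier N \<times> carrier M) \<subseteq> carrier G" using \<phi>(1) by auto
  then obtain h where h: "h \<in> hom Fr G"
    and h_frag: "\<And>p. p \<in> carrier N \<times> carrier M \<Longrightarrow> h (frag_of p) = (\<lambda>(x, y). \<phi> x y) p"
    using G.free_Abelian_group_universal by metis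
  interpret H: group_hom Fr G h by (intro group_hom.intro group_hom_axioms.intro h G.group_axioms) simp
  have hf: "h (frag_of (x, y)) = \<phi> x y" if "x \<in> carrier N" "y \<in> carrier M" for x y
    using h_frag[of "(x, y)"] that by simp
  have diff: "h (u - v) = h u \<otimes>\<^bsub>G\<^esub> inv\<^bsub>G\<^esub> h v" if "u \<in> carrier Fr" "v \<in> carrier Fr" for u v
    using H.hom_mult[OF that(1) F.inv_closed[OF that(2)]] H.hom_inv[OF that(2)] Fr_diff[OF that] by simp
  have "tensor_relations A N M \<subseteq> kernel Fr G h"
  proof
    fix u assume u: "u \<in> tensor_relations A N M"
    from u have "h u = \<one>\<^bsub>G\<^esub>"
    proof (cases rule: tensor_relationsE)
      case (add_left x x' y)
      have "h u = \<phi> (x \<oplus>\<^bsub>N\<^esub> x') y \<otimes>\<^bsub>G\<^esub> inv\<^bsub>G\<^esub> \<phi> x y \<otimes>\<^bsub>G\<^esub> inv\<^bsub>G\<^esub> \<phi> x' y"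
        unfolding add_left(1) using add_left(2-4)
        by (simp only: diff hf Fr_diff_closed frag_pair_closed N.a_closed)
      then show ?thesis using add_left(2-4) \<phi>(1)
        by (simp add: \<phi>(2) G.m_ac G.r_inv)
    next
      case (add_right x y y')
      have "h u = \<phi> x (y \<oplus>\<^bsub>M\<^esub> y') \<otimes>\<^bsub>G\<^esub> inv\<^bsub>G\<^esub> \<phi> x y \<otimes>\<^bsub>G\<^esub> inv\<^bsub>G\<^esub> \<phi> x y'"
        unfolding add_right(1) using add_right(2-4)
        by (simp only: diff hf Fr_diff_closed frag_pair_closed M.a_closed)
      then show ?thesis using add_right(2-4) \<phi>(1)
        by (simp add: \<phi>(3) G.m_ac G.r_inv)
    next
      case (balanced a x y)
      have "h u = \<phi> (a \<odot>\<^bsub>N\<^esub> x) y \<otimes>\<^bsub>G\<^esub> inv\<^bsub>G\<^esub> \<phi> x (a \<odot>\<^bsub>M\<^esub> y)"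
        unfolding balanced(1) using balanced(2-4)
        by (simp only: diff hf frag_pair_closed N_smult M_smult)
      then show ?thesis using balanced(2-4) \<phi>(1)[OF balanced(3) M_smult[OF balanced(2,4)]] by (simp add: \<phi>(4))
    qed
    then show "u \<in> kernel Fr G h" using u relations_closed unfolding kernel_def by blast
  qed
  then have "Ker \<subseteq> kernel Fr G h"
    unfolding tensor_kernel_def by (rule F.generate_subgroup_incl[OF _ H.subgroup_kernel])
  then obtain g where g: "g \<in> hom (Fr Mod Ker) G" "\<And>u. u \<in> carrier Fr \<Longrightarrow> g (Ker #>\<^bsub>Fr\<^esub> u) = h u"
    using H.FactGroup_universal_kernel[OF normal_Ker] by metis
  show ?thesis
    unfolding tensor_def using g(1)
  proof (rule bexI[rotated], intro ballI)
    fix x y assume "x \<in> carrier N" "y \<in> carrier M"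
    then show "g (pt x y) = \<phi> x y" unfolding pure_tensor_def using g(2)[OF frag_pair_closed] hf by simp
  qed
qed

lemma tensor_lift:
  assumes G: "comm_group G" and \<phi>: "balanced_map A N M G \<phi>"
  shows "tensor_lift A N M G \<phi> \<in> hom Te G"
    and "\<lbrakk>x \<in> carrier N; y \<in> carrier M\<rbrakk> \<Longrightarrow> tensor_lift A N M G \<phi> (pt x y) = \<phi> x y"
proof -
  interpret G: comm_group G by (rule G)
  let ?P = "\<lambda>h. h \<in> hom Te G \<and> h \<in> extensional (carrier Te) \<and>
    (\<forall>x\<in>carrier N. \<forall>y\<in>carrier M. h (pt x y) = \<phi> x y)"
  obtain h where h: "h \<in> hom Te G" "\<And>x y. \<lbrakk>x \<in> carrier N; y \<in> carrier M\<rbrakk> \<Longrightarrow> h (pt x y) = \<phi> x y"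
    using tensor_lift_exists[OF assms] by blast
  have rh: "restrict h (carrier Te) \<in> hom Te G"
    using h(1) group.is_monoid[OF comm_group.axioms(2)[OF comm_group_tensor]]
    by (auto simp: hom_def monoid.m_closed)
  have ex: "?P (restrict h (carrier Te))" using rh h(2) pure_closed by simp
  have uniq: "k = restrict h (carrier Te)" if k: "?P k" for k
  proof (rule extensionalityI[of _ "carrier Te"])
    fix t assume t: "t \<in> carrier Te"
    show "k t = restrict h (carrier Te) t"
      by (rule tensor_hom_eq[OF G.group_axioms _ rh _ t]) (use k h(2) pure_closed in auto)
  qed (use k in auto)
  have "?P (tensor_lift A N M G \<phi>)"
    unfolding tensor_lift_def by (rule theI[of ?P, OF ex uniq])
  then show "tensor_lift A N M G \<phi> \<in> hom Te G"
    and "\<lbrakk>x \<in> carrier N; y \<in> carrier M\<rbrakk> \<Longrightarrow> tensor_lift A N M G \<phi> (pt x y) = \<phi> x y"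
    by blast+
qed

end

lemma int_module_simps [simp]:
  "carrier (int_module M) = carrier M" "add (int_module M) = add M" "zero (int_module M) = zero M"
  "k \<odot>\<^bsub>int_module M\<^esub> x = [k] \<cdot>\<^bsub>M\<^esub> x"
  by (simp_all add: int_module_def)

lemma abelian_group_same_add:
  assumes "abelian_group M" "carrier N = carrier M" "add N = add M" "zero N = zero M"
  shows "abelian_group N"
proof -
  interpret M: abelian_group M by fact
  show ?thesis by (rule abelian_groupI) (auto simp: assms M.a_assoc intro: M.a_comm M.l_neg)
qed

lemma tensor_data_int:
  assumes N: "abelian_group N" and M: "abelian_group M"
  shows "tensor_data \<Z> (int_module N) (int_module M)"
proof (rule tensor_data.intro[OF _ _ tensor_data_axioms.intro])
  interpret N: abelian_group N by fact
  interpret M: abelian_group M by fact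
  show "abelian_group (int_module N)" by (rule abelian_group_same_add[OF N]) simp_all
  show "abelian_group (int_module M)" by (rule abelian_group_same_add[OF M]) simp_all
  show "k \<odot>\<^bsub>int_module N\<^esub> x \<in> carrier (int_module N)" if "x \<in> carrier (int_module N)" for k x
    using that by (simp add: N.add.int_pow_closed)
  show "k \<odot>\<^bsub>int_module M\<^esub> x \<in> carrier (int_module M)" if "x \<in> carrier (int_module M)" for k x
    using that by (simp add: M.add.int_pow_closed)
qed

text \<open>Additive maps commute with integer multiples.\<close>

lemma int_balanced_mapI:
  assumes N: "abelian_group N" and M: "abelian_group M" and G: "comm_group G"
    and c: "\<And>x y. \<lbrakk>x \<in> carrier N; y \<in> carrier M\<rbrakk> \<Longrightarrow> \<phi> x y \<in> carrier G"
    and l: "\<And>x x' y. \<lbrakk>x \<in> carrier N; x' \<in> carrier N; y \<in> carrier M\<rbrakk> \<Longrightarrow> \<phi> (x \<oplus>\<^bsub>N\<^esub> x') y = \<phi> x y \<otimes>\<^bsub>G\<^esub> \<phi> x' y"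
    and r: "\<And>x y y'. \<lbrakk>x \<in> carrier N; y \<in> carrier M; y' \<in> carrier M\<rbrakk> \<Longrightarrow> \<phi> x (y \<oplus>\<^bsub>M\<^esub> y') = \<phi> x y \<otimes>\<^bsub>G\<^esub> \<phi> x y'"
  shows "balanced_map \<Z> (int_module N) (int_module M) G \<phi>"
proof (rule balanced_mapI)
  interpret N: abelian_group N by fact
  interpret M: abelian_group M by fact
  interpret G: comm_group G by fact
  fix k x y assume x: "x \<in> carrier (int_module N)" and y: "y \<in> carrier (int_module M)"
  have 1: "(\<lambda>x. \<phi> x y) \<in> hom (add_monoid N) G" using c l y by (auto simp: hom_def)
  have 2: "(\<lambda>y. \<phi> x y) \<in> hom (add_monoid M) G" using c r x by (auto simp: hom_def)
  have "\<phi> ([k] \<cdot>\<^bsub>N\<^esub> x) y = \<phi> x y [^]\<^bsub>G\<^esub> (k::int)"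
    using hom_int_pow[OF 1 _ N.a_group G.group_axioms, of x k] x by (simp add: add_pow_def)
  moreover have "\<phi> x ([k] \<cdot>\<^bsub>M\<^esub> y) = \<phi> x y [^]\<^bsub>G\<^esub> (k::int)"
    using hom_int_pow[OF 2 _ M.a_group G.group_axioms, of y k] y by (simp add: add_pow_def)
  ultimately show "\<phi> (k \<odot>\<^bsub>int_module N\<^esub> x) y = \<phi> x (k \<odot>\<^bsub>int_module M\<^esub> y)" by simp
qed (use c l r in auto)

lemma additive_zero:
  assumes N: "abelian_group N" and G: "group G"
    and c: "\<And>x. x \<in> carrier N \<Longrightarrow> f x \<in> carrier G"
    and a: "\<And>x x'. \<lbrakk>x \<in> carrier N; x' \<in> carrier N\<rbrakk> \<Longrightarrow> f (x \<oplus>\<^bsub>N\<^esub> x') = f x \<otimes>\<^bsub>G\<^esub> f x'"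
  shows "f \<zero>\<^bsub>N\<^esub> = \<one>\<^bsub>G\<^esub>"
proof -
  interpret N: abelian_group N by fact
  interpret G: group G by fact
  have "f \<zero>\<^bsub>N\<^esub> \<otimes>\<^bsub>G\<^esub> f \<zero>\<^bsub>N\<^esub> = f \<zero>\<^bsub>N\<^esub>" using a[of "\<zero>\<^bsub>N\<^esub>" "\<zero>\<^bsub>N\<^esub>"] by simp
  then show ?thesis using c[OF N.zero_closed] G.l_cancel_one by simp
qed

lemma additive_finsum:
  assumes N: "abelian_group N" and G: "comm_group G"
    and c: "\<And>x. x \<in> carrier N \<Longrightarrow> f x \<in> carrier G"
    and a: "\<And>x x'. \<lbrakk>x \<in> carrier N; x' \<in> carrier N\<rbrakk> \<Longrightarrow> f (x \<oplus>\<^bsub>N\<^esub> x') = f x \<otimes>\<^bsub>G\<^esub> f x'"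
    and F: "finite F" "\<And>i. i \<in> F \<Longrightarrow> g i \<in> carrier N"
  shows "f (finsum N g F) = finprod G (\<lambda>i. f (g i)) F"
  using F
proof (induction F)
  interpret N: abelian_group N by fact
  interpret G: comm_group G by fact
  case empty
  show ?case using additive_zero[OF N G.group_axioms c a] by simp
next
  interpret N: abelian_group N by fact
  interpret G: comm_group G by fact
  case (insert i F)
  have gc: "g \<in> F \<rightarrow> carrier N" "g i \<in> carrier N" using insert.prems by auto
  have "f (finsum N g (insert i F)) = f (g i) \<otimes>\<^bsub>G\<^esub> f (finsum N g F)"
    using insert.hyps gc a[OF gc(2) N.finsum_closed[OF gc(1)]] by (simp add: N.finsum_insert)
  also have "\<dots> = finprod G (\<lambda>i. f (g i)) (insert i F)"
    using insert c by (subst G.finprod_insert) auto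
  finally show ?case .
qed

lemma (in linear_top_ring) abelian_group_formal_module: "abelian_group (formal_module S T X)"
  by (rule left_module.axioms(2)[OF left_module_formal_module])

locale discrete_contratensor = fg_contramodule S T R \<rho> J C
  for S :: "('s, 'k) ring_scheme" (structure) and T
    and R :: "('r, 'l) ring_scheme" and \<rho> :: "'r \<Rightarrow> 's" and J :: "nat \<Rightarrow> 's set"
    and C :: "('s, 'c, 'i) contramodule_scheme" +
  fixes N :: "('s, 'n, 'j) module_scheme"
  assumes discrete: "discrete_right_module S T N"
begin

abbreviation "TZ \<equiv> contra_int_tensor S N C"
abbreviation "pz \<equiv> contra_int_pure S N C"
abbreviation "FM \<equiv> formal_module S T (carrier C)"
abbreviation "TF \<equiv> formal_int_tensor S T N C"
abbreviation "pf \<equiv> pure_tensor \<Z> (int_module N) (int_module FM)"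
abbreviation "TR \<equiv> tensor R (restr N) (restr CM)"
abbreviation "pr \<equiv> pure_tensor R (restr N) (restr CM)"
abbreviation "Q \<equiv> contratensor S T N C"
abbreviation "pq \<equiv> pure_contratensor S T N C"
abbreviation "Act \<equiv> contratensor_act S T N C"
abbreviation "Ev \<equiv> contratensor_eval S T N C"

lemma right_module_N: "right_module S N"
  using discrete by (simp add: discrete_right_module_def)

lemma N_ann_open: "b \<in> carrier N \<Longrightarrow> oi {r \<in> carrier S. r \<odot>\<^bsub>N\<^esub> b = \<zero>\<^bsub>N\<^esub>}"
  using discrete by (simp add: discrete_right_module_def)

lemma abelian_group_N: "abelian_group N"
  by (rule right_module.axioms(2)[OF right_module_N])

lemmas N_smult_closed = right_module.smult_closed[OF right_module_N]
  and N_smult_l_distr = right_module.smult_l_distr[OF right_module_N]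
  and N_smult_r_distr = right_module.smult_r_distr[OF right_module_N]

lemma N_zero_smult: "b \<in> carrier N \<Longrightarrow> \<zero> \<odot>\<^bsub>N\<^esub> b = \<zero>\<^bsub>N\<^esub>"
  using oi_zero[OF N_ann_open] by simp

lemma N_smult_cong:
  assumes b: "b \<in> carrier N" and rs: "r \<in> carrier S" "s \<in> carrier S" and 0: "(r \<ominus> s) \<odot>\<^bsub>N\<^esub> b = \<zero>\<^bsub>N\<^esub>"
  shows "r \<odot>\<^bsub>N\<^esub> b = s \<odot>\<^bsub>N\<^esub> b"
proof -
  interpret N: abelian_group N by (rule abelian_group_N)
  have "(s \<oplus> (r \<ominus> s)) \<odot>\<^bsub>N\<^esub> b = s \<odot>\<^bsub>N\<^esub> b \<oplus>\<^bsub>N\<^esub> (r \<ominus> s) \<odot>\<^bsub>N\<^esub> b"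
    by (rule N_smult_l_distr) (use b rs in auto)
  then show ?thesis using 0 add_diff_cancel[OF rs(2,1)] N_smult_closed[OF rs(2) b] by simp
qed

lemma tensor_data_TZ: "tensor_data \<Z> (int_module N) (int_module CM)"
  by (rule tensor_data_int[OF abelian_group_N abelian_group_CM])

lemma tensor_data_TF: "tensor_data \<Z> (int_module N) (int_module FM)"
  by (rule tensor_data_int[OF abelian_group_N abelian_group_formal_module])

lemma tensor_data_TR: "tensor_data R (restr N) (restr CM)"
proof (rule tensor_data.intro[OF abelian_group_restr[OF abelian_group_N]
      abelian_group_restr[OF abelian_group_CM]], rule tensor_data_axioms.intro)
  show "a \<odot>\<^bsub>restr N\<^esub> x \<in> carrier (restr N)" if "a \<in> carrier R" "x \<in> carrier (restr N)" for a x
    using N_smult_closed[OF rho_closed[OF that(1)], of x] that by simp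
  show "a \<odot>\<^bsub>restr CM\<^esub> x \<in> carrier (restr CM)" if "a \<in> carrier R" "x \<in> carrier (restr CM)" for a x
    using left_module.smult_closed[OF left_module_restr_CM that] .
qed

lemmas comm_group_TZ = tensor_data.comm_group_tensor[OF tensor_data_TZ]
  and comm_group_TF = tensor_data.comm_group_tensor[OF tensor_data_TF]
  and comm_group_TR = tensor_data.comm_group_tensor[OF tensor_data_TR]

lemmas pz = balanced_mapD[OF tensor_data.pure_balanced[OF tensor_data_TZ], unfolded int_module_simps carrier_CM]
  and pr = balanced_mapD[OF tensor_data.pure_balanced[OF tensor_data_TR], unfolded restr_simps carrier_CM]

definition left_additive :: "('g, 'h) monoid_scheme \<Rightarrow> ('n \<Rightarrow> 'c \<Rightarrow> 'g) \<Rightarrow> bool" where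
  "left_additive G p \<longleftrightarrow> (\<forall>b\<in>carrier N. \<forall>c\<in>carrier C. p b c \<in> carrier G) \<and>
     (\<forall>b\<in>carrier N. \<forall>b'\<in>carrier N. \<forall>c\<in>carrier C. p (b \<oplus>\<^bsub>N\<^esub> b') c = p b c \<otimes>\<^bsub>G\<^esub> p b' c)"

lemma left_additiveD:
  assumes "left_additive G p"
  shows "\<lbrakk>b \<in> carrier N; c \<in> carrier C\<rbrakk> \<Longrightarrow> p b c \<in> carrier G"
    and "\<lbrakk>b \<in> carrier N; b' \<in> carrier N; c \<in> carrier C\<rbrakk> \<Longrightarrow> p (b \<oplus>\<^bsub>N\<^esub> b') c = p b c \<otimes>\<^bsub>G\<^esub> p b' c"
  using assms by (simp_all add: left_additive_def)

lemma left_additive_pz: "left_additive TZ pz"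
  unfolding left_additive_def by (intro conjI ballI pz(1,2))

lemma left_additive_pr: "left_additive TR pr"
  unfolding left_additive_def by (intro conjI ballI pr(1,2))

text \<open>
  The value \<open>\<Sum> b s\<^sub>c \<otimes> c\<close> on \<open>b \<otimes> \<Sum> s\<^sub>c c\<close> depends only on the finitely supported family of the \<open>b s\<^sub>c\<close>
  and is additive in it; this gives additivity in \<open>b\<close> and in \<open>s\<close> at once.
\<close>

definition fin_family :: "('c \<Rightarrow> 'n) \<Rightarrow> bool" where
  "fin_family u \<longleftrightarrow> u \<in> carrier C \<rightarrow> carrier N \<and> finite {c \<in> carrier C. u c \<noteq> \<zero>\<^bsub>N\<^esub>}"

definition pair_sum :: "('g, 'h) monoid_scheme \<Rightarrow> ('n \<Rightarrow> 'c \<Rightarrow> 'g) \<Rightarrow> ('c \<Rightarrow> 'n) \<Rightarrow> 'g" where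
  "pair_sum G p u = finprod G (\<lambda>c. p (u c) c) {c \<in> carrier C. u c \<noteq> \<zero>\<^bsub>N\<^esub>}"

lemma pair_fun:
  assumes "left_additive G p" "u \<in> carrier C \<rightarrow> carrier N" "F \<subseteq> carrier C"
  shows "(\<lambda>c. p (u c) c) \<in> F \<rightarrow> carrier G"
proof (rule funcsetI)
  fix c assume "c \<in> F"
  then have c: "c \<in> carrier C" using assms(3) by blast
  show "p (u c) c \<in> carrier G" by (rule left_additiveD(1)[OF assms(1) funcset_mem[OF assms(2) c] c])
qed

lemma pair_sum_superset:
  assumes G: "comm_group G" and la: "left_additive G p" and u: "u \<in> carrier C \<rightarrow> carrier N"
    and F: "finite F" "F \<subseteq> carrier C" "\<And>c. c \<in> carrier C - F \<Longrightarrow> u c = \<zero>\<^bsub>N\<^esub>"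
  shows "pair_sum G p u = finprod G (\<lambda>c. p (u c) c) F"
  unfolding pair_sum_def
proof (rule comm_monoid.finprod_mono_neutral_cong_left)
  interpret G: comm_group G by (rule G)
  show "Group.comm_monoid G" by (rule G.comm_monoid_axioms)
  show "finite F" by (rule F(1))
  show "{c \<in> carrier C. u c \<noteq> \<zero>\<^bsub>N\<^esub>} \<subseteq> F" using F(3) by blast
  show "p (u c) c = \<one>\<^bsub>G\<^esub>" if "c \<in> F - {c \<in> carrier C. u c \<noteq> \<zero>\<^bsub>N\<^esub>}" for c
  proof -
    have c: "c \<in> carrier C" "u c = \<zero>\<^bsub>N\<^esub>" using that F(2) by auto
    show ?thesis
      unfolding c(2) by (rule additive_zero[OF abelian_group_N G.group_axioms])
        (use left_additiveD[OF la] c(1) in auto)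
  qed
  show "(\<lambda>c. p (u c) c) \<in> F \<rightarrow> carrier G" by (rule pair_fun[OF la u F(2)])
qed simp

lemma pair_sum_add:
  assumes G: "comm_group G" and la: "left_additive G p" and u: "fin_family u" and v: "fin_family v"
    and w: "\<And>c. c \<in> carrier C \<Longrightarrow> w c = u c \<oplus>\<^bsub>N\<^esub> v c"
  shows "pair_sum G p w = pair_sum G p u \<otimes>\<^bsub>G\<^esub> pair_sum G p v"
proof -
  interpret G: comm_group G by (rule G)
  interpret N: abelian_group N by (rule abelian_group_N)
  have uN: "u \<in> carrier C \<rightarrow> carrier N" and vN: "v \<in> carrier C \<rightarrow> carrier N"
    using u v by (auto simp: fin_family_def)
  have wN: "w \<in> carrier C \<rightarrow> carrier N" using w funcset_mem[OF uN] funcset_mem[OF vN] by auto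
  let ?F = "{c \<in> carrier C. u c \<noteq> \<zero>\<^bsub>N\<^esub>} \<union> {c \<in> carrier C. v c \<noteq> \<zero>\<^bsub>N\<^esub>}"
  have F: "finite ?F" "?F \<subseteq> carrier C" using u v by (auto simp: fin_family_def)
  note sup = pair_sum_superset[OF G la _ F]
  have "pair_sum G p w = finprod G (\<lambda>c. p (w c) c) ?F"
    by (rule sup[OF wN]) (simp add: w)
  also have "\<dots> = finprod G (\<lambda>c. p (u c) c \<otimes>\<^bsub>G\<^esub> p (v c) c) ?F"
  proof (rule G.finprod_cong')
    fix c assume "c \<in> ?F"
    then have c: "c \<in> carrier C" by blast
    show "p (w c) c = p (u c) c \<otimes>\<^bsub>G\<^esub> p (v c) c"
      unfolding w[OF c] by (rule left_additiveD(2)[OF la funcset_mem[OF uN c] funcset_mem[OF vN c] c])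
  qed (use pair_fun[OF la uN F(2)] pair_fun[OF la vN F(2)] in auto)
  also have "\<dots> = finprod G (\<lambda>c. p (u c) c) ?F \<otimes>\<^bsub>G\<^esub> finprod G (\<lambda>c. p (v c) c) ?F"
    by (rule G.finprod_multf[OF pair_fun[OF la uN F(2)] pair_fun[OF la vN F(2)]])
  also have "finprod G (\<lambda>c. p (u c) c) ?F = pair_sum G p u" by (rule sup[OF uN, symmetric]) simp
  also have "finprod G (\<lambda>c. p (v c) c) ?F = pair_sum G p v" by (rule sup[OF vN, symmetric]) simp
  finally show ?thesis .
qed

abbreviation "eval_sum G p b s \<equiv> pair_sum G p (\<lambda>c. s c \<odot>\<^bsub>N\<^esub> b)"

lemma eval_family:
  assumes b: "b \<in> carrier N" and s: "s \<in> FS (carrier C)"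
  shows "fin_family (\<lambda>c. s c \<odot>\<^bsub>N\<^esub> b)"
proof -
  have "{c \<in> carrier C. s c \<odot>\<^bsub>N\<^esub> b \<noteq> \<zero>\<^bsub>N\<^esub>} \<subseteq>
      {c \<in> carrier C. s c \<notin> {r \<in> carrier S. r \<odot>\<^bsub>N\<^esub> b = \<zero>\<^bsub>N\<^esub>}}" by blast
  then have "finite {c \<in> carrier C. s c \<odot>\<^bsub>N\<^esub> b \<noteq> \<zero>\<^bsub>N\<^esub>}"
    using has_csum_finite_part[OF formal_sums_zconv[OF s] N_ann_open[OF b]] finite_subset by blast
  then show ?thesis
    unfolding fin_family_def using N_smult_closed[OF formal_sums_carrier[OF s] b] by simp
qed

lemma eval_sum_closed:
  assumes G: "comm_group G" and la: "left_additive G p"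
    and b: "b \<in> carrier N" and s: "s \<in> FS (carrier C)"
  shows "eval_sum G p b s \<in> carrier G"
proof -
  interpret G: comm_group G by (rule G)
  show ?thesis
    unfolding pair_sum_def
    by (rule G.finprod_closed[OF pair_fun[OF la]]) (use eval_family[OF b s] in \<open>auto simp: fin_family_def\<close>)
qed

lemma eval_sum_balanced:
  assumes G: "comm_group G" and la: "left_additive G p"
  shows "balanced_map \<Z> (int_module N) (int_module FM) G (eval_sum G p)"
proof (rule int_balanced_mapI[OF abelian_group_N abelian_group_formal_module G], unfold formal_module_simps)
  show "eval_sum G p b s \<in> carrier G" if "b \<in> carrier N" "s \<in> FS (carrier C)" for b s
    by (rule eval_sum_closed[OF G la that])
  show "eval_sum G p (b \<oplus>\<^bsub>N\<^esub> b') s = eval_sum G p b s \<otimes>\<^bsub>G\<^esub> eval_sum G p b' s"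
    if "b \<in> carrier N" "b' \<in> carrier N" "s \<in> FS (carrier C)" for b b' s
    by (rule pair_sum_add[OF G la eval_family[OF that(1,3)] eval_family[OF that(2,3)]])
      (rule N_smult_r_distr[OF formal_sums_carrier[OF that(3)] that(1,2)])
  show "eval_sum G p b (formal_add S (carrier C) s t) = eval_sum G p b s \<otimes>\<^bsub>G\<^esub> eval_sum G p b t"
    if "b \<in> carrier N" "s \<in> FS (carrier C)" "t \<in> FS (carrier C)" for b s t
  proof (rule pair_sum_add[OF G la eval_family[OF that(1,2)] eval_family[OF that(1,3)]])
    fix c assume c: "c \<in> carrier C"
    show "formal_add S (carrier C) s t c \<odot>\<^bsub>N\<^esub> b = s c \<odot>\<^bsub>N\<^esub> b \<oplus>\<^bsub>N\<^esub> t c \<odot>\<^bsub>N\<^esub> b"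
      using N_smult_l_distr[OF formal_sums_carrier[OF that(2) c] formal_sums_carrier[OF that(3) c] that(1)] c
      by (simp add: formal_add_def)
  qed
qed

lemma act_balanced: "balanced_map \<Z> (int_module N) (int_module FM) TZ (\<lambda>b s. pz b (\<pi> s))"
proof (rule int_balanced_mapI[OF abelian_group_N abelian_group_formal_module comm_group_TZ],
    unfold formal_module_simps)
  show "pz b (\<pi> s) \<in> carrier TZ" if "b \<in> carrier N" "s \<in> FS (carrier C)" for b s
    by (rule pz(1)[OF that(1) contra_act_closed[OF that(2)]])
  show "pz (b \<oplus>\<^bsub>N\<^esub> b') (\<pi> s) = pz b (\<pi> s) \<otimes>\<^bsub>TZ\<^esub> pz b' (\<pi> s)"
    if "b \<in> carrier N" "b' \<in> carrier N" "s \<in> FS (carrier C)" for b b' s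
    by (rule pz(2)[OF that(1,2) contra_act_closed[OF that(3)]])
  show "pz b (\<pi> (formal_add S (carrier C) s t)) = pz b (\<pi> s) \<otimes>\<^bsub>TZ\<^esub> pz b (\<pi> t)"
    if "b \<in> carrier N" "s \<in> FS (carrier C)" "t \<in> FS (carrier C)" for b s t
    unfolding act_add[OF that(2,3)]
    by (rule pz(3)[OF that(1) contra_act_closed[OF that(2)] contra_act_closed[OF that(3)]])
qed

lemma Act_hom: "Act \<in> hom TF TZ"
  unfolding contratensor_act_def by (rule tensor_data.tensor_lift(1)[OF tensor_data_TF comm_group_TZ act_balanced])

lemma Act_pure: "\<lbrakk>b \<in> carrier N; s \<in> FS (carrier C)\<rbrakk> \<Longrightarrow> Act (pf b s) = pz b (\<pi> s)"
  unfolding contratensor_act_def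
  by (rule tensor_data.tensor_lift(2)[OF tensor_data_TF comm_group_TZ act_balanced])
    simp_all

lemma Ev_eq: "Ev = tensor_lift \<Z> (int_module N) (int_module FM) TZ (eval_sum TZ pz)"
  unfolding contratensor_eval_def pair_sum_def ..

lemma Ev_hom: "Ev \<in> hom TF TZ"
  unfolding Ev_eq
  by (rule tensor_data.tensor_lift(1)[OF tensor_data_TF comm_group_TZ eval_sum_balanced[OF comm_group_TZ left_additive_pz]])

lemma Ev_pure: "\<lbrakk>b \<in> carrier N; s \<in> FS (carrier C)\<rbrakk> \<Longrightarrow> Ev (pf b s) = eval_sum TZ pz b s"
  unfolding Ev_eq
  by (rule tensor_data.tensor_lift(2)[OF tensor_data_TF comm_group_TZ eval_sum_balanced[OF comm_group_TZ left_additive_pz]])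
    simp_all

text \<open>
  The relations defining the contratensor product already hold in \<open>N \<otimes>\<^sub>R C\<close>: an infinite formal
  sum is a finite one with coefficients in \<open>R\<close> plus a finite combination \<open>\<Sum> a t\<^sub>a\<close> with all \<open>a\<close>
  annihilating \<open>b\<close>.
\<close>

lemma pure_act_eq_eval:
  assumes b: "b \<in> carrier N" and s: "s \<in> FS (carrier C)"
  shows "pr b (\<pi> s) = eval_sum TR pr b s"
proof -
  interpret G: comm_group TR by (rule comm_group_TR)
  interpret RM: left_module R "restr CM" by (rule left_module_restr_CM)
  let ?u = "formal_unit S (carrier C)"
  obtain n where n: "J n \<subseteq> {r \<in> carrier S. r \<odot>\<^bsub>N\<^esub> b = \<zero>\<^bsub>N\<^esub>}" using J_base[OF N_ann_open[OF b]] by blast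
  obtain F r A t where F: "finite F" "F \<subseteq> carrier C" and r: "r \<in> F \<rightarrow> carrier R"
    and sJ: "\<forall>x\<in>carrier C - F. s x \<in> J n" and rJ: "\<forall>x\<in>F. s x \<ominus> \<rho> (r x) \<in> J n"
    and A: "finite A" "A \<subseteq> carrier R" "\<rho> ` A \<subseteq> J n" and t: "t \<in> A \<rightarrow> FS (carrier C)"
    and eq: "\<pi> s = finsum (restr CM) (\<lambda>x. r x \<odot>\<^bsub>restr CM\<^esub> \<pi> (?u x)) F
      \<oplus>\<^bsub>restr CM\<^esub> finsum (restr CM) (\<lambda>a. a \<odot>\<^bsub>restr CM\<^esub> \<pi> (t a)) A"
    by (rule linear_decompose[OF left_module_restr_CM act_linear s, of n]) (rule that; assumption)
  have rc: "r x \<in> carrier R" if "x \<in> F" for x by (rule funcset_mem[OF r that])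
  have ac: "a \<in> carrier R" if "a \<in> A" for a using A(2) that by blast
  have tc: "\<pi> (t a) \<in> carrier C" if "a \<in> A" for a by (rule contra_act_closed[OF funcset_mem[OF t that]])
  have uc: "\<pi> (?u c) = c" "c \<in> carrier C" if "c \<in> F" for c using contra_act_unit F(2) that by auto
  have sum: "pr b (finsum (restr CM) g I) = finprod TR (\<lambda>i. pr b (g i)) I"
    if "finite I" "\<And>i. i \<in> I \<Longrightarrow> g i \<in> carrier (restr CM)" for g :: "'z \<Rightarrow> 'c" and I
    by (rule additive_finsum[OF abelian_group_restr[OF abelian_group_CM] comm_group_TR])
      (use pr(1)[OF b] pr(3)[OF b] that in auto)
  have zero: "pr \<zero>\<^bsub>N\<^esub> c = \<one>\<^bsub>TR\<^esub>" if "c \<in> carrier C" for c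
    by (rule additive_zero[OF abelian_group_N G.group_axioms]) (use pr(1,2) that in auto)
  have sN: "(\<lambda>c. s c \<odot>\<^bsub>N\<^esub> b) \<in> carrier C \<rightarrow> carrier N"
    using eval_family[OF b s] by (simp add: fin_family_def)
  have F_closed: "r c \<odot>\<^bsub>restr CM\<^esub> \<pi> (?u c) \<in> carrier (restr CM)" if "c \<in> F" for c
    by (rule RM.smult_closed[OF rc[OF that]]) (simp add: uc[OF that])
  have A_closed: "a \<odot>\<^bsub>restr CM\<^esub> \<pi> (t a) \<in> carrier (restr CM)" if "a \<in> A" for a
    by (rule RM.smult_closed[OF ac[OF that]]) (simp add: tc[OF that])
  have "pr b (finsum (restr CM) (\<lambda>x. r x \<odot>\<^bsub>restr CM\<^esub> \<pi> (?u x)) F)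
      = finprod TR (\<lambda>c. pr b (r c \<odot>\<^bsub>restr CM\<^esub> \<pi> (?u c))) F"
    by (rule sum[OF F(1) F_closed])
  also have "\<dots> = finprod TR (\<lambda>c. pr (s c \<odot>\<^bsub>N\<^esub> b) c) F"
  proof (rule G.finprod_cong')
    fix c assume c: "c \<in> F"
    have "s c \<odot>\<^bsub>N\<^esub> b = \<rho> (r c) \<odot>\<^bsub>N\<^esub> b"
      by (rule N_smult_cong[OF b formal_sums_carrier[OF s uc(2)[OF c]] rho_closed[OF rc[OF c]]])
        (use rJ c n in auto)
    then show "pr b (r c \<odot>\<^bsub>restr CM\<^esub> \<pi> (?u c)) = pr (s c \<odot>\<^bsub>N\<^esub> b) c"
      using pr(4)[OF rc[OF c] b uc(2)[OF c]] uc[OF c] by simp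
  qed (use pair_fun[OF left_additive_pr sN F(2)] in auto)
  also have "\<dots> = eval_sum TR pr b s"
    by (rule pair_sum_superset[OF comm_group_TR left_additive_pr sN F, symmetric]) (use sJ n in auto)
  finally have 1: "pr b (finsum (restr CM) (\<lambda>x. r x \<odot>\<^bsub>restr CM\<^esub> \<pi> (?u x)) F) = eval_sum TR pr b s" .
  have "pr b (finsum (restr CM) (\<lambda>a. a \<odot>\<^bsub>restr CM\<^esub> \<pi> (t a)) A)
      = finprod TR (\<lambda>a. pr b (a \<odot>\<^bsub>restr CM\<^esub> \<pi> (t a))) A"
    by (rule sum[OF A(1) A_closed])
  also have "\<dots> = finprod TR (\<lambda>a. \<one>\<^bsub>TR\<^esub>) A"
  proof (rule G.finprod_cong')
    fix a assume a: "a \<in> A"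
    have "\<rho> a \<odot>\<^bsub>N\<^esub> b = \<zero>\<^bsub>N\<^esub>" using A(3) n a by auto
    then show "pr b (a \<odot>\<^bsub>restr CM\<^esub> \<pi> (t a)) = \<one>\<^bsub>TR\<^esub>"
      using pr(4)[OF ac[OF a] b tc[OF a]] zero[OF tc[OF a]] by simp
  qed auto
  also have "\<dots> = \<one>\<^bsub>TR\<^esub>" by (rule G.finprod_one)
  finally have 2: "pr b (finsum (restr CM) (\<lambda>a. a \<odot>\<^bsub>restr CM\<^esub> \<pi> (t a)) A) = \<one>\<^bsub>TR\<^esub>" .
  have c1: "finsum (restr CM) (\<lambda>x. r x \<odot>\<^bsub>restr CM\<^esub> \<pi> (?u x)) F \<in> carrier (restr CM)"
    by (rule RM.M.finsum_closed) (use F_closed in blast)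
  have c2: "finsum (restr CM) (\<lambda>a. a \<odot>\<^bsub>restr CM\<^esub> \<pi> (t a)) A \<in> carrier (restr CM)"
    by (rule RM.M.finsum_closed) (use A_closed in blast)
  have "pr b (\<pi> s) = eval_sum TR pr b s \<otimes>\<^bsub>TR\<^esub> \<one>\<^bsub>TR\<^esub>"
    unfolding eq restr_simps(2) pr(3)[OF b c1[unfolded restr_simps carrier_CM] c2[unfolded restr_simps carrier_CM], folded restr_simps(4)]
    using 1 2 by simp
  then show ?thesis
    using eval_sum_closed[OF comm_group_TR left_additive_pr b s] by simp
qed

lemma diff_hom: "(\<lambda>t. Act t \<otimes>\<^bsub>TZ\<^esub> inv\<^bsub>TZ\<^esub> Ev t) \<in> hom TF TZ"
proof (rule homI)
  interpret G: comm_group TZ by (rule comm_group_TZ)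
  fix t u assume t: "t \<in> carrier TF" and u: "u \<in> carrier TF"
  note c = hom_in_carrier[OF Act_hom t] hom_in_carrier[OF Ev_hom t]
    hom_in_carrier[OF Act_hom u] hom_in_carrier[OF Ev_hom u]
  show "Act t \<otimes>\<^bsub>TZ\<^esub> inv\<^bsub>TZ\<^esub> Ev t \<in> carrier TZ" by (intro G.m_closed G.inv_closed c)
  show "Act (t \<otimes>\<^bsub>TF\<^esub> u) \<otimes>\<^bsub>TZ\<^esub> inv\<^bsub>TZ\<^esub> Ev (t \<otimes>\<^bsub>TF\<^esub> u) =
      (Act t \<otimes>\<^bsub>TZ\<^esub> inv\<^bsub>TZ\<^esub> Ev t) \<otimes>\<^bsub>TZ\<^esub> (Act u \<otimes>\<^bsub>TZ\<^esub> inv\<^bsub>TZ\<^esub> Ev u)"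
    unfolding hom_mult[OF Act_hom t u] hom_mult[OF Ev_hom t u]
    using c by (simp add: G.inv_mult G.m_ac)
qed

lemma subgroup_image: "subgroup (contratensor_image S T N C) TZ"
proof -
  interpret h: group_hom TF TZ "\<lambda>t. Act t \<otimes>\<^bsub>TZ\<^esub> inv\<^bsub>TZ\<^esub> Ev t"
    by (intro group_hom.intro group_hom_axioms.intro diff_hom comm_group.axioms(2) comm_group_TF comm_group_TZ)
  show ?thesis unfolding contratensor_image_def by (rule h.img_is_subgroup)
qed

lemma comm_group_Q: "comm_group Q"
  unfolding contratensor_def by (rule comm_group.abelian_FactGroup[OF comm_group_TZ subgroup_image])

lemma normal_image: "contratensor_image S T N C \<lhd> TZ"
  by (rule comm_group.subgroup_imp_normal[OF comm_group_TZ subgroup_image])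

abbreviation "qproj u \<equiv> contratensor_image S T N C #>\<^bsub>TZ\<^esub> u"

lemma qproj_hom: "(\<lambda>u. qproj u) \<in> hom TZ Q"
  unfolding contratensor_def by (rule normal.r_coset_hom_Mod[OF normal_image])

lemma qproj_eq:
  assumes b: "b \<in> carrier N" and s: "s \<in> FS (carrier C)"
  shows "qproj (pz b (\<pi> s)) = qproj (eval_sum TZ pz b s)"
proof -
  interpret G: comm_group TZ by (rule comm_group_TZ)
  have c: "pz b (\<pi> s) \<in> carrier TZ" "eval_sum TZ pz b s \<in> carrier TZ"
    by (rule pz(1)[OF b contra_act_closed[OF s]], rule eval_sum_closed[OF comm_group_TZ left_additive_pz b s])
  have "pf b s \<in> carrier TF"
    by (rule tensor_data.pure_closed[OF tensor_data_TF]) (use b s in simp_all)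
  then have "Act (pf b s) \<otimes>\<^bsub>TZ\<^esub> inv\<^bsub>TZ\<^esub> Ev (pf b s) \<in> contratensor_image S T N C"
    unfolding contratensor_image_def by (rule imageI)
  then have "pz b (\<pi> s) \<otimes>\<^bsub>TZ\<^esub> inv\<^bsub>TZ\<^esub> eval_sum TZ pz b s \<in> contratensor_image S T N C"
    unfolding Act_pure[OF b s] Ev_pure[OF b s] .
  then have "pz b (\<pi> s) \<in> qproj (eval_sum TZ pz b s)"
    using c unfolding r_coset_def by (auto intro!: bexI simp: G.m_assoc)
  then show ?thesis using G.repr_independence[OF _ c(2) subgroup_image] by simp
qed

text \<open>
  As \<open>a y\<close> is the value of the formal sum \<open>a [y]\<close>, being balanced over \<open>R\<close> is an instance of the relation
  that defines the contratensor product.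
\<close>

lemma pq_balanced: "balanced_map R (restr N) (restr CM) Q pq"
proof (rule balanced_mapI, unfold restr_simps carrier_CM pure_contratensor_def)
  show "qproj (pz x y) \<in> carrier Q" if "x \<in> carrier N" "y \<in> carrier C" for x y
    by (rule hom_in_carrier[OF qproj_hom pz(1)[OF that]])
  show "qproj (pz (x \<oplus>\<^bsub>N\<^esub> x') y) = qproj (pz x y) \<otimes>\<^bsub>Q\<^esub> qproj (pz x' y)"
    if "x \<in> carrier N" "x' \<in> carrier N" "y \<in> carrier C" for x x' y
    unfolding pz(2)[OF that] by (rule hom_mult[OF qproj_hom pz(1)[OF that(1,3)] pz(1)[OF that(2,3)]])
  show "qproj (pz x (y \<oplus>\<^bsub>CM\<^esub> y')) = qproj (pz x y) \<otimes>\<^bsub>Q\<^esub> qproj (pz x y')"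
    if "x \<in> carrier N" "y \<in> carrier C" "y' \<in> carrier C" for x y y'
    unfolding pz(3)[OF that] by (rule hom_mult[OF qproj_hom pz(1)[OF that(1,2)] pz(1)[OF that(1,3)]])
  fix a x y assume a: "a \<in> carrier R" and x: "x \<in> carrier N" and y: "y \<in> carrier C"
  let ?s = "formal_scale S (carrier C) (\<rho> a) (formal_unit S (carrier C) y)"
  have s: "?s \<in> FS (carrier C)" by (rule formal_scale_FS[OF formal_unit_FS rho_closed[OF a]])
  have "\<pi> ?s = \<rho> a \<odot>\<^bsub>CM\<^esub> y" using act_scale[OF formal_unit_FS rho_closed[OF a]] contra_act_unit[OF y] by simp
  moreover have "eval_sum TZ pz x ?s = pz (\<rho> a \<odot>\<^bsub>N\<^esub> x) y"
  proof -
    interpret G: comm_group TZ by (rule comm_group_TZ)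
    have sy: "?s y = \<rho> a" using y a by (simp add: formal_scale_def formal_unit_def)
    have "eval_sum TZ pz x ?s = finprod TZ (\<lambda>c. pz (?s c \<odot>\<^bsub>N\<^esub> x) c) {y}"
      by (rule pair_sum_superset[OF comm_group_TZ left_additive_pz])
        (use y a N_smult_closed[OF formal_sums_carrier[OF s] x] in \<open>auto simp: formal_scale_def formal_unit_def N_zero_smult[OF x]\<close>)
    also have "\<dots> = pz (?s y \<odot>\<^bsub>N\<^esub> x) y"
      using pz(1)[OF N_smult_closed[OF rho_closed[OF a] x] y] sy by (subst G.finprod_insert) auto
    finally show ?thesis unfolding sy .
  qed
  ultimately show "qproj (pz (\<rho> a \<odot>\<^bsub>N\<^esub> x) y) = qproj (pz x (\<rho> a \<odot>\<^bsub>CM\<^esub> y))"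
    using qproj_eq[OF x s] by simp
qed

lemma pr_int_balanced: "balanced_map \<Z> (int_module N) (int_module CM) TR pr"
  by (rule int_balanced_mapI[OF abelian_group_N abelian_group_CM comm_group_TR])
    (simp_all only: carrier_CM pr(1-3))

text \<open>
  The inverse is induced by the projection of \<open>N \<otimes>\<^sub>\<int> C\<close> onto \<open>N \<otimes>\<^sub>R C\<close>, which by \<open>pure_act_eq_eval\<close> identifies
  the two maps whose difference has the contratensor product as its cokernel.
\<close>

lemma comparison_iso:
  "tensor_lift R (restr N) (restr CM) Q pq \<in> iso TR Q"
proof -
  interpret TR: comm_group TR by (rule comm_group_TR)
  interpret Q: comm_group Q by (rule comm_group_Q)
  interpret TZ: comm_group TZ by (rule comm_group_TZ)
  let ?\<kappa> = "tensor_lift R (restr N) (restr CM) Q pq"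
  let ?\<chi> = "tensor_lift \<Z> (int_module N) (int_module CM) TR pr"
  have \<kappa>: "?\<kappa> \<in> hom TR Q"
    by (rule tensor_data.tensor_lift(1)[OF tensor_data_TR comm_group_Q pq_balanced])
  have \<kappa>_pure: "?\<kappa> (pr b c) = qproj (pz b c)" if "b \<in> carrier N" "c \<in> carrier C" for b c
    using tensor_data.tensor_lift(2)[OF tensor_data_TR comm_group_Q pq_balanced, of b c] that
    by (simp add: pure_contratensor_def)
  have \<chi>: "?\<chi> \<in> hom TZ TR"
    by (rule tensor_data.tensor_lift(1)[OF tensor_data_TZ comm_group_TR pr_int_balanced])
  have \<chi>_pure: "?\<chi> (pz b c) = pr b c" if "b \<in> carrier N" "c \<in> carrier C" for b c
    using tensor_data.tensor_lift(2)[OF tensor_data_TZ comm_group_TR pr_int_balanced, of b c] that by simp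
  interpret \<chi>: group_hom TZ TR ?\<chi>
    by (intro group_hom.intro group_hom_axioms.intro \<chi> TZ.group_axioms TR.group_axioms)
  have \<chi>_eval: "?\<chi> (eval_sum TZ pz b s) = eval_sum TR pr b s"
    if b: "b \<in> carrier N" and s: "s \<in> FS (carrier C)" for b s
  proof -
    let ?F = "{c \<in> carrier C. s c \<odot>\<^bsub>N\<^esub> b \<noteq> \<zero>\<^bsub>N\<^esub>}"
    have c: "s c \<odot>\<^bsub>N\<^esub> b \<in> carrier N" if "c \<in> carrier C" for c
      by (rule N_smult_closed[OF formal_sums_carrier[OF s that] b])
    have prod: "?\<chi> (finprod TZ (\<lambda>c. pz (s c \<odot>\<^bsub>N\<^esub> b) c) F) = finprod TR (\<lambda>c. pr (s c \<odot>\<^bsub>N\<^esub> b) c) F"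
      if "finite F" "F \<subseteq> carrier C" for F
      using that
    proof (induction F)
      case empty
      show ?case by simp
    next
      case (insert x F)
      have xC: "x \<in> carrier C" and FC: "F \<subseteq> carrier C" using insert.prems by auto
      have f1: "(\<lambda>c. pz (s c \<odot>\<^bsub>N\<^esub> b) c) \<in> F \<rightarrow> carrier TZ" using pz(1)[OF c] FC by auto
      have f2: "(\<lambda>c. pr (s c \<odot>\<^bsub>N\<^esub> b) c) \<in> F \<rightarrow> carrier TR" using pr(1)[OF c] FC by auto
      have "?\<chi> (finprod TZ (\<lambda>c. pz (s c \<odot>\<^bsub>N\<^esub> b) c) (insert x F)) =
          ?\<chi> (pz (s x \<odot>\<^bsub>N\<^esub> b) x) \<otimes>\<^bsub>TR\<^esub> ?\<chi> (finprod TZ (\<lambda>c. pz (s c \<odot>\<^bsub>N\<^esub> b) c) F)"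
        unfolding TZ.finprod_insert[OF insert.hyps f1 pz(1)[OF c[OF xC] xC]]
        by (rule \<chi>.hom_mult[OF pz(1)[OF c[OF xC] xC] TZ.finprod_closed[OF f1]])
      also have "\<dots> = pr (s x \<odot>\<^bsub>N\<^esub> b) x \<otimes>\<^bsub>TR\<^esub> finprod TR (\<lambda>c. pr (s c \<odot>\<^bsub>N\<^esub> b) c) F"
        unfolding \<chi>_pure[OF c[OF xC] xC] insert.IH[OF FC] ..
      also have "\<dots> = finprod TR (\<lambda>c. pr (s c \<odot>\<^bsub>N\<^esub> b) c) (insert x F)"
        by (rule TR.finprod_insert[OF insert.hyps f2 pr(1)[OF c[OF xC] xC], symmetric])
      finally show ?case .
    qed
    show ?thesis unfolding pair_sum_def
      by (rule prod) (use eval_family[OF b s] in \<open>auto simp: fin_family_def\<close>)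
  qed
  have agree: "?\<chi> (Act t) = ?\<chi> (Ev t)" if t: "t \<in> carrier TF" for t
  proof (rule tensor_data.tensor_hom_eq[OF tensor_data_TF TR.group_axioms _ _ _ t])
    show "(\<lambda>t. ?\<chi> (Act t)) \<in> hom TF TR" using hom_compose[OF Act_hom \<chi>] by (simp add: comp_def)
    show "(\<lambda>t. ?\<chi> (Ev t)) \<in> hom TF TR" using hom_compose[OF Ev_hom \<chi>] by (simp add: comp_def)
    fix b s assume "b \<in> carrier (int_module N)" "s \<in> carrier (int_module FM)"
    then have b: "b \<in> carrier N" and s: "s \<in> FS (carrier C)" by simp_all
    show "?\<chi> (Act (pf b s)) = ?\<chi> (Ev (pf b s))"
      unfolding Act_pure[OF b s] Ev_pure[OF b s] \<chi>_pure[OF b contra_act_closed[OF s]] \<chi>_eval[OF b s]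
      by (rule pure_act_eq_eval[OF b s])
  qed
  have "contratensor_image S T N C \<subseteq> kernel TZ TR ?\<chi>"
  proof
    fix u assume "u \<in> contratensor_image S T N C"
    then obtain t where t: "t \<in> carrier TF" and u: "u = Act t \<otimes>\<^bsub>TZ\<^esub> inv\<^bsub>TZ\<^esub> Ev t"
      unfolding contratensor_image_def by blast
    note c = hom_in_carrier[OF Act_hom t] hom_in_carrier[OF Ev_hom t]
    have "?\<chi> u = ?\<chi> (Ev t) \<otimes>\<^bsub>TR\<^esub> inv\<^bsub>TR\<^esub> ?\<chi> (Ev t)"
      unfolding u \<chi>.hom_mult[OF c(1) TZ.inv_closed[OF c(2)]] \<chi>.hom_inv[OF c(2)] agree[OF t] ..
    also have "\<dots> = \<one>\<^bsub>TR\<^esub>" by (rule TR.r_inv[OF \<chi>.hom_closed[OF c(2)]])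
    finally show "u \<in> kernel TZ TR ?\<chi>" using c u unfolding kernel_def by simp
  qed
  then obtain g where g: "g \<in> hom (TZ Mod contratensor_image S T N C) TR"
    and g_proj: "\<And>u. u \<in> carrier TZ \<Longrightarrow> g (qproj u) = ?\<chi> u"
    using \<chi>.FactGroup_universal_kernel[OF normal_image] by metis
  have g: "g \<in> hom Q TR" using g unfolding contratensor_def .
  have g\<kappa>: "g (?\<kappa> t) = t" if t: "t \<in> carrier TR" for t
  proof (rule tensor_data.tensor_hom_eq[OF tensor_data_TR TR.group_axioms _ _ _ t])
    show "(\<lambda>t. g (?\<kappa> t)) \<in> hom TR TR" using hom_compose[OF \<kappa> g] by (simp add: comp_def)
    show "(\<lambda>t. t) \<in> hom TR TR" by (rule homI) auto
    fix b c assume "b \<in> carrier (restr N)" "c \<in> carrier (restr CM)"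
    then have b: "b \<in> carrier N" and c: "c \<in> carrier C" by simp_all
    show "g (?\<kappa> (pr b c)) = pr b c"
      unfolding \<kappa>_pure[OF b c] g_proj[OF pz(1)[OF b c]] by (rule \<chi>_pure[OF b c])
  qed
  have \<kappa>g: "?\<kappa> (g q) = q" if q: "q \<in> carrier Q" for q
  proof -
    have "?\<kappa> (?\<chi> u) = qproj u" if u: "u \<in> carrier TZ" for u
    proof (rule tensor_data.tensor_hom_eq[OF tensor_data_TZ Q.group_axioms _ qproj_hom _ u])
      show "(\<lambda>u. ?\<kappa> (?\<chi> u)) \<in> hom TZ Q" using hom_compose[OF \<chi> \<kappa>] by (simp add: comp_def)
      fix b c assume "b \<in> carrier (int_module N)" "c \<in> carrier (int_module CM)"
      then have b: "b \<in> carrier N" and c: "c \<in> carrier C" by simp_all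
      show "?\<kappa> (?\<chi> (pz b c)) = qproj (pz b c)"
        unfolding \<chi>_pure[OF b c] by (rule \<kappa>_pure[OF b c])
    qed
    moreover obtain u where "u \<in> carrier TZ" "q = qproj u"
      using q unfolding contratensor_def carrier_FactGroup by blast
    ultimately show ?thesis using g_proj by simp
  qed
  have "bij_betw ?\<kappa> (carrier TR) (carrier Q)"
    by (rule bij_betw_byWitness[of _ g]) (use g\<kappa> \<kappa>g hom_in_carrier[OF \<kappa>] hom_in_carrier[OF g] in auto)
  then show ?thesis using \<kappa> by (simp add: iso_def)
qed

end

section \<open>Contramodules over the completion\<close>


theorem corollary6p7:
  fixes R :: "('a, 'm) ring_scheme" and \<G> :: "'a set set"
  assumes "ring R"
    and "right_gabriel_topology R \<G>"
    and "\<exists>\<B>. gabriel_base \<G> \<B> \<and> countable \<B> \<and> (\<forall>I\<in>\<B>. fg_right_ideal I R)"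
  shows "(\<forall>(C :: ('a set \<Rightarrow> 'a set, 'c) contramodule) (D :: ('a set \<Rightarrow> 'a set, 'd) contramodule).
            contramodule (gabriel_completion R \<G>) (completion_topology R \<G>) C \<longrightarrow>
            contramodule (gabriel_completion R \<G>) (completion_topology R \<G>) D \<longrightarrow>
            bij_betw (\<lambda>f. f)
              (contra_hom (gabriel_completion R \<G>) (completion_topology R \<G>) C D)
              (lmod_hom R (forget R \<G> C) (forget R \<G> D))) \<and>
         (\<forall>(C :: ('a set \<Rightarrow> 'a set, 'c) contramodule) (N :: ('a set \<Rightarrow> 'a set, 'n) module).
            contramodule (gabriel_completion R \<G>) (completion_topology R \<G>) C \<longrightarrow>
            discrete_right_module (gabriel_completion R \<G>) (completion_topology R \<G>) N \<longrightarrow>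
            contratensor_comparison R \<G> N C \<in>
              iso (tensor R (forget_right R \<G> N) (forget R \<G> C))
                  (contratensor (gabriel_completion R \<G>) (completion_topology R \<G>) N C)) \<and>
         (\<forall>(C :: ('a set \<Rightarrow> 'a set, 'c) contramodule). \<forall>I\<in>\<G>.
            contramodule (gabriel_completion R \<G>) (completion_topology R \<G>) C \<longrightarrow>
            ideal_smult I (forget R \<G> C) =
              ideal_contra (gabriel_completion R \<G>) (completion_topology R \<G>) (completion_ideal R \<G> I) C)"
proof -
  interpret gabriel_ring R \<G>
    by (rule gabriel_ring.intro[OF assms(1,2)])
  obtain \<B> where \<B>: "gabriel_base \<G> \<B>" "countable \<B>" "\<forall>I\<in>\<B>. fg_right_ideal I R"
    using assms(3) by blast
  obtain B :: "nat \<Rightarrow> 'a set" where B: "B 0 = carrier R" "\<And>n. B n \<in> \<G>" "\<And>m n. m \<le> n \<Longrightarrow> B n \<subseteq> B m"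
    "\<And>K. K \<in> \<G> \<Longrightarrow> \<exists>n. B n \<subseteq> K" "\<And>n. fg_right_ideal (B n) R"
    using fg_base_sequence[OF \<B>(1,2)] \<B>(3) by metis
  interpret L: fg_dense \<RR> \<TT> R \<rho> "\<lambda>n. \<NN> (B n)"
    by (rule fg_dense_completion[OF B])
  show ?thesis
  proof (intro conjI allI impI ballI)
    fix C :: "('a set \<Rightarrow> 'a set, 'c) contramodule" and D :: "('a set \<Rightarrow> 'a set, 'd) contramodule"
    assume C: "contramodule \<RR> \<TT> C" and D: "contramodule \<RR> \<TT> D"
    have "contra_hom \<RR> \<TT> C D = lmod_hom R (forget R \<G> C) (forget R \<G> D)"
      unfolding forget_def
      by (intro equalityI L.contra_hom_subset_lmod_hom L.lmod_hom_subset_contra_hom C D)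
    then show "bij_betw (\<lambda>f. f) (contra_hom \<RR> \<TT> C D) (lmod_hom R (forget R \<G> C) (forget R \<G> D))"
      by (simp add: bij_betw_def)
  next
    fix C :: "('a set \<Rightarrow> 'a set, 'c) contramodule" and N :: "('a set \<Rightarrow> 'a set, 'n) module"
    assume C: "contramodule \<RR> \<TT> C" and N: "discrete_right_module \<RR> \<TT> N"
    interpret C: discrete_contratensor \<RR> \<TT> R \<rho> "\<lambda>n. \<NN> (B n)" C N
      by (intro discrete_contratensor.intro discrete_contratensor_axioms.intro fg_contramodule.intro
          topring_contramodule.intro L.fg_dense_axioms L.linear_top_ring_axioms C N)
    show "contratensor_comparison R \<G> N C \<in>
        iso (tensor R (forget_right R \<G> N) (forget R \<G> C)) (contratensor \<RR> \<TT> N C)"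
      unfolding contratensor_comparison_def forget_def by (rule C.comparison_iso)
  next
    fix C :: "('a set \<Rightarrow> 'a set, 'c) contramodule" and I
    assume I: "I \<in> \<G>" and C: "contramodule \<RR> \<TT> C"
    interpret C: fg_contramodule \<RR> \<TT> R \<rho> "\<lambda>n. \<NN> (B n)" C
      by (intro fg_contramodule.intro topring_contramodule.intro L.fg_dense_axioms
          L.linear_top_ring_axioms C)
    have "I = {r \<in> carrier R. \<rho> r \<in> \<NN> I}"
      using rho_completion_ideal[OF _ I] right_ideal_subset[OF right_ideals[OF I]] by blast
    then show "ideal_smult I (forget R \<G> C) = ideal_contra \<RR> \<TT> (\<NN> I) C"
      unfolding forget_def by (rule C.ideal_smult_eq_ideal_contra[OF completion_ideal_open[OF I]])
  qed
qed

end
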